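(* Assume: $p(\cdot\,|x,a)$ is continuous in $(x,a)\in\mathsf X\times\mathsf A$ with respect to total variation distance; there exist a probability measure $\lambda$ on $\mathsf X$, a constant $\alpha_0\in(0,1)$ and a bounded measurable $\phi:\mathsf X\times\mathsf A\to\mathbb R$ such that $p(D|x,a)\ge\lambda(D)\phi(x,a)$ for all Borel $D\subset\mathsf X$ and $1-\alpha_0\le\phi(x,a)$, for all $(x,a)$; $c(\cdot,a)$ is $K_c$-Lipschitz and $d_l(\cdot,a)$ is $K_l$-Lipschitz on $\mathsf X$ for all $a\in\mathsf A$ and $l=1,\dots,q$; and $\|p(\cdot\,|x,a)-p(\cdot\,|y,a)\|_{TV}\le G_p\,d_{\mathsf X}(x,y)$ for all $x,y\in\mathsf X$, $a\in\mathsf A$. Consider the average cost criterion. If $\varepsilon_{\max}(n)<\frac12\min_{l=1,\dots,q}\alpha'_l$, then $$\bigl|\min(\mathbf{CP}_n^{\mathbf k})-\min(\mathbf{CP}^{\mathbf k})\bigr|\le2\varepsilon_c(n)+\frac{4\|c\|}{\min_{l}\alpha'_l}\,\varepsilon_{\max}(n).$$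
   Context: **Model.** $\mathsf X$ (states) is a compact subset of $\mathbb R^d$, $d\ge1$, with Euclidean distance $d_{\mathsf X}$; $\mathsf A$ (actions) is a compact metric space; every action is admissible in every state. $p(\cdot\,|x,a)$ is a stochastic kernel on $\mathsf X$ given $\mathsf X\times\mathsf A$; $c,d_1,\dots,d_q:\mathsf X\times\mathsf A\to[0,\infty)$ are continuous; $\gamma$ is a probability measure on $\mathsf X$ (initial distribution); $\mathbf k=(k_1,\dots,k_q)\in[0,\infty)^q$. A policy $\pi=\{\pi_t\}$ is a sequence of stochastic kernels on $\mathsf A$ given the history spaces $\mathsf H_t=(\mathsf X\times\mathsf A)^t\times\mathsf X$; $\Pi$ is the set of all policies; $\Phi$ is the set of stochastic kernels on $\mathsf A$ given $\mathsf X$ (randomized stationary policies). $\mathbb E_\gamma^\pi$ is expectation under the law of $(X_t,A_t)_{t\ge0}$ determined by $\gamma$, $\pi$, $p$. $\|\cdot\|$ is the sup norm; $\|\mu\|_{TV}=\sup\{|\int g\,d\mu|:\|g\|\le1\}$ for signed measures. **Average criterion.** $V(\pi,\gamma)=\limsup_{T\to\infty}\frac1T\mathbb E_\gamma^\pi[\sum_{t=0}^{T-1}c(X_t,A_t)]$, and $V_l(\pi,\gamma)$ is the same with $d_l$ in place of $c$. $(\mathbf{CP}^{\mathbf k})$: minimize $V(\pi,\gamma)$ over $\pi\in\Pi$ subject to $V_l(\pi,\gamma)\le k_l$, $l=1,\dots,q$. Standing assumption: there are $\pi\in\Pi$ and $\boldsymbol\alpha'=(\alpha_1',\dots,\alpha_q')$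 with all $\alpha'_l>0$ such that $V_l(\pi,\gamma)+\alpha'_l=k_l$ for all $l$; this $\boldsymbol\alpha'$ is fixed. **Finite models.** $\alpha>0$ is a constant and, for each $n\ge1$, $\mathsf X_n=\{x_{n,1},\dots,x_{n,n}\}\subset\mathsf X$ is a set of cardinality $n$ with $\max_{x\in\mathsf X}\min_{y\in\mathsf X_n}d_{\mathsf X}(x,y)\le\alpha(1/n)^{1/d}$. $Q_n:\mathsf X\to\mathsf X_n$ is a nearest-point map (ties broken so that $Q_n$ is measurable); $\mathcal S_{n,i}=Q_n^{-1}(x_{n,i})$; $i_n(x)$ is the index with $x\in\mathcal S_{n,i_n(x)}$. $\nu_n$ is a finite measure on $\mathsf X$ with $\nu_n(\mathcal S_{n,i})>0$ for all $i$, and $\nu_{n,i}(\cdot)=\nu_n(\cdot)/\nu_n(\mathcal S_{n,i})$ on $\mathcal S_{n,i}$. MDP$_n$ has state space $\mathsf X_n$, action space $\mathsf A$, initial distribution $\gamma_n=\gamma\circ Q_n^{-1}$, and $p_n(x_{n,j}|x_{n,i},a)=\int_{\mathcal S_{n,i}}p(\mathcal S_{n,j}|x,a)\,\nu_{n,i}(dx)$, $c_n(x_{n,i},a)=\int_{\mathcal S_{n,i}}c(x,a)\,\nu_{n,i}(dx)$, $d_{l,n}(x_{n,i},a)=\int_{\mathcal S_{n,i}}d_l(x,a)\,\nu_{n,i}(dx)$. Its policies $\Pi_n$ and average costs $V_n,V_{l,n}$ are defined as for the original model. $(\mathbf{CP}_n^{\mathbf k})$: minimize $V_n(\pi,\gamma_n)$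 over $\pi\in\Pi_n$ subject to $V_{l,n}(\pi,\gamma_n)\le k_l$ for all $l$. $\min(\cdot)$ denotes the optimal value. Also let $q_n(\cdot|x,a)=\int p(\cdot|z,a)\,\nu_{n,i_n(x)}(dz)$. **Ergodicity constants.** For $\varphi\in\Phi$, $p(\cdot|x,\varphi)=\int_{\mathsf A}p(\cdot|x,a)\varphi(da|x)$, with $t$-step kernel $p^t(\cdot|x,\varphi)$ and unique invariant probability measure $\mu_\varphi$; similarly $q_n(\cdot|x,\varphi)$, $q_n^t$, $\bar\mu^n_\varphi$. $R>0$ and $\kappa_0\in(0,1)$ are constants such that, for all $t\ge1$, $x\in\mathsf X$, $n\ge1$, $\sup_{\varphi\in\Phi}\|p^t(\cdot|x,\varphi)-\mu_\varphi\|_{TV}\le R\kappa_0^t$ and $\sup_{\varphi\in\Phi}\|q_n^t(\cdot|x,\varphi)-\bar\mu^n_\varphi\|_{TV}\le R\kappa_0^t$ (such constants exist under the assumptions of the claim). **Error terms.** $I_1=2\|c\|R$, $I_2=2K_c\alpha$, $I_3=2\|c\|G_p\alpha$, $I_4=\frac{I_3}{I_1\ln(1/\kappa_0)}$ (the constants being such that these are well defined, with $I_4>0$); $I_1^l,I_2^l,I_3^l,I_4^l$ are obtained by replacing $c$ with $d_l$ (and $K_c$ with $K_l$). $\varepsilon_c(n)=(I_1I_4+I_2)(1/n)^{1/d}+\frac{I_3}{\ln(1/\kappa_0)}(1/n)^{1/d}\ln\bigl(\frac{n^{1/d}}{I_4}\bigr)$, $\varepsilon_{d_l}(n)=(I_1^lI_4^l+I_2^l)(1/n)^{1/d}+\frac{I_3^l}{\ln(1/\kappa_0)}(1/n)^{1/d}\ln\bigl(\frac{n^{1/d}}{I_4^l}\bigr)$,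 $\varepsilon_{\max}(n)=\max_{l}\varepsilon_{d_l}(n)$.
   Formalization: The formal theorem additionally assumes I_4 ≤ n^{1/d}, i.e. ln(n^{1/d}/I_4) ≥ 0; without it the error terms ε_c(n), ε_max(n) can be negative for small n and the stated inequality fails (e.g. a uniform kernel with constant costs, small R and n=1). *)

theory Defs
  imports "HOL-Probability.Probability"
begin

section \<open>Spaces, norms and kernels\<close>

abbreviation bspace :: "'a::topological_space set \<Rightarrow> 'a measure" where
  "bspace S \<equiv> restrict_space borel S"

definition sup_norm :: "'a set \<Rightarrow> ('a \<Rightarrow> real) \<Rightarrow> real" where
  "sup_norm S f = (SUP z\<in>S. \<bar>f z\<bar>)"

text \<open>
  The total variation norm of the signed measure \<open>M - N\<close>, for two finite measures on the
  same measurable space.  With this normalisation it ranges over \<open>[0, 2]\<close> on probability measures.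
\<close>

definition tv_dist :: "'a measure \<Rightarrow> 'a measure \<Rightarrow> real" where
  "tv_dist M N =
     (SUP g\<in>{g \<in> borel_measurable M. \<forall>x\<in>space M. \<bar>g x\<bar> \<le> 1}.
        \<bar>(\<integral>x. g x \<partial>M) - (\<integral>x. g x \<partial>N)\<bar>)"

primrec kernel_pow :: "'x measure \<Rightarrow> ('x \<Rightarrow> 'x measure) \<Rightarrow> nat \<Rightarrow> 'x \<Rightarrow> 'x measure" where
  "kernel_pow M K 0 x = return M x"
| "kernel_pow M K (Suc t) x = kernel_pow M K t x \<bind> K"

definition invariant_prob :: "'x measure \<Rightarrow> ('x \<Rightarrow> 'x measure) \<Rightarrow> 'x measure \<Rightarrow> bool" where
  "invariant_prob M K \<mu> \<longleftrightarrow> \<mu> \<in> space (prob_algebra M) \<and> \<mu> \<bind> K = \<mu>"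

text \<open>
  Meaningful only if there is exactly one invariant probability measure, as for every kernel
  that satisfies a Doeblin minorization condition.
\<close>

definition inv_measure :: "'x measure \<Rightarrow> ('x \<Rightarrow> 'x measure) \<Rightarrow> 'x measure" where
  "inv_measure M K = (THE \<mu>. invariant_prob M K \<mu>)"


section \<open>Constrained Markov decision processes with average cost\<close>

text \<open>
  A stochastic kernel on \<open>N\<close> given \<open>M\<close> is an element of \<open>M \<rightarrow>\<^sub>M prob_algebra N\<close>.
  Below, \<open>MX\<close> and \<open>MA\<close> are the measurable spaces of states and of actions.  The
  element \<open>(h, x)\<close> of \<open>hist_space MX MA t\<close> is the history with past state-action pairs
  \<open>h 0, \<dots>, h (t - 1)\<close> and current state \<open>x\<close>.
\<close>

definition hist_space ::
  "'x measure \<Rightarrow> 'a measure \<Rightarrow> nat \<Rightarrow> ((nat \<Rightarrow> 'x \<times> 'a) \<times> 'x) measure" where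
  "hist_space MX MA t = (\<Pi>\<^sub>M i\<in>{0..<t}. MX \<Otimes>\<^sub>M MA) \<Otimes>\<^sub>M MX"

type_synonym ('x, 'a) policy = "nat \<Rightarrow> (nat \<Rightarrow> 'x \<times> 'a) \<times> 'x \<Rightarrow> 'a measure"

definition policies :: "'x measure \<Rightarrow> 'a measure \<Rightarrow> ('x, 'a) policy set" where
  "policies MX MA = {\<pi>. \<forall>t. \<pi> t \<in> hist_space MX MA t \<rightarrow>\<^sub>M prob_algebra MA}"

definition stationary_policies :: "'x measure \<Rightarrow> 'a measure \<Rightarrow> ('x \<Rightarrow> 'a measure) set" where
  "stationary_policies MX MA = MX \<rightarrow>\<^sub>M prob_algebra MA"

definition policy_kernel ::
  "('x \<times> 'a \<Rightarrow> 'x measure) \<Rightarrow> ('x \<Rightarrow> 'a measure) \<Rightarrow> 'x \<Rightarrow> 'x measure" where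
  "policy_kernel p \<phi> x = \<phi> x \<bind> (\<lambda>a. p (x, a))"

text \<open>The conditional law of the pair \<open>(X\<^sub>t, A\<^sub>t)\<close> given the pairs at times \<open>0, \<dots>, t - 1\<close>.\<close>

definition step_kernel ::
  "'x measure \<Rightarrow> 'a measure \<Rightarrow> 'x measure \<Rightarrow> ('x \<times> 'a \<Rightarrow> 'x measure) \<Rightarrow> ('x, 'a) policy \<Rightarrow>
     nat \<Rightarrow> (nat \<Rightarrow> 'x \<times> 'a) \<Rightarrow> ('x \<times> 'a) measure" where
  "step_kernel MX MA \<gamma> p \<pi> t h =
     (if t = 0 then \<gamma> else p (h (t - 1))) \<bind>
       (\<lambda>x. distr (\<pi> t (h, x)) (MX \<Otimes>\<^sub>M MA) (Pair x))"

text \<open>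
  The law on \<open>(X \<times> A)\<^sup>\<infinity>\<close> of the state-action process: the measure that the
  Ionescu-Tulcea theorem of the library constructs from \<open>step_kernel\<close>.
\<close>

definition process_law ::
  "'x measure \<Rightarrow> 'a measure \<Rightarrow> 'x measure \<Rightarrow> ('x \<times> 'a \<Rightarrow> 'x measure) \<Rightarrow> ('x, 'a) policy \<Rightarrow>
     (nat \<Rightarrow> 'x \<times> 'a) measure" where
  "process_law MX MA \<gamma> p \<pi> =
     projective_family.lim UNIV
       (Ionescu_Tulcea.CI (step_kernel MX MA \<gamma> p \<pi>) (\<lambda>_. MX \<Otimes>\<^sub>M MA)) (\<lambda>_. MX \<Otimes>\<^sub>M MA)"

lemma Ionescu_Tulcea_step_kernel:
  assumes g: "\<gamma> \<in> space (prob_algebra MX)"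
    and p: "p \<in> MX \<Otimes>\<^sub>M MA \<rightarrow>\<^sub>M prob_algebra MX"
    and pol: "\<pi> \<in> policies MX MA"
  shows "Ionescu_Tulcea (step_kernel MX MA \<gamma> p \<pi>) (\<lambda>_. MX \<Otimes>\<^sub>M MA)"
proof -
  have *: "step_kernel MX MA \<gamma> p \<pi> t
      \<in> (\<Pi>\<^sub>M i\<in>{0..<t}. MX \<Otimes>\<^sub>M MA) \<rightarrow>\<^sub>M prob_algebra (MX \<Otimes>\<^sub>M MA)" for t
  proof -
    have pt: "\<pi> t \<in> (\<Pi>\<^sub>M i\<in>{0..<t}. MX \<Otimes>\<^sub>M MA) \<Otimes>\<^sub>M MX \<rightarrow>\<^sub>M prob_algebra MA"
      using pol by (auto simp: policies_def hist_space_def)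
    have first: "(\<lambda>h. if t = 0 then \<gamma> else p (h (t - 1)))
        \<in> (\<Pi>\<^sub>M i\<in>{0..<t}. MX \<Otimes>\<^sub>M MA) \<rightarrow>\<^sub>M prob_algebra MX"
    proof (cases t)
      case 0
      then show ?thesis using g by simp
    next
      case (Suc s)
      have "(\<lambda>h. h s) \<in> (\<Pi>\<^sub>M i\<in>{0..<t}. MX \<Otimes>\<^sub>M MA) \<rightarrow>\<^sub>M MX \<Otimes>\<^sub>M MA"
        using Suc by (intro measurable_component_singleton) auto
      from measurable_compose[OF this p] Suc show ?thesis by simp
    qed
    have "(\<lambda>z. distr (\<pi> t z) (MX \<Otimes>\<^sub>M MA) (Pair (snd z)))
        \<in> (\<Pi>\<^sub>M i\<in>{0..<t}. MX \<Otimes>\<^sub>M MA) \<Otimes>\<^sub>M MX \<rightarrow>\<^sub>M prob_algebra (MX \<Otimes>\<^sub>M MA)"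
      by (rule measurable_distr_prob_space2[OF pt]) measurable
    then have "(\<lambda>(h, x). distr (\<pi> t (h, x)) (MX \<Otimes>\<^sub>M MA) (Pair x))
        \<in> (\<Pi>\<^sub>M i\<in>{0..<t}. MX \<Otimes>\<^sub>M MA) \<Otimes>\<^sub>M MX \<rightarrow>\<^sub>M prob_algebra (MX \<Otimes>\<^sub>M MA)"
      by (simp add: split_beta')
    from measurable_bind_prob_space2[OF first this]
    show ?thesis by (simp add: step_kernel_def[abs_def])
  qed
  have "prob_space (step_kernel MX MA \<gamma> p \<pi> t h)"
    if "h \<in> space (\<Pi>\<^sub>M i\<in>{0..<t}. MX \<Otimes>\<^sub>M MA)" for t h
    using measurable_space[OF *[of t] that] by (simp add: space_prob_algebra)
  with measurable_prob_algebraD[OF *] show ?thesis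
    by (rule Ionescu_Tulcea.intro)
qed

definition avg_cost ::
  "'x measure \<Rightarrow> 'a measure \<Rightarrow> 'x measure \<Rightarrow> ('x \<times> 'a \<Rightarrow> 'x measure) \<Rightarrow>
     ('x \<times> 'a \<Rightarrow> real) \<Rightarrow> ('x, 'a) policy \<Rightarrow> ereal" where
  "avg_cost MX MA \<gamma> p c \<pi> =
     limsup (\<lambda>T. ereal (1 / real T * (\<integral>\<omega>. (\<Sum>t<T. c (\<omega> t)) \<partial>process_law MX MA \<gamma> p \<pi>)))"

definition feasible_policies ::
  "'x measure \<Rightarrow> 'a measure \<Rightarrow> 'x measure \<Rightarrow> ('x \<times> 'a \<Rightarrow> 'x measure) \<Rightarrow>
     nat \<Rightarrow> (nat \<Rightarrow> 'x \<times> 'a \<Rightarrow> real) \<Rightarrow> (nat \<Rightarrow> real) \<Rightarrow> ('x, 'a) policy set" where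
  "feasible_policies MX MA \<gamma> p q d k =
     {\<pi> \<in> policies MX MA. \<forall>l\<in>{1..q}. avg_cost MX MA \<gamma> p (d l) \<pi> \<le> ereal (k l)}"

text \<open>The value is \<open>\<infinity>\<close> if no policy is feasible.\<close>

definition opt_value ::
  "'x measure \<Rightarrow> 'a measure \<Rightarrow> 'x measure \<Rightarrow> ('x \<times> 'a \<Rightarrow> 'x measure) \<Rightarrow>
     ('x \<times> 'a \<Rightarrow> real) \<Rightarrow> nat \<Rightarrow> (nat \<Rightarrow> 'x \<times> 'a \<Rightarrow> real) \<Rightarrow> (nat \<Rightarrow> real) \<Rightarrow> ereal" where
  "opt_value MX MA \<gamma> p c q d k =
     (INF \<pi>\<in>feasible_policies MX MA \<gamma> p q d k. avg_cost MX MA \<gamma> p c \<pi>)"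


section \<open>Finite-state models\<close>

text \<open>
  The \<open>n\<close>-point set of representatives is a plain set \<open>Y\<close>; its points themselves serve as the
  indices \<open>i\<close>, so that the cell of the point \<open>y \<in> Y\<close> is \<open>cell X Q y\<close>, and the cell containing a
  state \<open>x\<close> is \<open>cell X Q (Q x)\<close>.  The normalised restriction of \<open>\<nu>\<close> to a cell \<open>S\<close> is
  \<open>uniform_measure \<nu> S\<close>, regarded as a measure on all of \<open>X\<close> which is carried by \<open>S\<close>.
\<close>

definition cell :: "'x set \<Rightarrow> ('x \<Rightarrow> 'x) \<Rightarrow> 'x \<Rightarrow> 'x set" where
  "cell X Q y = {x \<in> X. Q x = y}"

definition nearest_point_map :: "'x::metric_space set \<Rightarrow> 'x set \<Rightarrow> ('x \<Rightarrow> 'x) \<Rightarrow> bool" where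
  "nearest_point_map X Y Q \<longleftrightarrow>
     Q \<in> bspace X \<rightarrow>\<^sub>M count_space Y \<and> (\<forall>x\<in>X. \<forall>y\<in>Y. dist x (Q x) \<le> dist x y)"

definition fin_kernel ::
  "'x set \<Rightarrow> 'x set \<Rightarrow> ('x \<Rightarrow> 'x) \<Rightarrow> 'x measure \<Rightarrow> ('x \<times> 'a \<Rightarrow> 'x measure) \<Rightarrow>
     'x \<times> 'a \<Rightarrow> 'x measure" where
  "fin_kernel X Y Q \<nu> p = (\<lambda>(y, a).
     point_measure Y
       (\<lambda>z. ennreal (\<integral>x. measure (p (x, a)) (cell X Q z) \<partial>uniform_measure \<nu> (cell X Q y))))"

definition fin_cost ::
  "'x set \<Rightarrow> ('x \<Rightarrow> 'x) \<Rightarrow> 'x measure \<Rightarrow> ('x \<times> 'a \<Rightarrow> real) \<Rightarrow> 'x \<times> 'a \<Rightarrow> real" where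
  "fin_cost X Q \<nu> c = (\<lambda>(y, a). \<integral>x. c (x, a) \<partial>uniform_measure \<nu> (cell X Q y))"

definition ext_kernel ::
  "'x set \<Rightarrow> ('x \<Rightarrow> 'x) \<Rightarrow> 'x measure \<Rightarrow> ('x \<times> 'a \<Rightarrow> 'x measure) \<Rightarrow> 'x \<times> 'a \<Rightarrow> 'x measure" where
  "ext_kernel X Q \<nu> p = (\<lambda>(x, a). uniform_measure \<nu> (cell X Q (Q x)) \<bind> (\<lambda>z. p (z, a)))"


section \<open>Error terms\<close>

text \<open>
  Here \<open>C\<close> is the sup norm of the cost function, \<open>K\<close> its Lipschitz constant in the state, \<open>G\<close> the
  Lipschitz constant of the transition kernel and \<open>dm\<close> the dimension.  The term \<open>err_term\<close> is
  \<open>I1 * \<kappa> ^ t + (I2 + t * I3) * (1 / n) powr (1 / dm)\<close> at the minimising (real) number of steps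
  \<open>t = ln (n powr (1 / dm) / I4) / ln (1 / \<kappa>)\<close>; it is an error bound only if this \<open>t\<close> is
  nonnegative, that is, for \<open>I4 \<le> n powr (1 / dm)\<close>.  For smaller \<open>n\<close> it can be negative.
  As \<open>x / 0 = 0\<close>, the condition \<open>0 < err_I4 C R G \<alpha> \<kappa>\<close> implies that the denominator is nonzero.
\<close>

definition err_I1 :: "real \<Rightarrow> real \<Rightarrow> real" where
  "err_I1 C R = 2 * C * R"

definition err_I2 :: "real \<Rightarrow> real \<Rightarrow> real" where
  "err_I2 K \<alpha> = 2 * K * \<alpha>"

definition err_I3 :: "real \<Rightarrow> real \<Rightarrow> real \<Rightarrow> real" where
  "err_I3 C G \<alpha> = 2 * C * G * \<alpha>"

definition err_I4 :: "real \<Rightarrow> real \<Rightarrow> real \<Rightarrow> real \<Rightarrow> real \<Rightarrow> real" where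
  "err_I4 C R G \<alpha> \<kappa> = err_I3 C G \<alpha> / (err_I1 C R * ln (1 / \<kappa>))"

definition err_term ::
  "nat \<Rightarrow> real \<Rightarrow> real \<Rightarrow> real \<Rightarrow> real \<Rightarrow> real \<Rightarrow> real \<Rightarrow> nat \<Rightarrow> real" where
  "err_term dm C K R G \<alpha> \<kappa> n =
     (err_I1 C R * err_I4 C R G \<alpha> \<kappa> + err_I2 K \<alpha>) * (1 / real n) powr (1 / real dm)
     + err_I3 C G \<alpha> / ln (1 / \<kappa>) * (1 / real n) powr (1 / real dm)
         * ln (real n powr (1 / real dm) / err_I4 C R G \<alpha> \<kappa>)"

end

theory Submission
  imports Defs
begin

text \<open>
  Both optimal values are compared through state-action measures \<open>m\<close> that are invariant under the
  transition law up to a small defect \<open>s\<close> in total variation (\<open>almost_invariant\<close>).  The time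
  average of the laws of \<open>(X\<^sub>t, A\<^sub>t)\<close> over a horizon \<open>T\<close> is such a measure with defect \<open>2 / T\<close>,
  whatever the policy, and for large \<open>T\<close> it nearly attains the average costs of the policy, for
  the objective and all constraints at once (\<open>policy_to_almost_invariant\<close>).  As the optimal
  values are infima, near attainment is enough, and no limit of occupation measures has to be
  taken.

  A measure \<open>m\<close> is turned back into a stationary policy of the other model by averaging its action
  law over the cells of the partition; over finitely many cells this disintegration is elementary.
  Let \<open>\<sigma>\<close> be the law of the state, or of the next state, under \<open>m\<close>.  Within a cell the transition
  law varies by at most \<open>\<eta> = min (2 * Gp * \<alpha> * h) (2 * R * \<kappa>)\<close>, where \<open>h = n powr (- 1 / DIM('x))\<close>,
  so \<open>\<sigma>\<close> is invariant up to \<open>\<eta> + s\<close> under the chain of the new policy.  After \<open>t\<close> steps that chain has moved \<open>\<sigma>\<close> by at most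
  \<open>t * (\<eta> + s)\<close> and is within \<open>R * \<kappa> ^ t\<close> of its invariant law.  A cost with values in \<open>[0, C]\<close> and
  Lipschitz constant \<open>K\<close> therefore changes by at most
  \<open>2 * K * \<alpha> * h + C / 2 * (R * \<kappa> ^ t + t * (\<eta> + s))\<close>.  The two directions are
  \<open>approximating_policy_in_finite_model\<close> and \<open>approximating_policy_in_original_model\<close>.

  The error terms of the statement are the minimum over real \<open>t\<close> of the weaker expression
  \<open>2 * K * \<alpha> * h + C * (2 * R * \<kappa> powr t + t * (2 * Gp * \<alpha> * h))\<close>.  The factor \<open>1 / 2\<close>, which comes from the nonnegativity of the costs,
  and the second entry of the minimum \<open>\<eta>\<close> make it possible to round the minimiser to an integer
  (\<open>error_at_integer_steps_le_err_term\<close>).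

  Finally, a policy that is feasible in one model violates the constraints of the other by at most
  \<open>\<epsilon>max\<close>.  This is repaired before the transfer by mixing its measure with that of the strictly
  feasible policy, with weight about \<open>\<epsilon>max / (a - \<epsilon>max)\<close>, where \<open>a\<close> is the least slack; as the
  cost lies in \<open>[0, C]\<close>, the repair costs at most \<open>C\<close> times the weight
  (\<open>optimal_values_close\<close>).  Doeblin's theorem enters only to ensure that the invariant laws in
  the ergodicity conditions exist.
\<close>

section \<open>Stochastic kernels acting on bounded functions\<close>

definition test_functions :: "'a measure \<Rightarrow> ('a \<Rightarrow> real) set" where
  "test_functions M = {g \<in> borel_measurable M. \<forall>x\<in>space M. \<bar>g x\<bar> \<le> 1}"

lemma prob_algebraD:
  assumes "N \<in> space (prob_algebra M)"
  shows "prob_space N" "sets N = sets M" "space N = space M"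
    "borel_measurable N = borel_measurable M"
  using assms by (auto simp: space_prob_algebra dest: sets_eq_imp_space_eq intro!: measurable_cong_sets)

lemma kernel_in_prob_algebra:
  "P \<in> M \<rightarrow>\<^sub>M prob_algebra N \<Longrightarrow> x \<in> space M \<Longrightarrow> P x \<in> space (prob_algebra N)"
  by (rule measurable_space)

lemma integrable_bounded:
  fixes f :: "'a \<Rightarrow> real"
  assumes "N \<in> space (prob_algebra M)" "f \<in> borel_measurable M" "\<And>x. x \<in> space M \<Longrightarrow> \<bar>f x\<bar> \<le> B"
  shows "integrable N f"
proof -
  interpret prob_space N using prob_algebraD[OF assms(1)] by simp
  show ?thesis
    by (rule integrable_const_bound[where B=B]) (use assms prob_algebraD[OF assms(1)] in auto)
qed

lemma integral_between:
  fixes f :: "'a \<Rightarrow> real"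
  assumes N: "N \<in> space (prob_algebra M)" and f: "f \<in> borel_measurable M"
    and b: "\<And>x. x \<in> space M \<Longrightarrow> l \<le> f x \<and> f x \<le> u"
  shows "l \<le> (\<integral>x. f x \<partial>N)" "(\<integral>x. f x \<partial>N) \<le> u"
proof -
  interpret prob_space N using prob_algebraD[OF N] by simp
  have int: "integrable N f"
    by (rule integrable_bounded[OF N f, where B="max \<bar>l\<bar> \<bar>u\<bar>"]) (use b in fastforce)
  have sp: "space N = space M" by (rule prob_algebraD[OF N])
  show "l \<le> (\<integral>x. f x \<partial>N)"
    by (rule integral_ge_const[OF int]) (use b sp in auto)
  show "(\<integral>x. f x \<partial>N) \<le> u"
    by (rule integral_le_const[OF int]) (use b sp in auto)
qed

lemma abs_integral_le:
  fixes f :: "'a \<Rightarrow> real"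
  assumes "N \<in> space (prob_algebra M)" "f \<in> borel_measurable M" "\<And>x. x \<in> space M \<Longrightarrow> \<bar>f x\<bar> \<le> B"
  shows "\<bar>\<integral>x. f x \<partial>N\<bar> \<le> B"
  using integral_between[OF assms(1,2), of "-B" B] assms(3) by (force simp: abs_le_iff)

lemma integral_diff_le:
  fixes f g :: "'a \<Rightarrow> real"
  assumes N: "N \<in> space (prob_algebra M)"
    and f: "f \<in> borel_measurable M" "\<And>x. x \<in> space M \<Longrightarrow> \<bar>f x\<bar> \<le> B"
    and g: "g \<in> borel_measurable M" "\<And>x. x \<in> space M \<Longrightarrow> \<bar>g x\<bar> \<le> B'"
    and e: "\<And>x. x \<in> space M \<Longrightarrow> \<bar>f x - g x\<bar> \<le> e"
  shows "\<bar>(\<integral>x. f x \<partial>N) - (\<integral>x. g x \<partial>N)\<bar> \<le> e"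
proof -
  have "(\<integral>x. f x \<partial>N) - (\<integral>x. g x \<partial>N) = (\<integral>x. f x - g x \<partial>N)"
    by (rule Bochner_Integration.integral_diff[symmetric])
       (use integrable_bounded[OF N f] integrable_bounded[OF N g] in auto)
  with abs_integral_le[OF N, of "\<lambda>x. f x - g x" e] f(1) g(1) e show ?thesis by simp
qed

lemma kernel_integral_measurable:
  fixes f :: "'b \<Rightarrow> real"
  assumes P: "P \<in> M \<rightarrow>\<^sub>M prob_algebra N" and f: "f \<in> borel_measurable N"
  shows "(\<lambda>x. \<integral>y. f y \<partial>P x) \<in> borel_measurable M"
  by (rule measurable_compose[OF measurable_prob_algebraD[OF P] integral_measurable_subprob_algebra[OF f]])

lemma kernel_integral_measurable2:
  fixes f :: "'a \<times> 'b \<Rightarrow> real"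
  assumes P: "P \<in> M \<rightarrow>\<^sub>M prob_algebra N" and f: "f \<in> borel_measurable (M \<Otimes>\<^sub>M N)"
  shows "(\<lambda>x. \<integral>y. f (x, y) \<partial>P x) \<in> borel_measurable M"
proof -
  have D: "(\<lambda>x. distr (P x) (M \<Otimes>\<^sub>M N) (Pair x)) \<in> M \<rightarrow>\<^sub>M prob_algebra (M \<Otimes>\<^sub>M N)"
    by (rule measurable_distr_prob_space2[OF P]) simp
  have "(\<integral>z. f z \<partial>distr (P x) (M \<Otimes>\<^sub>M N) (Pair x)) = (\<integral>y. f (x, y) \<partial>P x)" if "x \<in> space M" for x
  proof (rule integral_distr)
    have "sets (P x) = sets N" using prob_algebraD[OF kernel_in_prob_algebra[OF P that]] by simp
    then show "Pair x \<in> P x \<rightarrow>\<^sub>M M \<Otimes>\<^sub>M N" using that by (auto cong: measurable_cong_sets)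
  qed (rule f)
  with kernel_integral_measurable[OF D f] show ?thesis by (simp cong: measurable_cong)
qed

lemma integral_bind_kernel:
  fixes f :: "'b \<Rightarrow> real"
  assumes N: "N \<in> space (prob_algebra M)" and P: "P \<in> M \<rightarrow>\<^sub>M prob_algebra K"
    and f: "f \<in> borel_measurable K" "\<And>y. y \<in> space K \<Longrightarrow> \<bar>f y\<bar> \<le> B"
  shows "(\<integral>y. f y \<partial>(N \<bind> P)) = (\<integral>x. (\<integral>y. f y \<partial>P x) \<partial>N)"
proof (rule integral_bind[where K=K and B=B and B'=1])
  interpret prob_space N using prob_algebraD[OF N] by simp
  show "finite_measure N" by unfold_locales
  show "P \<in> N \<rightarrow>\<^sub>M subprob_algebra K"
    using measurable_prob_algebraD[OF P] prob_algebraD[OF N] by (auto cong: measurable_cong_sets)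
  show "AE x in N. emeasure (P x) (space (P x)) \<le> ennreal 1"
    using prob_algebraD(1)[OF kernel_in_prob_algebra[OF P]] prob_algebraD(3)[OF N]
    by (auto simp: prob_space.emeasure_space_1)
qed (use f in auto)

lemma bind_in_prob_algebra:
  "N \<in> space (prob_algebra M) \<Longrightarrow> P \<in> M \<rightarrow>\<^sub>M prob_algebra K \<Longrightarrow> N \<bind> P \<in> space (prob_algebra K)"
  by (simp add: space_prob_algebra prob_space_bind' sets_bind')

lemma distr_in_prob_algebra:
  assumes "N \<in> space (prob_algebra M)" "f \<in> M \<rightarrow>\<^sub>M K"
  shows "distr N K f \<in> space (prob_algebra K)"
  using assms prob_space.prob_space_distr[of N f K]
  by (auto simp: space_prob_algebra cong: measurable_cong_sets)

lemma integral_distr_prob: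
  fixes g :: "'b \<Rightarrow> real"
  assumes "N \<in> space (prob_algebra M)" "f \<in> M \<rightarrow>\<^sub>M K" "g \<in> borel_measurable K"
  shows "(\<integral>y. g y \<partial>distr N K f) = (\<integral>x. g (f x) \<partial>N)"
  using assms by (intro integral_distr) (auto simp: space_prob_algebra cong: measurable_cong_sets)

lemma abs_integral_diff_le_tv_dist:
  assumes M: "M \<in> space (prob_algebra S)" and N: "N \<in> space (prob_algebra S)"
    and g: "g \<in> test_functions S"
  shows "\<bar>(\<integral>x. g x \<partial>M) - (\<integral>x. g x \<partial>N)\<bar> \<le> tv_dist M N"
proof -
  have T: "{g \<in> borel_measurable M. \<forall>x\<in>space M. \<bar>g x\<bar> \<le> 1} = test_functions S"
    unfolding test_functions_def prob_algebraD(3)[OF M] prob_algebraD(4)[OF M] ..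
  have b: "\<bar>(\<integral>x. h x \<partial>M) - (\<integral>x. h x \<partial>N)\<bar> \<le> 2" if "h \<in> test_functions S" for h
    using abs_integral_le[OF M, of h 1] abs_integral_le[OF N, of h 1] that
    by (auto simp: test_functions_def)
  show ?thesis
    unfolding tv_dist_def T
    by (rule cSUP_upper[OF g]) (use b in \<open>auto intro!: bdd_aboveI2[where M=2]\<close>)
qed

text \<open>
  Centring a \<open>[0, C]\<close>-valued function at \<open>C / 2\<close> halves its norm, and constants do not see the
  difference of two probability measures.  This factor \<open>1 / 2\<close> pays for the rounding of the
  number of steps to an integer in the final error estimate.
\<close>

lemma integral_diff_le_half:
  assumes M: "M \<in> space (prob_algebra S)" and N: "N \<in> space (prob_algebra S)"
    and e: "\<And>g. g \<in> test_functions S \<Longrightarrow> \<bar>(\<integral>x. g x \<partial>M) - (\<integral>x. g x \<partial>N)\<bar> \<le> e"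
    and f: "f \<in> borel_measurable S" "\<And>x. x \<in> space S \<Longrightarrow> 0 \<le> f x \<and> f x \<le> C"
    and C: "0 < C"
  shows "\<bar>(\<integral>x. f x \<partial>M) - (\<integral>x. f x \<partial>N)\<bar> \<le> C / 2 * e"
proof -
  let ?g = "\<lambda>x. 2 / C * f x - 1"
  have fb: "\<bar>f x\<bar> \<le> C" if "x \<in> space S" for x using f(2)[OF that] by auto
  have "\<bar>?g x\<bar> \<le> 1" if "x \<in> space S" for x
    using f(2)[OF that] C by (auto simp: abs_le_iff field_simps)
  then have g: "?g \<in> test_functions S" using f(1) by (auto simp: test_functions_def)
  have "(\<integral>x. ?g x \<partial>L) = 2 / C * (\<integral>x. f x \<partial>L) - 1" if L: "L \<in> space (prob_algebra S)" for L
  proof -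
    interpret prob_space L using prob_algebraD[OF L] by simp
    have "integrable L f" by (rule integrable_bounded[OF L f(1) fb])
    then show ?thesis by (simp add: prob_space)
  qed
  with e[OF g] M N have "\<bar>2 / C * (\<integral>x. f x \<partial>M) - 2 / C * (\<integral>x. f x \<partial>N)\<bar> \<le> e" by simp
  then have "2 / C * \<bar>(\<integral>x. f x \<partial>M) - (\<integral>x. f x \<partial>N)\<bar> \<le> e"
    using C abs_mult[of "2 / C" "(\<integral>x. f x \<partial>M) - (\<integral>x. f x \<partial>N)"]
    by (simp only: right_diff_distrib[symmetric])
  then show ?thesis using C by (simp add: field_simps)
qed

section \<open>Iterated kernels\<close>

lemma kernel_pow_measurable [measurable]:
  "P \<in> M \<rightarrow>\<^sub>M prob_algebra M \<Longrightarrow> kernel_pow M P t \<in> M \<rightarrow>\<^sub>M prob_algebra M"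
proof (induction t)
  case 0
  have "kernel_pow M P 0 = return M" by auto
  then show ?case by simp
next
  case (Suc t)
  have "kernel_pow M P (Suc t) = (\<lambda>x. kernel_pow M P t x \<bind> P)" by auto
  then show ?case using measurable_bind_prob_space[OF Suc.IH[OF Suc.prems] Suc.prems] by simp
qed

lemma integral_kernel_pow_Suc:
  fixes f :: "'a \<Rightarrow> real"
  assumes P: "P \<in> M \<rightarrow>\<^sub>M prob_algebra M" and x: "x \<in> space M"
    and f: "f \<in> borel_measurable M" "\<And>y. y \<in> space M \<Longrightarrow> \<bar>f y\<bar> \<le> B"
  shows "(\<integral>y. f y \<partial>kernel_pow M P (Suc t) x) = (\<integral>z. (\<integral>y. f y \<partial>P z) \<partial>kernel_pow M P t x)"
  using integral_bind_kernel[OF kernel_in_prob_algebra[OF kernel_pow_measurable[OF P] x] P f] by simp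

lemma integral_kernel_pow_0:
  fixes f :: "'a \<Rightarrow> real"
  assumes "x \<in> space M" "f \<in> borel_measurable M"
  shows "(\<integral>y. f y \<partial>kernel_pow M P 0 x) = f x"
  using assms by (simp add: integral_return)

lemma kernel_image_bounded:
  fixes f :: "'b \<Rightarrow> real"
  assumes P: "P \<in> M \<rightarrow>\<^sub>M prob_algebra N"
    and f: "f \<in> borel_measurable N" "\<And>y. y \<in> space N \<Longrightarrow> \<bar>f y\<bar> \<le> B"
    and x: "x \<in> space M"
  shows "\<bar>\<integral>y. f y \<partial>P x\<bar> \<le> B"
  using abs_integral_le[OF kernel_in_prob_algebra[OF P x] f] .

lemma integral_kernel_pow_add:
  fixes f :: "'a \<Rightarrow> real"
  assumes P: "P \<in> M \<rightarrow>\<^sub>M prob_algebra M" and x: "x \<in> space M"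
    and f: "f \<in> borel_measurable M" "\<And>y. y \<in> space M \<Longrightarrow> \<bar>f y\<bar> \<le> B"
  shows "(\<integral>y. f y \<partial>kernel_pow M P (s + t) x)
    = (\<integral>z. (\<integral>y. f y \<partial>kernel_pow M P t z) \<partial>kernel_pow M P s x)"
  using f
proof (induction t arbitrary: f)
  case 0
  have "(\<integral>z. (\<integral>y. f y \<partial>kernel_pow M P 0 z) \<partial>kernel_pow M P s x) = (\<integral>z. f z \<partial>kernel_pow M P s x)"
  proof (rule Bochner_Integration.integral_cong[OF refl])
    fix z assume "z \<in> space (kernel_pow M P s x)"
    then have "z \<in> space M"
      using prob_algebraD(3)[OF kernel_in_prob_algebra[OF kernel_pow_measurable[OF P] x]] by blast
    then show "(\<integral>y. f y \<partial>kernel_pow M P 0 z) = f z" by (rule integral_kernel_pow_0[OF _ 0(1)])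
  qed
  then show ?case by simp
next
  case (Suc t)
  have Pf: "(\<lambda>z. \<integral>y. f y \<partial>P z) \<in> borel_measurable M"
    by (rule kernel_integral_measurable[OF P Suc.prems(1)])
  have bPf: "\<bar>\<integral>y. f y \<partial>P z\<bar> \<le> B" if "z \<in> space M" for z
    by (rule kernel_image_bounded[OF P Suc.prems that])
  have "(\<integral>y. f y \<partial>kernel_pow M P (s + Suc t) x) = (\<integral>z. (\<integral>y. f y \<partial>P z) \<partial>kernel_pow M P (s + t) x)"
    using integral_kernel_pow_Suc[OF P x Suc.prems, of "s + t"] by simp
  also have "\<dots> = (\<integral>w. (\<integral>z. (\<integral>y. f y \<partial>P z) \<partial>kernel_pow M P t w) \<partial>kernel_pow M P s x)"
    by (rule Suc.IH[OF Pf bPf])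
  also have "\<dots> = (\<integral>w. (\<integral>y. f y \<partial>kernel_pow M P (Suc t) w) \<partial>kernel_pow M P s x)"
  proof (rule Bochner_Integration.integral_cong[OF refl])
    fix w assume "w \<in> space (kernel_pow M P s x)"
    then have "w \<in> space M"
      using prob_algebraD(3)[OF kernel_in_prob_algebra[OF kernel_pow_measurable[OF P] x]] by blast
    then show "(\<integral>z. (\<integral>y. f y \<partial>P z) \<partial>kernel_pow M P t w) = (\<integral>y. f y \<partial>kernel_pow M P (Suc t) w)"
      by (rule integral_kernel_pow_Suc[OF P _ Suc.prems, symmetric])
  qed
  finally show ?case .
qed

text \<open>
  If one step of the chain moves \<open>\<sigma>\<close> by at most \<open>e\<close>, then \<open>t\<close> steps move it by at most \<open>t * e\<close>,
  as the adjoint kernel maps test functions to test functions.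
\<close>

lemma almost_invariant_iterate:
  assumes P: "P \<in> M \<rightarrow>\<^sub>M prob_algebra M" and \<sigma>: "\<sigma> \<in> space (prob_algebra M)"
    and e: "\<And>g. g \<in> test_functions M \<Longrightarrow> \<bar>(\<integral>x. (\<integral>y. g y \<partial>P x) \<partial>\<sigma>) - (\<integral>x. g x \<partial>\<sigma>)\<bar> \<le> e"
    and g: "g \<in> test_functions M"
  shows "\<bar>(\<integral>x. (\<integral>y. g y \<partial>kernel_pow M P t x) \<partial>\<sigma>) - (\<integral>x. g x \<partial>\<sigma>)\<bar> \<le> real t * e"
  using g
proof (induction t arbitrary: g)
  case 0
  have "(\<integral>x. (\<integral>y. g y \<partial>kernel_pow M P 0 x) \<partial>\<sigma>) = (\<integral>x. g x \<partial>\<sigma>)"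
  proof (rule Bochner_Integration.integral_cong[OF refl])
    fix z assume "z \<in> space \<sigma>"
    then have "z \<in> space M" using prob_algebraD(3)[OF \<sigma>] by simp
    then show "(\<integral>y. g y \<partial>kernel_pow M P 0 z) = g z"
      by (rule integral_kernel_pow_0) (use 0 in \<open>simp add: test_functions_def\<close>)
  qed
  then show ?case by simp
next
  case (Suc t)
  have gm: "g \<in> borel_measurable M" and gb: "\<And>x. x \<in> space M \<Longrightarrow> \<bar>g x\<bar> \<le> 1"
    using Suc.prems by (auto simp: test_functions_def)
  have Pg: "(\<lambda>z. \<integral>y. g y \<partial>P z) \<in> test_functions M"
    using kernel_integral_measurable[OF P gm] kernel_image_bounded[OF P gm gb]
    by (auto simp: test_functions_def)
  have "(\<integral>x. (\<integral>y. g y \<partial>kernel_pow M P (Suc t) x) \<partial>\<sigma>) = (\<integral>x. (\<integral>z. (\<integral>y. g y \<partial>P z) \<partial>kernel_pow M P t x) \<partial>\<sigma>)"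
    by (rule Bochner_Integration.integral_cong[OF refl], rule integral_kernel_pow_Suc[OF P _ gm gb])
       (use prob_algebraD(3)[OF \<sigma>] in auto)
  with Suc.IH[OF Pg] e[OF Suc.prems] show ?case by (simp add: algebra_simps)
qed

text \<open>
  The number \<open>t\<close> of steps is free: few steps keep the accumulated defect \<open>t * e\<close> small, many steps
  bring the chain closer to its limit law.
\<close>

lemma almost_invariant_close_to_ergodic_limit:
  assumes P: "P \<in> M \<rightarrow>\<^sub>M prob_algebra M" and \<sigma>: "\<sigma> \<in> space (prob_algebra M)"
    and \<mu>: "\<mu> \<in> space (prob_algebra M)"
    and e: "\<And>g. g \<in> test_functions M \<Longrightarrow> \<bar>(\<integral>x. (\<integral>y. g y \<partial>P x) \<partial>\<sigma>) - (\<integral>x. g x \<partial>\<sigma>)\<bar> \<le> e"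
    and r: "\<And>x. x \<in> space M \<Longrightarrow> tv_dist (kernel_pow M P t x) \<mu> \<le> r"
    and g: "g \<in> test_functions M"
  shows "\<bar>(\<integral>x. g x \<partial>\<sigma>) - (\<integral>x. g x \<partial>\<mu>)\<bar> \<le> r + real t * e"
proof -
  have gm: "g \<in> borel_measurable M" and gb: "\<And>x. x \<in> space M \<Longrightarrow> \<bar>g x\<bar> \<le> 1"
    using g by (auto simp: test_functions_def)
  note Pt = kernel_pow_measurable[OF P, of t]
  have "\<bar>(\<integral>x. (\<integral>y. g y \<partial>kernel_pow M P t x) \<partial>\<sigma>) - (\<integral>x. (\<integral>y. g y \<partial>\<mu>) \<partial>\<sigma>)\<bar> \<le> r"
  proof (rule integral_diff_le[OF \<sigma> kernel_integral_measurable[OF Pt gm] kernel_image_bounded[OF Pt gm gb]])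
    fix x assume x: "x \<in> space M"
    show "\<bar>(\<integral>y. g y \<partial>kernel_pow M P t x) - (\<integral>y. g y \<partial>\<mu>)\<bar> \<le> r"
      using abs_integral_diff_le_tv_dist[OF kernel_in_prob_algebra[OF Pt x] \<mu> g] r[OF x] by linarith
  qed auto
  moreover have "(\<integral>x. (\<integral>y. g y \<partial>\<mu>) \<partial>\<sigma>) = (\<integral>y. g y \<partial>\<mu>)"
    using prob_space.prob_space[OF prob_algebraD(1)[OF \<sigma>]] by simp
  moreover have "\<bar>(\<integral>x. (\<integral>y. g y \<partial>kernel_pow M P t x) \<partial>\<sigma>) - (\<integral>x. g x \<partial>\<sigma>)\<bar> \<le> real t * e"
    by (rule almost_invariant_iterate[OF P \<sigma> e g])
  ultimately show ?thesis by linarith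
qed

section \<open>Doeblin's theorem\<close>

text \<open>
  A minorization is given on sets only; it extends to functions by approximation from below with
  simple functions.
\<close>

lemma minorization_nn_integral:
  assumes \<Lambda>: "\<Lambda> \<in> space (prob_algebra M)" and N: "N \<in> space (prob_algebra M)" and b: "0 \<le> b"
    and minor: "\<And>D. D \<in> sets M \<Longrightarrow> b * measure \<Lambda> D \<le> measure N D"
    and f: "f \<in> borel_measurable M"
  shows "ennreal b * (\<integral>\<^sup>+x. f x \<partial>\<Lambda>) \<le> (\<integral>\<^sup>+x. f x \<partial>N)"
  using f
proof (induction rule: borel_measurable_induct)
  case (cong f g)
  have "(\<integral>\<^sup>+x. f x \<partial>\<Lambda>) = (\<integral>\<^sup>+x. g x \<partial>\<Lambda>)" "(\<integral>\<^sup>+x. f x \<partial>N) = (\<integral>\<^sup>+x. g x \<partial>N)"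
    using cong(3) prob_algebraD(3)[OF \<Lambda>] prob_algebraD(3)[OF N] by (auto intro!: nn_integral_cong)
  with cong show ?case by simp
next
  case (set D)
  interpret L: prob_space \<Lambda> by (rule prob_algebraD[OF \<Lambda>])
  interpret N: prob_space N by (rule prob_algebraD[OF N])
  have "ennreal b * emeasure \<Lambda> D \<le> emeasure N D"
    using minor[OF set] b
    by (simp add: L.emeasure_eq_measure N.emeasure_eq_measure ennreal_mult[symmetric] ennreal_leI)
  with set prob_algebraD(2)[OF \<Lambda>] prob_algebraD(2)[OF N] show ?case by simp
next
  case (mult f u)
  then show ?case
    by (simp add: prob_algebraD(4)[OF \<Lambda>] prob_algebraD(4)[OF N] nn_integral_cmult mult.left_commute[of "ennreal b"] mult_left_mono)
next
  case (add f g)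
  then show ?case
    by (simp add: prob_algebraD(4)[OF \<Lambda>] prob_algebraD(4)[OF N] nn_integral_add distrib_left add_mono)
next
  case (seq U)
  have "(\<integral>\<^sup>+x. (SUP i. U i) x \<partial>K) = (SUP i. \<integral>\<^sup>+x. U i x \<partial>K)" if K: "K \<in> space (prob_algebra M)" for K
    using seq by (simp add: prob_algebraD(4)[OF K] image_comp nn_integral_monotone_convergence_SUP)
  then show ?case
    using seq \<Lambda> N by (simp add: SUP_mult_left_ennreal SUP_mono')
qed

lemma minorization_integral:
  fixes f :: "'a \<Rightarrow> real"
  assumes \<Lambda>: "\<Lambda> \<in> space (prob_algebra M)" and N: "N \<in> space (prob_algebra M)" and b: "0 \<le> b"
    and minor: "\<And>D. D \<in> sets M \<Longrightarrow> b * measure \<Lambda> D \<le> measure N D"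
    and f: "f \<in> borel_measurable M" "\<And>x. x \<in> space M \<Longrightarrow> 0 \<le> f x \<and> f x \<le> B"
  shows "b * (\<integral>x. f x \<partial>\<Lambda>) \<le> (\<integral>x. f x \<partial>N)"
proof -
  have fb: "\<bar>f x\<bar> \<le> B" if "x \<in> space M" for x using f(2)[OF that] by auto
  have eq: "(\<integral>\<^sup>+x. ennreal (f x) \<partial>K) = ennreal (\<integral>x. f x \<partial>K)" if K: "K \<in> space (prob_algebra M)" for K
    by (rule nn_integral_eq_integral[OF integrable_bounded[OF K f(1) fb]])
       (use f(2) prob_algebraD(3)[OF K] in auto)
  have nn: "0 \<le> (\<integral>x. f x \<partial>K)" if K: "K \<in> space (prob_algebra M)" for K
    using integral_between(1)[OF K f] .
  have "(\<lambda>x. ennreal (f x)) \<in> borel_measurable M" using f(1) by simp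
  from minorization_nn_integral[OF \<Lambda> N b minor this] nn[OF N] nn[OF \<Lambda>] b show ?thesis
    by (simp add: eq[OF \<Lambda>] eq[OF N] ennreal_mult[symmetric])
qed

text \<open>
  Both \<open>f\<close> and \<open>1 - f\<close> receive the mass that the minorizing measure guarantees, so that one
  step shrinks the range of a \<open>[0, 1]\<close>-valued function by the factor \<open>1 - b\<close>.
\<close>

lemma minorized_kernel_contracts:
  fixes f :: "'a \<Rightarrow> real"
  assumes P: "P \<in> M \<rightarrow>\<^sub>M prob_algebra M" and \<Lambda>: "\<Lambda> \<in> space (prob_algebra M)"
    and b: "0 \<le> b" "b < 1"
    and minor: "\<And>x D. x \<in> space M \<Longrightarrow> D \<in> sets M \<Longrightarrow> b * measure \<Lambda> D \<le> measure (P x) D"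
    and f: "f \<in> borel_measurable M" "\<And>x. x \<in> space M \<Longrightarrow> 0 \<le> f x \<and> f x \<le> 1"
  shows "\<exists>a. \<forall>x\<in>space M. a \<le> (\<integral>y. f y \<partial>kernel_pow M P t x) \<and>
    (\<integral>y. f y \<partial>kernel_pow M P t x) \<le> a + (1 - b) ^ t"
  using f
proof (induction t arbitrary: f)
  case 0
  have "(\<integral>y. f y \<partial>kernel_pow M P 0 x) = f x" if "x \<in> space M" for x
    by (rule integral_kernel_pow_0[OF that 0(1)])
  with 0(2) show ?case by (intro exI[of _ 0]) simp
next
  case (Suc t)
  have fb: "\<bar>f x\<bar> \<le> 1" if "x \<in> space M" for x using Suc.prems(2)[OF that] by auto
  define m where "m = b * (\<integral>x. f x \<partial>\<Lambda>)"
  define Pf where "Pf x = (\<integral>y. f y \<partial>P x)" for x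
  have Pf_m: "Pf \<in> borel_measurable M"
    unfolding Pf_def by (rule kernel_integral_measurable[OF P Suc.prems(1)])
  have range: "m \<le> Pf x \<and> Pf x \<le> m + (1 - b)" if x: "x \<in> space M" for x
  proof
    have Px: "P x \<in> space (prob_algebra M)" by (rule kernel_in_prob_algebra[OF P x])
    interpret PP: prob_space "P x" by (rule prob_algebraD[OF Px])
    interpret L: prob_space \<Lambda> by (rule prob_algebraD[OF \<Lambda>])
    show "m \<le> Pf x"
      unfolding m_def Pf_def by (rule minorization_integral[OF \<Lambda> Px b(1) minor[OF x] Suc.prems])
    have "b * (\<integral>y. 1 - f y \<partial>\<Lambda>) \<le> (\<integral>y. 1 - f y \<partial>P x)"
      by (rule minorization_integral[OF \<Lambda> Px b(1) minor[OF x], where B=1]) (use Suc.prems in auto)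
    moreover have "integrable (P x) f" "integrable \<Lambda> f"
      using integrable_bounded[OF _ Suc.prems(1) fb] Px \<Lambda> by auto
    ultimately show "Pf x \<le> m + (1 - b)"
      by (simp add: m_def Pf_def PP.prob_space L.prob_space algebra_simps)
  qed
  let ?h = "\<lambda>x. (Pf x - m) / (1 - b)"
  have h: "?h \<in> borel_measurable M" using Pf_m by simp
  have hb: "0 \<le> ?h x \<and> ?h x \<le> 1" if "x \<in> space M" for x
    using range[OF that] b by (auto simp: field_simps)
  obtain a where a: "\<And>x. x \<in> space M \<Longrightarrow> a \<le> (\<integral>y. ?h y \<partial>kernel_pow M P t x) \<and>
    (\<integral>y. ?h y \<partial>kernel_pow M P t x) \<le> a + (1 - b) ^ t"
    using Suc.IH[OF h hb] by blast
  show ?case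
  proof (intro exI[of _ "(1 - b) * a + m"] ballI)
    fix x assume x: "x \<in> space M"
    have K: "kernel_pow M P t x \<in> space (prob_algebra M)"
      by (rule kernel_in_prob_algebra[OF kernel_pow_measurable[OF P] x])
    interpret K: prob_space "kernel_pow M P t x" by (rule prob_algebraD[OF K])
    have "integrable (kernel_pow M P t x) Pf"
      by (rule integrable_bounded[OF K Pf_m, where B="\<bar>m\<bar> + 1"]) (use range b in fastforce)
    then have "(\<integral>y. ?h y \<partial>kernel_pow M P t x) = ((\<integral>y. Pf y \<partial>kernel_pow M P t x) - m) / (1 - b)"
      by (simp add: K.prob_space)
    moreover have "(\<integral>y. f y \<partial>kernel_pow M P (Suc t) x) = (\<integral>y. Pf y \<partial>kernel_pow M P t x)"
      unfolding Pf_def by (rule integral_kernel_pow_Suc[OF P x Suc.prems(1) fb])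
    ultimately show "(1 - b) * a + m \<le> (\<integral>y. f y \<partial>kernel_pow M P (Suc t) x) \<and>
      (\<integral>y. f y \<partial>kernel_pow M P (Suc t) x) \<le> (1 - b) * a + m + (1 - b) ^ Suc t"
      using a[OF x] b by (auto simp: field_simps)
  qed
qed

text \<open>
  A setwise limit of probability measures that is uniform over all measurable sets is again a
  probability measure: the uniformity carries the continuity at the empty set over to the limit.
\<close>

lemma uniform_setwise_limit_prob:
  assumes F: "\<And>t. F t \<in> space (prob_algebra M)"
    and e: "e \<longlonglongrightarrow> (0::real)"
    and cauchy: "\<And>s t D. D \<in> sets M \<Longrightarrow> t \<le> s \<Longrightarrow> \<bar>measure (F s) D - measure (F t) D\<bar> \<le> e t"
  obtains \<mu> where "\<mu> \<in> space (prob_algebra M)"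
    "\<And>t D. D \<in> sets M \<Longrightarrow> \<bar>measure \<mu> D - measure (F t) D\<bar> \<le> e t"
proof -
  define m where "m D = lim (\<lambda>t. measure (F t) D)" for D
  have conv: "(\<lambda>t. measure (F t) D) \<longlonglongrightarrow> m D" if D: "D \<in> sets M" for D
  proof -
    have "Cauchy (\<lambda>t. measure (F t) D)"
    proof (rule CauchyI')
      fix r :: real assume "0 < r"
      with e have "\<forall>\<^sub>F t in sequentially. e t < r" by (rule order_tendstoD)
      then obtain T where T: "\<And>t. t \<ge> T \<Longrightarrow> e t < r" by (auto simp: eventually_sequentially)
      have "norm (measure (F i) D - measure (F j) D) < r" if "T \<le> i" "i < j" for i j
        using cauchy[OF D, of i j] T[of i] that by (simp add: abs_minus_commute)
      then show "\<exists>M. \<forall>i\<ge>M. \<forall>n>i. dist (measure (F i) D) (measure (F n) D) < r"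
        by (auto simp: dist_norm)
    qed
    then show ?thesis unfolding m_def by (simp add: Cauchy_convergent_iff convergent_LIMSEQ_iff)
  qed
  have close: "\<bar>m D - measure (F t) D\<bar> \<le> e t" if D: "D \<in> sets M" for t D
  proof (rule tendsto_upperbound)
    show "(\<lambda>s. \<bar>measure (F s) D - measure (F t) D\<bar>) \<longlonglongrightarrow> \<bar>m D - measure (F t) D\<bar>"
      by (intro tendsto_intros conv D)
    show "\<forall>\<^sub>F s in sequentially. \<bar>measure (F s) D - measure (F t) D\<bar> \<le> e t"
      using eventually_ge_at_top[of t] by eventually_elim (rule cauchy[OF D])
  qed simp
  have nonneg: "0 \<le> m D" if "D \<in> sets M" for D
    by (rule tendsto_lowerbound[OF conv[OF that]]) auto
  have m_empty: "m {} = 0"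
    using LIMSEQ_unique[OF conv[of "{}"]] by simp
  have add: "additive (sets M) (\<lambda>D. ennreal (m D))"
    unfolding additive_def
  proof (intro ballI impI)
    fix A B assume AB: "A \<in> sets M" "B \<in> sets M" "A \<inter> B = {}"
    have "(\<lambda>t. measure (F t) A + measure (F t) B) \<longlonglongrightarrow> m A + m B"
      by (intro tendsto_intros conv AB)
    moreover have "measure (F t) (A \<union> B) = measure (F t) A + measure (F t) B" for t
    proof -
      interpret prob_space "F t" by (rule prob_algebraD[OF F])
      show ?thesis using AB prob_algebraD(2)[OF F] by (simp add: finite_measure_Union)
    qed
    ultimately have "m (A \<union> B) = m A + m B"
      using LIMSEQ_unique[OF conv[of "A \<union> B"]] AB by simp
    then show "ennreal (m (A \<union> B)) = ennreal (m A) + ennreal (m B)"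
      using nonneg AB by (simp add: ennreal_plus)
  qed
  have pos: "positive (sets M) (\<lambda>D. ennreal (m D))" by (simp add: positive_def m_empty)
  have ca: "countably_additive (sets M) (\<lambda>D. ennreal (m D))"
  proof (rule sets.empty_continuous_imp_countably_additive[OF pos add])
    show "\<forall>A\<in>sets M. ennreal (m A) \<noteq> \<infinity>" by simp
    fix A :: "nat \<Rightarrow> 'a set" assume A: "range A \<subseteq> sets M" "decseq A" "(\<Inter>i. A i) = {}"
    have "(\<lambda>i. m (A i)) \<longlonglongrightarrow> 0"
    proof (rule LIMSEQ_I)
      fix r :: real assume "0 < r"
      then have "\<forall>\<^sub>F t in sequentially. e t < r / 2" using e by (intro order_tendstoD) auto
      then obtain t where t: "e t < r / 2" by (auto simp: eventually_sequentially)
      interpret prob_space "F t" by (rule prob_algebraD[OF F])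
      have "(\<lambda>i. measure (F t) (A i)) \<longlonglongrightarrow> measure (F t) (\<Inter>i. A i)"
        by (rule finite_Lim_measure_decseq) (use A prob_algebraD(2)[OF F] in auto)
      then have "\<forall>\<^sub>F i in sequentially. measure (F t) (A i) < r / 2"
        using A(3) \<open>0 < r\<close> by (intro order_tendstoD) auto
      then obtain N where N: "\<And>i. i \<ge> N \<Longrightarrow> measure (F t) (A i) < r / 2"
        by (auto simp: eventually_sequentially)
      have "norm (m (A i) - 0) < r" if "i \<ge> N" for i
        using N[OF that] t close[of "A i" t] nonneg[of "A i"] A(1) by auto
      then show "\<exists>no. \<forall>i\<ge>no. norm (m (A i) - 0) < r" by blast
    qed
    then show "(\<lambda>i. ennreal (m (A i))) \<longlonglongrightarrow> 0"
      using tendsto_ennrealI by fastforce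
  qed
  define \<mu> where "\<mu> = measure_of (space M) (sets M) (\<lambda>D. ennreal (m D))"
  have sets_\<mu>: "sets \<mu> = sets M" by (simp add: \<mu>_def)
  have em: "emeasure \<mu> D = ennreal (m D)" if "D \<in> sets M" for D
    by (rule emeasure_measure_of[OF \<mu>_def]) (use sets.space_closed pos ca that in \<open>auto simp: sets_\<mu>\<close>)
  have me: "measure \<mu> D = m D" if "D \<in> sets M" for D
    using em[OF that] nonneg[OF that] by (simp add: measure_def)
  have "measure (F t) (space M) = 1" for t
    using prob_algebraD(1)[OF F, THEN prob_space.prob_space] prob_algebraD(3)[OF F] by metis
  with conv[of "space M"] have "(\<lambda>t. 1) \<longlonglongrightarrow> m (space M)" by simp
  from LIMSEQ_unique[OF tendsto_const this] have "m (space M) = 1" by simp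
  then have "prob_space \<mu>"
    using em[of "space M"] sets_eq_imp_space_eq[OF sets_\<mu>] by (intro prob_spaceI) simp
  with sets_\<mu> have "\<mu> \<in> space (prob_algebra M)" by (simp add: space_prob_algebra)
  moreover have "\<bar>measure \<mu> D - measure (F t) D\<bar> \<le> e t" if "D \<in> sets M" for t D
    using close[OF that] me[OF that] by simp
  ultimately show thesis by (rule that)
qed

text \<open>
  A \<open>[0, 1]\<close>-valued function lies within \<open>1 / k\<close> of the average of the indicators of its level
  sets \<open>{f \<ge> j / k}\<close>, which turns a uniform bound on sets into one on integrals.
\<close>

lemma integral_diff_le_setwise:
  fixes f :: "'a \<Rightarrow> real"
  assumes M: "M \<in> space (prob_algebra S)" and N: "N \<in> space (prob_algebra S)"
    and e: "\<And>D. D \<in> sets S \<Longrightarrow> \<bar>measure M D - measure N D\<bar> \<le> e"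
    and f: "f \<in> borel_measurable S" "\<And>x. x \<in> space S \<Longrightarrow> 0 \<le> f x \<and> f x \<le> 1"
  shows "\<bar>(\<integral>x. f x \<partial>M) - (\<integral>x. f x \<partial>N)\<bar> \<le> e"
proof (rule field_le_epsilon)
  fix r :: real assume r: "0 < r"
  obtain k :: nat where k: "0 < k" "2 / real k < r"
    using reals_Archimedean2[of "2 / r"] r
    by (metis divide_less_eq divide_pos_pos less_trans mult.commute of_nat_0_less_iff zero_less_numeral)
  define D where "D j = {x \<in> space S. real j / real k \<le> f x}" for j :: nat
  have D: "D j \<in> sets S" for j using f(1) unfolding D_def by measurable
  define h where "h x = (\<Sum>j=1..k. indicator (D j) x) / real k" for x
  have hm: "h \<in> borel_measurable S" unfolding h_def using D by measurable
  have h_near: "\<bar>f x - h x\<bar> \<le> 1 / real k" if x: "x \<in> space S" for x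
  proof -
    define i where "i = nat \<lfloor>real k * f x\<rfloor>"
    have i: "real i \<le> real k * f x" "real k * f x < real i + 1"
      using f(2)[OF x] by (auto simp: i_def)
    have "real k * f x \<le> real k" using f(2)[OF x] by (simp add: mult_left_le)
    with i(1) have "i \<le> k" by linarith
    have iff: "x \<in> D j \<longleftrightarrow> j \<le> i" for j
    proof -
      have "x \<in> D j \<longleftrightarrow> real j \<le> real k * f x" using x k by (simp add: D_def field_simps)
      also have "\<dots> \<longleftrightarrow> j \<le> i" using i by linarith
      finally show ?thesis .
    qed
    have "(\<Sum>j=1..k. indicator (D j) x) = (\<Sum>j=1..k. if j \<le> i then 1 else (0::real))"
      by (intro sum.cong) (auto simp: iff indicator_def)
    also have "\<dots> = real (card {j \<in> {1..k}. j \<le> i})" by (simp add: sum.If_cases Int_def)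
    also have "{j \<in> {1..k}. j \<le> i} = {1..i}" using \<open>i \<le> k\<close> by auto
    finally have "h x = real i / real k" by (simp add: h_def)
    then show ?thesis using i k by (simp add: abs_le_iff field_simps)
  qed
  have hb: "\<bar>h x\<bar> \<le> 2" if "x \<in> space S" for x
  proof -
    have "1 / real k \<le> 1" using k by simp
    with h_near[OF that] f(2)[OF that] show ?thesis by linarith
  qed
  have fb: "\<bar>f x\<bar> \<le> 1" if "x \<in> space S" for x using f(2)[OF that] by auto
  have hint: "(\<integral>x. h x \<partial>K) = (\<Sum>j=1..k. measure K (D j)) / real k"
    if K: "K \<in> space (prob_algebra S)" for K
  proof -
    interpret prob_space K by (rule prob_algebraD[OF K])
    have DK: "D j \<in> sets K" for j using D prob_algebraD(2)[OF K] by simp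
    have "integrable K (indicator (D j) :: 'a \<Rightarrow> real)" for j
      using DK by (simp add: less_top[symmetric])
    then have "(\<integral>x. (\<Sum>j=1..k. indicator (D j) x) \<partial>K) = (\<Sum>j=1..k. measure K (D j))"
      using DK sets.sets_into_space[OF DK]
      by (subst Bochner_Integration.integral_sum) (auto simp: Int_absorb2)
    then show ?thesis by (simp add: h_def)
  qed
  have "\<bar>(\<integral>x. h x \<partial>M) - (\<integral>x. h x \<partial>N)\<bar> = \<bar>\<Sum>j=1..k. measure M (D j) - measure N (D j)\<bar> / real k"
    using k by (simp add: hint[OF M] hint[OF N] diff_divide_distrib[symmetric] sum_subtractf)
  also have "\<dots> \<le> (\<Sum>j=1..k. e) / real k"
    by (intro divide_right_mono order_trans[OF sum_abs] sum_mono e D) auto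
  also have "\<dots> = e" using k by simp
  finally have "\<bar>(\<integral>x. h x \<partial>M) - (\<integral>x. h x \<partial>N)\<bar> \<le> e" .
  moreover have "\<bar>(\<integral>x. f x \<partial>M) - (\<integral>x. h x \<partial>M)\<bar> \<le> 1 / real k"
    by (rule integral_diff_le[OF M f(1) fb hm hb h_near])
  moreover have "\<bar>(\<integral>x. f x \<partial>N) - (\<integral>x. h x \<partial>N)\<bar> \<le> 1 / real k"
    by (rule integral_diff_le[OF N f(1) fb hm hb h_near])
  ultimately show "\<bar>(\<integral>x. f x \<partial>M) - (\<integral>x. f x \<partial>N)\<bar> \<le> e + r"
    using k(2) by (simp add: abs_le_iff)
qed

text \<open>
  The laws of the chain started at a fixed point form a uniform Cauchy sequence by the
  contraction; their limit is invariant, and the contraction leaves room for only one invariant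
  measure.
\<close>

theorem doeblin_unique_invariant_prob:
  assumes P: "P \<in> M \<rightarrow>\<^sub>M prob_algebra M" and \<Lambda>: "\<Lambda> \<in> space (prob_algebra M)"
    and b: "0 < b" "b < 1"
    and minor: "\<And>x D. x \<in> space M \<Longrightarrow> D \<in> sets M \<Longrightarrow> b * measure \<Lambda> D \<le> measure (P x) D"
  shows "\<exists>!\<mu>. invariant_prob M P \<mu>"
proof -
  have b0: "0 \<le> b" using b by simp
  have lim0: "(\<lambda>t. (1 - b) ^ t) \<longlonglongrightarrow> 0" using b by (intro LIMSEQ_power_zero) auto
  note contr = minorized_kernel_contracts[OF P \<Lambda> b0 b(2) minor]
  have spread: "\<bar>(\<integral>x. (\<integral>y. f y \<partial>kernel_pow M P t x) \<partial>\<sigma>) - (\<integral>x. (\<integral>y. f y \<partial>kernel_pow M P t x) \<partial>\<tau>)\<bar> \<le> (1 - b) ^ t"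
    if \<sigma>: "\<sigma> \<in> space (prob_algebra M)" and \<tau>: "\<tau> \<in> space (prob_algebra M)"
      and f: "f \<in> borel_measurable M" "\<And>x. x \<in> space M \<Longrightarrow> 0 \<le> f x \<and> f x \<le> 1"
    for \<sigma> \<tau> t and f :: "'a \<Rightarrow> real"
  proof -
    let ?g = "\<lambda>x. \<integral>y. f y \<partial>kernel_pow M P t x"
    obtain a where a: "\<And>x. x \<in> space M \<Longrightarrow> a \<le> ?g x \<and> ?g x \<le> a + (1 - b) ^ t"
      using contr[OF _ _ f] by blast
    have g: "?g \<in> borel_measurable M"
      by (rule kernel_integral_measurable[OF kernel_pow_measurable[OF P] f(1)])
    show ?thesis
      using integral_between[OF \<sigma> g a] integral_between[OF \<tau> g a] by (simp add: abs_le_iff)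
  qed
  have \<Lambda>_ne: "space M \<noteq> {}"
    using prob_space.not_empty[OF prob_algebraD(1)[OF \<Lambda>]] prob_algebraD(3)[OF \<Lambda>] by simp
  then obtain x0 where x0: "x0 \<in> space M" by blast
  define F where "F t = kernel_pow M P t x0" for t
  have F: "F t \<in> space (prob_algebra M)" for t
    unfolding F_def by (rule kernel_in_prob_algebra[OF kernel_pow_measurable[OF P] x0])
  have ind: "(\<integral>y. indicator D y \<partial>K) = measure K D"
    if "K \<in> space (prob_algebra M)" "D \<in> sets M" for K :: "'a measure" and D
    using prob_algebraD(2)[OF that(1)] that(2) sets.sets_into_space[of D K] by (simp add: Int_absorb2)
  have cauchy: "\<bar>measure (F s) D - measure (F t) D\<bar> \<le> (1 - b) ^ t"
    if D: "D \<in> sets M" and st: "t \<le> s" for s t D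
  proof -
    let ?f = "indicator D :: 'a \<Rightarrow> real"
    have f: "?f \<in> borel_measurable M" using D by simp
    have R: "return M x0 \<in> space (prob_algebra M)"
      using x0 by (simp add: space_prob_algebra prob_space_return)
    have "(\<integral>y. ?f y \<partial>F (s - t + t)) = (\<integral>z. (\<integral>y. ?f y \<partial>kernel_pow M P t z) \<partial>F (s - t))"
      unfolding F_def by (rule integral_kernel_pow_add[OF P x0 f, where B=1]) simp
    moreover have "(\<integral>y. ?f y \<partial>F t) = (\<integral>z. (\<integral>y. ?f y \<partial>kernel_pow M P t z) \<partial>return M x0)"
      unfolding F_def
      by (rule integral_return[symmetric])
         (use x0 kernel_integral_measurable[OF kernel_pow_measurable[OF P] f] in auto)
    ultimately show ?thesis
      using spread[OF F R f, where t=t and t1="s - t"] st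
      by (simp only: ind[OF F D] le_add_diff_inverse2) (simp add: indicator_def)
  qed
  obtain \<mu> where \<mu>: "\<mu> \<in> space (prob_algebra M)"
    and \<mu>_close: "\<And>t D. D \<in> sets M \<Longrightarrow> \<bar>measure \<mu> D - measure (F t) D\<bar> \<le> (1 - b) ^ t"
    using uniform_setwise_limit_prob[OF F lim0 cauchy] by blast
  have eqI: "\<mu>1 = \<mu>2"
    if m: "\<mu>1 \<in> space (prob_algebra M)" "\<mu>2 \<in> space (prob_algebra M)"
      and c: "\<And>t D. D \<in> sets M \<Longrightarrow> \<bar>measure \<mu>1 D - measure \<mu>2 D\<bar> \<le> C * (1 - b) ^ t" for \<mu>1 \<mu>2 C
  proof (rule measure_eqI)
    show "sets \<mu>1 = sets \<mu>2" using m by (simp add: space_prob_algebra)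
    fix D assume "D \<in> sets \<mu>1"
    then have D: "D \<in> sets M" using m by (simp add: space_prob_algebra)
    have "(\<lambda>t. C * (1 - b) ^ t) \<longlonglongrightarrow> C * 0" by (intro tendsto_intros lim0)
    then have "\<bar>measure \<mu>1 D - measure \<mu>2 D\<bar> \<le> C * 0"
      by (rule tendsto_lowerbound) (intro always_eventually allI c[OF D], simp)
    then have "measure \<mu>1 D = measure \<mu>2 D" by simp
    moreover have "finite_measure \<mu>1" "finite_measure \<mu>2"
      using prob_algebraD(1)[OF m(1)] prob_algebraD(1)[OF m(2)] by (auto simp: prob_space.finite_measure)
    ultimately show "emeasure \<mu>1 D = emeasure \<mu>2 D"
      by (simp add: finite_measure.emeasure_eq_measure)
  qed
  have \<mu>P: "\<mu> \<bind> P \<in> space (prob_algebra M)" by (rule bind_in_prob_algebra[OF \<mu> P])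
  have measure_bind: "measure (K \<bind> P) D = (\<integral>x. measure (P x) D \<partial>K)"
    if K: "K \<in> space (prob_algebra M)" and D: "D \<in> sets M" for K D
  proof -
    have "measure (K \<bind> P) D = (\<integral>y. indicator D y \<partial>(K \<bind> P))"
      using ind[OF bind_in_prob_algebra[OF K P] D] by simp
    also have "\<dots> = (\<integral>x. (\<integral>y. indicator D y \<partial>P x) \<partial>K)"
      by (rule integral_bind_kernel[OF K P, where B=1]) (use D in auto)
    also have "\<dots> = (\<integral>x. measure (P x) D \<partial>K)"
      by (rule Bochner_Integration.integral_cong[OF refl], rule ind[OF kernel_in_prob_algebra[OF P] D])
         (use prob_algebraD(3)[OF K] in simp)
    finally show ?thesis .
  qed
  have inv: "\<mu> \<bind> P = \<mu>"
  proof (rule eqI[OF \<mu>P \<mu>, where C=2])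
    fix t D assume D: "D \<in> sets M"
    have meas: "(\<lambda>x. measure (P x) D) \<in> borel_measurable M"
      using measurable_compose[OF P measurable_measure_prob_algebra[OF D]] .
    have "\<bar>(\<integral>x. measure (P x) D \<partial>\<mu>) - (\<integral>x. measure (P x) D \<partial>F t)\<bar> \<le> (1 - b) ^ t"
    proof (rule integral_diff_le_setwise[OF \<mu> F \<mu>_close meas])
      fix x assume "x \<in> space M"
      then interpret prob_space "P x" using prob_algebraD(1)[OF kernel_in_prob_algebra[OF P]] by blast
      show "0 \<le> measure (P x) D \<and> measure (P x) D \<le> 1" by simp
    qed
    moreover have "measure (F (Suc t)) D = (\<integral>x. measure (P x) D \<partial>F t)"
      using measure_bind[OF F D, of t] by (simp add: F_def)
    moreover have "(1 - b) ^ Suc t \<le> (1 - b) ^ t" using b by (simp add: mult_left_le_one_le)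
    ultimately show "\<bar>measure (\<mu> \<bind> P) D - measure \<mu> D\<bar> \<le> 2 * (1 - b) ^ t"
      using \<mu>_close[OF D, of "Suc t"] measure_bind[OF \<mu> D] by (simp add: abs_le_iff)
  qed
  have pow_inv: "(\<integral>x. (\<integral>y. f y \<partial>kernel_pow M P t x) \<partial>\<rho>) = (\<integral>x. f x \<partial>\<rho>)"
    if \<rho>: "\<rho> \<in> space (prob_algebra M)" "\<rho> \<bind> P = \<rho>" and f: "f \<in> test_functions M" for \<rho> t f
  proof -
    have "(\<integral>x. (\<integral>y. g y \<partial>P x) \<partial>\<rho>) = (\<integral>x. g x \<partial>\<rho>)" if "g \<in> test_functions M" for g
      using integral_bind_kernel[OF \<rho>(1) P, of g 1] \<rho>(2) that by (simp add: test_functions_def)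
    then have "\<bar>(\<integral>x. (\<integral>y. f y \<partial>kernel_pow M P t x) \<partial>\<rho>) - (\<integral>x. f x \<partial>\<rho>)\<bar> \<le> real t * 0"
      by (intro almost_invariant_iterate[OF P \<rho>(1) _ f]) simp
    then show ?thesis by simp
  qed
  show ?thesis
  proof (rule ex1I[of _ \<mu>])
    show "invariant_prob M P \<mu>" using \<mu> inv by (simp add: invariant_prob_def)
    fix \<rho> assume "invariant_prob M P \<rho>"
    then have \<rho>: "\<rho> \<in> space (prob_algebra M)" "\<rho> \<bind> P = \<rho>" by (auto simp: invariant_prob_def)
    show "\<rho> = \<mu>"
    proof (rule eqI[OF \<rho>(1) \<mu>, where C=1])
      fix t D assume D: "D \<in> sets M"
      let ?f = "indicator D :: 'a \<Rightarrow> real"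
      have f: "?f \<in> borel_measurable M" using D by simp
      have ft: "?f \<in> test_functions M" using D by (simp add: test_functions_def)
      show "\<bar>measure \<rho> D - measure \<mu> D\<bar> \<le> 1 * (1 - b) ^ t"
        using spread[OF \<rho>(1) \<mu> f, of t] pow_inv[OF \<rho> ft, of t] pow_inv[OF \<mu> inv ft, of t]
          ind[OF \<rho>(1) D] ind[OF \<mu> D] by (simp add: indicator_def)
    qed
  qed
qed

corollary doeblin_inv_measure:
  assumes "P \<in> M \<rightarrow>\<^sub>M prob_algebra M" "\<Lambda> \<in> space (prob_algebra M)" "0 < b" "b < 1"
    "\<And>x D. x \<in> space M \<Longrightarrow> D \<in> sets M \<Longrightarrow> b * measure \<Lambda> D \<le> measure (P x) D"
  shows "inv_measure M P \<in> space (prob_algebra M)"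
proof -
  have "\<exists>!\<mu>. invariant_prob M P \<mu>" by (rule doeblin_unique_invariant_prob[OF assms])
  then have "invariant_prob M P (inv_measure M P)" unfolding inv_measure_def by (rule theI')
  then show ?thesis unfolding invariant_prob_def by blast
qed

section \<open>Laws of the state-action process\<close>

definition state_action_law ::
  "'x measure \<Rightarrow> 'a measure \<Rightarrow> 'x measure \<Rightarrow> ('x \<times> 'a \<Rightarrow> 'x measure) \<Rightarrow> ('x, 'a) policy \<Rightarrow>
     nat \<Rightarrow> ('x \<times> 'a) measure" where
  "state_action_law MX MA \<gamma> p \<pi> t = distr (process_law MX MA \<gamma> p \<pi>) (MX \<Otimes>\<^sub>M MA) (\<lambda>\<omega>. \<omega> t)"

lemma process_law_in_prob_algebra:
  assumes "\<gamma> \<in> space (prob_algebra MX)" "p \<in> MX \<Otimes>\<^sub>M MA \<rightarrow>\<^sub>M prob_algebra MX" "\<pi> \<in> policies MX MA"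
  shows "process_law MX MA \<gamma> p \<pi> \<in> space (prob_algebra (\<Pi>\<^sub>M i\<in>UNIV. MX \<Otimes>\<^sub>M MA))"
proof -
  interpret IT: Ionescu_Tulcea "step_kernel MX MA \<gamma> p \<pi>" "\<lambda>_. MX \<Otimes>\<^sub>M MA"
    by (rule Ionescu_Tulcea_step_kernel[OF assms])
  have "prob_space (distr IT.PF.lim (PiM {} (\<lambda>_. MX \<Otimes>\<^sub>M MA)) (\<lambda>x. restrict x {}))"
    using IT.distr_lim[of "{}"] IT.PF.prob_space_P[of "{}"] by simp
  then have "prob_space IT.PF.lim"
    by (rule prob_space_distrD[rotated])
       (simp add: measurable_cong_sets[OF IT.PF.sets_lim refl] measurable_restrict)
  then show ?thesis
    by (simp add: space_prob_algebra process_law_def IT.PF.sets_lim)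
qed

lemma state_action_law_in_prob_algebra:
  assumes "\<gamma> \<in> space (prob_algebra MX)" "p \<in> MX \<Otimes>\<^sub>M MA \<rightarrow>\<^sub>M prob_algebra MX" "\<pi> \<in> policies MX MA"
  shows "state_action_law MX MA \<gamma> p \<pi> t \<in> space (prob_algebra (MX \<Otimes>\<^sub>M MA))"
  unfolding state_action_law_def
  by (rule distr_in_prob_algebra[OF process_law_in_prob_algebra[OF assms]]) simp

text \<open>
  \<open>H t\<close> is the law of the history before time \<open>t\<close>, that is, the finite-dimensional law from which
  the Ionescu-Tulcea construction obtains the next one.
\<close>

lemma state_action_law_via_history:
  fixes \<gamma> :: "'x measure" and \<pi> :: "('x, 'a) policy"
  assumes \<gamma>: "\<gamma> \<in> space (prob_algebra MX)" and p: "p \<in> MX \<Otimes>\<^sub>M MA \<rightarrow>\<^sub>M prob_algebra MX"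
    and \<pi>: "\<pi> \<in> policies MX MA"
  obtains H where
    "\<And>t. H t \<in> space (prob_algebra (\<Pi>\<^sub>M i\<in>{0..<t}. MX \<Otimes>\<^sub>M MA))"
    "\<And>t. state_action_law MX MA \<gamma> p \<pi> t = H t \<bind> step_kernel MX MA \<gamma> p \<pi> t"
    "\<And>s t. s < t \<Longrightarrow> distr (H t) (MX \<Otimes>\<^sub>M MA) (\<lambda>h. h s) = state_action_law MX MA \<gamma> p \<pi> s"
proof -
  let ?S = "MX \<Otimes>\<^sub>M MA" and ?K = "step_kernel MX MA \<gamma> p \<pi>"
  let ?L = "process_law MX MA \<gamma> p \<pi>"
  interpret IT: Ionescu_Tulcea ?K "\<lambda>_. ?S"
    by (rule Ionescu_Tulcea_step_kernel[OF assms])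
  have L: "?L \<in> space (prob_algebra (\<Pi>\<^sub>M i\<in>UNIV. ?S))" by (rule process_law_in_prob_algebra[OF assms])
  have sets_L: "sets ?L = sets (\<Pi>\<^sub>M i\<in>UNIV. ?S)" by (rule prob_algebraD[OF L])
  have restr: "(\<lambda>\<omega>. restrict \<omega> J) \<in> (\<Pi>\<^sub>M i\<in>UNIV. ?S) \<rightarrow>\<^sub>M (\<Pi>\<^sub>M i\<in>J. ?S)" for J :: "nat set"
    by (intro measurable_restrict) simp
  define H where "H t = distr ?L (\<Pi>\<^sub>M i\<in>{0..<t}. ?S) (\<lambda>\<omega>. restrict \<omega> {0..<t})" for t
  have Hp: "H t \<in> space (prob_algebra (\<Pi>\<^sub>M i\<in>{0..<t}. ?S))" for t
    unfolding H_def by (rule distr_in_prob_algebra[OF L restr])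
  have coord: "distr (H t) ?S (\<lambda>h. h s) = state_action_law MX MA \<gamma> p \<pi> s" if "s < t" for s t
  proof -
    have c: "(\<lambda>h. h s) \<in> (\<Pi>\<^sub>M i\<in>{0..<t}. ?S) \<rightarrow>\<^sub>M ?S"
      using that by (intro measurable_component_singleton) auto
    have r: "(\<lambda>\<omega>. restrict \<omega> {0..<t}) \<in> ?L \<rightarrow>\<^sub>M (\<Pi>\<^sub>M i\<in>{0..<t}. ?S)"
      using restr by (simp add: measurable_cong_sets[OF sets_L refl])
    show ?thesis
      unfolding H_def state_action_law_def distr_distr[OF c r] using that by (simp add: comp_def)
  qed
  let ?u = "\<lambda>_. undefined :: 'x \<times> 'a"
  have u: "?u \<in> space (\<Pi>\<^sub>M i\<in>{0..<0::nat}. ?S)" by (simp add: space_PiM)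
  have HC: "H t = IT.C 0 t ?u" for t
  proof -
    have "IT.up_to {0..<t} \<le> t" by (subst IT.up_to_iff) auto
    moreover have "t \<le> IT.up_to {0..<t}"
      using IT.up_to_less[of "{0..<t}" "t - 1"] by (cases t) auto
    ultimately have up: "IT.up_to {0..<t} = t" by simp
    have "H t = IT.CI {0..<t}"
      using IT.distr_lim[of "{0..<t}"] by (simp add: H_def process_law_def)
    also have "\<dots> = IT.C 0 t ?u"
      using IT.distr_C[of t t ?u 0, OF _ u] by (simp add: IT.CI_def up)
    finally show ?thesis .
  qed
  have step: "state_action_law MX MA \<gamma> p \<pi> t = H t \<bind> ?K t" for t
  proof -
    have c: "(\<lambda>h. h t) \<in> (\<Pi>\<^sub>M i\<in>{0..<Suc t}. ?S) \<rightarrow>\<^sub>M ?S"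
      by (intro measurable_component_singleton) auto
    have eP: "IT.eP t \<in> H t \<rightarrow>\<^sub>M subprob_algebra (\<Pi>\<^sub>M i\<in>{0..<Suc t}. ?S)"
      using IT.measurable_eP[of t] by (simp add: measurable_cong_sets[OF prob_algebraD(2)[OF Hp] refl])
    have ne: "space (H t) \<noteq> {}" by (rule prob_space.not_empty[OF prob_algebraD(1)[OF Hp]])
    have "state_action_law MX MA \<gamma> p \<pi> t = distr (H (Suc t)) ?S (\<lambda>h. h t)"
      by (rule coord[symmetric]) simp
    also have "H (Suc t) = H t \<bind> IT.eP t" by (simp add: HC)
    also have "distr (H t \<bind> IT.eP t) ?S (\<lambda>h. h t) = H t \<bind> (\<lambda>h. distr (IT.eP t h) ?S (\<lambda>h. h t))"
      by (rule distr_bind[OF eP ne c])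
    also have "\<dots> = H t \<bind> ?K t"
    proof (rule bind_cong[OF refl])
      fix h assume "h \<in> space (H t)"
      then have h: "h \<in> space (\<Pi>\<^sub>M i\<in>{0..<t}. ?S)" using prob_algebraD(3)[OF Hp] by simp
      have upd: "fun_upd h t \<in> ?K t h \<rightarrow>\<^sub>M (\<Pi>\<^sub>M i\<in>{0..<Suc t}. ?S)"
        unfolding measurable_cong_sets[OF IT.sets_P[OF h] refl]
        by (rule measurable_fun_upd[where J="{0..<t}"]) (use h in auto)
      have "distr (IT.eP t h) ?S (\<lambda>h. h t) = distr (?K t h) ?S ((\<lambda>h. h t) \<circ> fun_upd h t)"
        unfolding IT.eP_def by (rule distr_distr[OF c upd])
      also have "\<dots> = distr (?K t h) ?S (\<lambda>x. x)" by (simp add: comp_def)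
      also have "\<dots> = ?K t h" by (rule distr_id2[symmetric, OF IT.sets_P[OF h, symmetric], symmetric])
      finally show "distr (IT.eP t h) ?S (\<lambda>h. h t) = ?K t h" .
    qed
    finally show ?thesis .
  qed
  show thesis by (rule that[of H]) (use Hp step coord in auto)
qed

lemma step_kernel_integral:
  fixes f :: "'x \<times> 'a \<Rightarrow> real"
  assumes \<gamma>: "\<gamma> \<in> space (prob_algebra MX)" and p: "p \<in> MX \<Otimes>\<^sub>M MA \<rightarrow>\<^sub>M prob_algebra MX"
    and \<pi>: "\<pi> \<in> policies MX MA"
    and h: "h \<in> space (\<Pi>\<^sub>M i\<in>{0..<t}. MX \<Otimes>\<^sub>M MA)"
    and f: "f \<in> borel_measurable (MX \<Otimes>\<^sub>M MA)" "\<And>z. z \<in> space (MX \<Otimes>\<^sub>M MA) \<Longrightarrow> \<bar>f z\<bar> \<le> B"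
  shows "(\<integral>z. f z \<partial>step_kernel MX MA \<gamma> p \<pi> t h)
    = (\<integral>x. (\<integral>a. f (x, a) \<partial>\<pi> t (h, x)) \<partial>(if t = 0 then \<gamma> else p (h (t - 1))))"
proof -
  let ?m = "if t = 0 then \<gamma> else p (h (t - 1))"
  have pt: "\<pi> t \<in> (\<Pi>\<^sub>M i\<in>{0..<t}. MX \<Otimes>\<^sub>M MA) \<Otimes>\<^sub>M MX \<rightarrow>\<^sub>M prob_algebra MA"
    using \<pi> by (auto simp: policies_def hist_space_def)
  have m: "?m \<in> space (prob_algebra MX)"
  proof (cases t)
    case (Suc s)
    then have "h s \<in> space (MX \<Otimes>\<^sub>M MA)" using h by (auto simp: space_PiM PiE_iff)
    then show ?thesis using kernel_in_prob_algebra[OF p] Suc by simp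
  qed (use \<gamma> in simp)
  have \<pi>h: "(\<lambda>x. \<pi> t (h, x)) \<in> MX \<rightarrow>\<^sub>M prob_algebra MA"
    using measurable_compose[OF measurable_Pair1'[OF h] pt] .
  have D: "(\<lambda>x. distr (\<pi> t (h, x)) (MX \<Otimes>\<^sub>M MA) (Pair x)) \<in> MX \<rightarrow>\<^sub>M prob_algebra (MX \<Otimes>\<^sub>M MA)"
    by (rule measurable_distr_prob_space2[OF \<pi>h]) simp
  have "(\<integral>z. f z \<partial>step_kernel MX MA \<gamma> p \<pi> t h)
    = (\<integral>x. (\<integral>z. f z \<partial>distr (\<pi> t (h, x)) (MX \<Otimes>\<^sub>M MA) (Pair x)) \<partial>?m)"
    unfolding step_kernel_def by (rule integral_bind_kernel[OF m D f])
  also have "\<dots> = (\<integral>x. (\<integral>a. f (x, a) \<partial>\<pi> t (h, x)) \<partial>?m)"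
  proof (rule Bochner_Integration.integral_cong[OF refl])
    fix x assume "x \<in> space ?m"
    then have x: "x \<in> space MX" using prob_algebraD(3)[OF m] by simp
    show "(\<integral>z. f z \<partial>distr (\<pi> t (h, x)) (MX \<Otimes>\<^sub>M MA) (Pair x)) = (\<integral>a. f (x, a) \<partial>\<pi> t (h, x))"
      by (rule integral_distr_prob[OF kernel_in_prob_algebra[OF \<pi>h x] _ f(1)]) (use x in simp)
  qed
  finally show ?thesis .
qed

text \<open>
  The only consequence of the construction of the process that concerns arbitrary policies: the
  next state has the conditional law prescribed by \<open>p\<close>, whatever the policy does.
\<close>

lemma state_action_law_transition:
  fixes g :: "'x \<Rightarrow> real"
  assumes \<gamma>: "\<gamma> \<in> space (prob_algebra MX)" and p: "p \<in> MX \<Otimes>\<^sub>M MA \<rightarrow>\<^sub>M prob_algebra MX"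
    and \<pi>: "\<pi> \<in> policies MX MA"
    and g: "g \<in> borel_measurable MX" "\<And>x. x \<in> space MX \<Longrightarrow> \<bar>g x\<bar> \<le> B"
  shows "(\<integral>z. g (fst z) \<partial>state_action_law MX MA \<gamma> p \<pi> (Suc t))
    = (\<integral>z. (\<integral>y. g y \<partial>p z) \<partial>state_action_law MX MA \<gamma> p \<pi> t)"
proof -
  let ?S = "MX \<Otimes>\<^sub>M MA" and ?L = "state_action_law MX MA \<gamma> p \<pi>"
  let ?K = "step_kernel MX MA \<gamma> p \<pi> (Suc t)" and ?PS = "\<Pi>\<^sub>M i\<in>{0..<Suc t}. MX \<Otimes>\<^sub>M MA"
  obtain H where H: "H (Suc t) \<in> space (prob_algebra ?PS)"
    and L: "?L (Suc t) = H (Suc t) \<bind> ?K"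
    and c: "distr (H (Suc t)) ?S (\<lambda>h. h t) = ?L t"
    using state_action_law_via_history[OF \<gamma> p \<pi>] by (metis lessI)
  interpret IT: Ionescu_Tulcea "step_kernel MX MA \<gamma> p \<pi>" "\<lambda>_. ?S"
    by (rule Ionescu_Tulcea_step_kernel[OF \<gamma> p \<pi>])
  have K: "?K \<in> ?PS \<rightarrow>\<^sub>M prob_algebra ?S"
    using IT.P[of "Suc t"] IT.prob_space_P[of _ "Suc t"] IT.sets_P[of _ "Suc t"]
    by (intro measurable_prob_algebraI) auto
  have ct: "(\<lambda>h. h t) \<in> ?PS \<rightarrow>\<^sub>M ?S" by (intro measurable_component_singleton) auto
  have gm: "(\<lambda>z. g (fst z)) \<in> borel_measurable ?S" using g(1) by measurable
  have gb: "\<bar>g (fst z)\<bar> \<le> B" if "z \<in> space ?S" for z using g(2) that by (auto simp: space_pair_measure)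
  have pt: "\<pi> (Suc t) \<in> ?PS \<Otimes>\<^sub>M MX \<rightarrow>\<^sub>M prob_algebra MA"
    using \<pi> unfolding policies_def hist_space_def by blast
  have "(\<integral>z. g (fst z) \<partial>?L (Suc t)) = (\<integral>h. (\<integral>z. g (fst z) \<partial>?K h) \<partial>H (Suc t))"
    unfolding L by (rule integral_bind_kernel[OF H K gm gb])
  also have "\<dots> = (\<integral>h. (\<integral>y. g y \<partial>p (h t)) \<partial>H (Suc t))"
  proof (rule Bochner_Integration.integral_cong[OF refl])
    fix h assume "h \<in> space (H (Suc t))"
    then have h: "h \<in> space ?PS" using prob_algebraD(3)[OF H] by simp
    have ht: "h t \<in> space ?S" using measurable_space[OF ct h] .
    have "(\<integral>z. g (fst z) \<partial>?K h) = (\<integral>x. (\<integral>a. g x \<partial>\<pi> (Suc t) (h, x)) \<partial>p (h t))"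
      using step_kernel_integral[OF \<gamma> p \<pi> h gm gb] by simp
    also have "\<dots> = (\<integral>x. g x \<partial>p (h t))"
    proof (rule Bochner_Integration.integral_cong[OF refl])
      fix x assume "x \<in> space (p (h t))"
      then have "x \<in> space MX" using prob_algebraD(3)[OF kernel_in_prob_algebra[OF p ht]] by simp
      with h have "(h, x) \<in> space (?PS \<Otimes>\<^sub>M MX)" by (simp add: space_pair_measure)
      then have "prob_space (\<pi> (Suc t) (h, x))"
        using prob_algebraD(1)[OF kernel_in_prob_algebra[OF pt]] by blast
      then show "(\<integral>a. g x \<partial>\<pi> (Suc t) (h, x)) = g x" by (simp add: prob_space.prob_space)
    qed
    finally show "(\<integral>z. g (fst z) \<partial>?K h) = (\<integral>y. g y \<partial>p (h t))" .
  qed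
  also have "\<dots> = (\<integral>z. (\<integral>y. g y \<partial>p z) \<partial>distr (H (Suc t)) ?S (\<lambda>h. h t))"
    by (rule integral_distr_prob[symmetric, OF H ct kernel_integral_measurable[OF p g(1)]])
  finally show ?thesis by (simp only: c)
qed

definition stationary_policy :: "('x \<Rightarrow> 'a measure) \<Rightarrow> ('x, 'a) policy" where
  "stationary_policy \<phi> = (\<lambda>t hx. \<phi> (snd hx))"

lemma stationary_policy_in_policies:
  assumes "\<phi> \<in> stationary_policies MX MA"
  shows "stationary_policy \<phi> \<in> policies MX MA"
  using measurable_compose[OF measurable_snd] assms
  by (auto simp: policies_def stationary_policies_def stationary_policy_def hist_space_def)

lemma policy_kernel_measurable:
  assumes p: "p \<in> MX \<Otimes>\<^sub>M MA \<rightarrow>\<^sub>M prob_algebra N" and \<phi>: "\<phi> \<in> stationary_policies MX MA"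
  shows "policy_kernel p \<phi> \<in> MX \<rightarrow>\<^sub>M prob_algebra N"
  unfolding policy_kernel_def[abs_def]
  using measurable_bind_prob_space2[of \<phi> MX MA "\<lambda>x a. p (x, a)" N] p \<phi>
  by (simp add: stationary_policies_def)

lemma integral_policy_kernel:
  fixes g :: "'b \<Rightarrow> real"
  assumes p: "p \<in> MX \<Otimes>\<^sub>M MA \<rightarrow>\<^sub>M prob_algebra N" and \<phi>: "\<phi> \<in> stationary_policies MX MA"
    and x: "x \<in> space MX"
    and g: "g \<in> borel_measurable N" "\<And>x. x \<in> space N \<Longrightarrow> \<bar>g x\<bar> \<le> B"
  shows "(\<integral>y. g y \<partial>policy_kernel p \<phi> x) = (\<integral>a. (\<integral>y. g y \<partial>p (x, a)) \<partial>\<phi> x)"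
  unfolding policy_kernel_def
proof (rule integral_bind_kernel[OF _ _ g])
  show "\<phi> x \<in> space (prob_algebra MA)"
    using \<phi> x by (simp add: stationary_policies_def kernel_in_prob_algebra)
  show "(\<lambda>a. p (x, a)) \<in> MA \<rightarrow>\<^sub>M prob_algebra N"
    using measurable_compose[OF measurable_Pair1'[OF x] p] .
qed

lemma state_action_law_stationary_action:
  fixes f :: "'x \<times> 'a \<Rightarrow> real"
  assumes \<gamma>: "\<gamma> \<in> space (prob_algebra MX)" and p: "p \<in> MX \<Otimes>\<^sub>M MA \<rightarrow>\<^sub>M prob_algebra MX"
    and \<phi>: "\<phi> \<in> stationary_policies MX MA"
    and f: "f \<in> borel_measurable (MX \<Otimes>\<^sub>M MA)" "\<And>z. z \<in> space (MX \<Otimes>\<^sub>M MA) \<Longrightarrow> \<bar>f z\<bar> \<le> B"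
  shows "(\<integral>z. f z \<partial>state_action_law MX MA \<gamma> p (stationary_policy \<phi>) t)
    = (\<integral>z. (\<integral>a. f (fst z, a) \<partial>\<phi> (fst z)) \<partial>state_action_law MX MA \<gamma> p (stationary_policy \<phi>) t)"
proof -
  let ?S = "MX \<Otimes>\<^sub>M MA" and ?\<pi> = "stationary_policy \<phi>"
  let ?L = "state_action_law MX MA \<gamma> p ?\<pi>" and ?K = "step_kernel MX MA \<gamma> p ?\<pi> t"
  have \<pi>: "?\<pi> \<in> policies MX MA" by (rule stationary_policy_in_policies[OF \<phi>])
  have \<phi>': "\<phi> \<in> MX \<rightarrow>\<^sub>M prob_algebra MA" using \<phi> by (simp add: stationary_policies_def)
  interpret IT: Ionescu_Tulcea "step_kernel MX MA \<gamma> p ?\<pi>" "\<lambda>_. ?S"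
    by (rule Ionescu_Tulcea_step_kernel[OF \<gamma> p \<pi>])
  have K: "?K \<in> (\<Pi>\<^sub>M i\<in>{0..<t}. ?S) \<rightarrow>\<^sub>M prob_algebra ?S"
    using IT.P[of t] IT.prob_space_P[of _ t] IT.sets_P[of _ t]
    by (intro measurable_prob_algebraI) auto
  obtain H where H: "H t \<in> space (prob_algebra (\<Pi>\<^sub>M i\<in>{0..<t}. ?S))" and L: "?L t = H t \<bind> ?K"
    using state_action_law_via_history[OF \<gamma> p \<pi>] by metis
  define F where "F y = (\<integral>a. f (y, a) \<partial>\<phi> y)" for y
  have F: "F \<in> borel_measurable MX"
    unfolding F_def by (rule kernel_integral_measurable2[OF \<phi>' f(1)])
  have Fb: "\<bar>F y\<bar> \<le> B" if y: "y \<in> space MX" for y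
    unfolding F_def
    by (rule abs_integral_le[OF kernel_in_prob_algebra[OF \<phi>' y] measurable_compose[OF measurable_Pair1'[OF y] f(1)]])
       (use f(2) y in \<open>simp add: space_pair_measure\<close>)
  have Fm: "(\<lambda>z. F (fst z)) \<in> borel_measurable ?S" using F by measurable
  have Fmb: "\<bar>F (fst z)\<bar> \<le> B" if "z \<in> space ?S" for z using Fb that by (auto simp: space_pair_measure)
  have "(\<integral>z. f z \<partial>?L t) = (\<integral>h. (\<integral>z. f z \<partial>?K h) \<partial>H t)"
    unfolding L by (rule integral_bind_kernel[OF H K f])
  also have "\<dots> = (\<integral>h. (\<integral>z. F (fst z) \<partial>?K h) \<partial>H t)"
  proof (rule Bochner_Integration.integral_cong[OF refl])
    fix h assume "h \<in> space (H t)"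
    then have h: "h \<in> space (\<Pi>\<^sub>M i\<in>{0..<t}. ?S)" using prob_algebraD(3)[OF H] by blast
    let ?m = "if t = 0 then \<gamma> else p (h (t - 1))"
    have m: "space ?m = space MX"
    proof (cases t)
      case (Suc s)
      then have "h s \<in> space ?S" using h by (auto simp: space_PiM PiE_iff)
      then show ?thesis using prob_algebraD(3)[OF kernel_in_prob_algebra[OF p]] Suc by simp
    qed (use prob_algebraD(3)[OF \<gamma>] in simp)
    have "(\<integral>x. F x \<partial>?m) = (\<integral>x. (\<integral>a. F x \<partial>\<phi> x) \<partial>?m)"
      using prob_algebraD(1)[OF kernel_in_prob_algebra[OF \<phi>']] m
      by (intro Bochner_Integration.integral_cong[OF refl]) (simp add: prob_space.prob_space)
    then show "(\<integral>z. f z \<partial>?K h) = (\<integral>z. F (fst z) \<partial>?K h)"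
      using step_kernel_integral[OF \<gamma> p \<pi> h f] step_kernel_integral[OF \<gamma> p \<pi> h Fm Fmb]
      by (simp add: stationary_policy_def F_def)
  qed
  also have "\<dots> = (\<integral>z. F (fst z) \<partial>?L t)"
    unfolding L by (rule integral_bind_kernel[symmetric, OF H K Fm Fmb])
  finally show ?thesis by (simp only: F_def)
qed

lemma state_action_law_0:
  fixes g :: "'x \<Rightarrow> real"
  assumes \<gamma>: "\<gamma> \<in> space (prob_algebra MX)" and p: "p \<in> MX \<Otimes>\<^sub>M MA \<rightarrow>\<^sub>M prob_algebra MX"
    and \<pi>: "\<pi> \<in> policies MX MA"
    and g: "g \<in> borel_measurable MX" "\<And>x. x \<in> space MX \<Longrightarrow> \<bar>g x\<bar> \<le> B"
  shows "(\<integral>z. g (fst z) \<partial>state_action_law MX MA \<gamma> p \<pi> 0) = (\<integral>x. g x \<partial>\<gamma>)"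
proof -
  let ?S = "MX \<Otimes>\<^sub>M MA" and ?PS = "\<Pi>\<^sub>M i\<in>{0..<0::nat}. MX \<Otimes>\<^sub>M MA"
  let ?L = "state_action_law MX MA \<gamma> p \<pi>" and ?K = "step_kernel MX MA \<gamma> p \<pi> 0"
  interpret IT: Ionescu_Tulcea "step_kernel MX MA \<gamma> p \<pi>" "\<lambda>_. ?S"
    by (rule Ionescu_Tulcea_step_kernel[OF \<gamma> p \<pi>])
  have K: "?K \<in> ?PS \<rightarrow>\<^sub>M prob_algebra ?S"
    using IT.P[of 0] IT.prob_space_P[of _ 0] IT.sets_P[of _ 0]
    by (intro measurable_prob_algebraI) auto
  have pt: "\<pi> 0 \<in> ?PS \<Otimes>\<^sub>M MX \<rightarrow>\<^sub>M prob_algebra MA"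
    using \<pi> unfolding policies_def hist_space_def by blast
  obtain H where H: "H 0 \<in> space (prob_algebra ?PS)" and L: "?L 0 = H 0 \<bind> ?K"
    using state_action_law_via_history[OF \<gamma> p \<pi>] by metis
  have gm: "(\<lambda>z. g (fst z)) \<in> borel_measurable ?S" using g(1) by measurable
  have gb: "\<bar>g (fst z)\<bar> \<le> B" if "z \<in> space ?S" for z using g(2) that by (auto simp: space_pair_measure)
  have "(\<integral>z. g (fst z) \<partial>?L 0) = (\<integral>h. (\<integral>z. g (fst z) \<partial>?K h) \<partial>H 0)"
    unfolding L by (rule integral_bind_kernel[OF H K gm gb])
  also have "\<dots> = (\<integral>h. (\<integral>x. g x \<partial>\<gamma>) \<partial>H 0)"
  proof (rule Bochner_Integration.integral_cong[OF refl])
    fix h assume "h \<in> space (H 0)"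
    then have h: "h \<in> space ?PS" using prob_algebraD(3)[OF H] by blast
    have "(\<integral>z. g (fst z) \<partial>?K h) = (\<integral>x. (\<integral>a. g x \<partial>\<pi> 0 (h, x)) \<partial>\<gamma>)"
      using step_kernel_integral[OF \<gamma> p \<pi> h gm gb] by simp
    also have "\<dots> = (\<integral>x. g x \<partial>\<gamma>)"
    proof (rule Bochner_Integration.integral_cong[OF refl])
      fix x assume "x \<in> space \<gamma>"
      then have "(h, x) \<in> space (?PS \<Otimes>\<^sub>M MX)"
        using h prob_algebraD(3)[OF \<gamma>] by (simp add: space_pair_measure)
      then have "prob_space (\<pi> 0 (h, x))"
        using prob_algebraD(1)[OF kernel_in_prob_algebra[OF pt]] by blast
      then show "(\<integral>a. g x \<partial>\<pi> 0 (h, x)) = g x" by (simp add: prob_space.prob_space)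
    qed
    finally show "(\<integral>z. g (fst z) \<partial>?K h) = (\<integral>x. g x \<partial>\<gamma>)" .
  qed
  also have "\<dots> = (\<integral>x. g x \<partial>\<gamma>)"
    using prob_space.prob_space[OF prob_algebraD(1)[OF H]] by simp
  finally show ?thesis .
qed

text \<open>
  Under a stationary policy the state process is the Markov chain of \<open>policy_kernel p \<phi>\<close>, and the
  action is drawn from \<open>\<phi>\<close> at the current state.
\<close>

lemma state_action_law_stationary:
  fixes f :: "'x \<times> 'a \<Rightarrow> real"
  assumes \<gamma>: "\<gamma> \<in> space (prob_algebra MX)" and p: "p \<in> MX \<Otimes>\<^sub>M MA \<rightarrow>\<^sub>M prob_algebra MX"
    and \<phi>: "\<phi> \<in> stationary_policies MX MA"
    and f: "f \<in> borel_measurable (MX \<Otimes>\<^sub>M MA)" "\<And>z. z \<in> space (MX \<Otimes>\<^sub>M MA) \<Longrightarrow> \<bar>f z\<bar> \<le> B"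
  shows "(\<integral>z. f z \<partial>state_action_law MX MA \<gamma> p (stationary_policy \<phi>) t)
    = (\<integral>x. (\<integral>y. (\<integral>a. f (y, a) \<partial>\<phi> y) \<partial>kernel_pow MX (policy_kernel p \<phi>) t x) \<partial>\<gamma>)"
proof -
  let ?S = "MX \<Otimes>\<^sub>M MA" and ?\<pi> = "stationary_policy \<phi>"
  let ?L = "state_action_law MX MA \<gamma> p ?\<pi>" and ?P = "policy_kernel p \<phi>"
  have \<pi>: "?\<pi> \<in> policies MX MA" by (rule stationary_policy_in_policies[OF \<phi>])
  have \<phi>': "\<phi> \<in> MX \<rightarrow>\<^sub>M prob_algebra MA" using \<phi> by (simp add: stationary_policies_def)
  note P = policy_kernel_measurable[OF p \<phi>]
  have marginal: "(\<integral>z. g (fst z) \<partial>?L t) = (\<integral>x. (\<integral>y. g y \<partial>kernel_pow MX ?P t x) \<partial>\<gamma>)"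
    if g: "g \<in> borel_measurable MX" "\<And>x. x \<in> space MX \<Longrightarrow> \<bar>g x\<bar> \<le> B" for g
    using g
  proof (induction t arbitrary: g)
    case 0
    have "(\<integral>x. g x \<partial>\<gamma>) = (\<integral>x. (\<integral>y. g y \<partial>kernel_pow MX ?P 0 x) \<partial>\<gamma>)"
      using prob_algebraD(3)[OF \<gamma>] integral_kernel_pow_0[OF _ 0(1)]
      by (intro Bochner_Integration.integral_cong[OF refl]) metis
    with state_action_law_0[OF \<gamma> p \<pi> 0] show ?case by simp
  next
    case (Suc t)
    have Pg: "(\<lambda>x. \<integral>y. g y \<partial>?P x) \<in> borel_measurable MX"
      by (rule kernel_integral_measurable[OF P Suc.prems(1)])
    have Pgb: "\<bar>\<integral>y. g y \<partial>?P x\<bar> \<le> B" if "x \<in> space MX" for x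
      by (rule kernel_image_bounded[OF P Suc.prems that])
    have "(\<integral>z. g (fst z) \<partial>?L (Suc t)) = (\<integral>z. (\<integral>y. g y \<partial>p z) \<partial>?L t)"
      by (rule state_action_law_transition[OF \<gamma> p \<pi> Suc.prems])
    also have "\<dots> = (\<integral>z. (\<integral>a. (\<integral>y. g y \<partial>p (fst z, a)) \<partial>\<phi> (fst z)) \<partial>?L t)"
      by (rule state_action_law_stationary_action[OF \<gamma> p \<phi> kernel_integral_measurable[OF p Suc.prems(1)]
            kernel_image_bounded[OF p Suc.prems]])
    also have "\<dots> = (\<integral>z. (\<integral>y. g y \<partial>?P (fst z)) \<partial>?L t)"
      using prob_algebraD(3)[OF state_action_law_in_prob_algebra[OF \<gamma> p \<pi>]]
      by (intro Bochner_Integration.integral_cong[OF refl] integral_policy_kernel[OF p \<phi> _ Suc.prems, symmetric])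
         (auto simp: space_pair_measure)
    also have "\<dots> = (\<integral>x. (\<integral>w. (\<integral>y. g y \<partial>?P w) \<partial>kernel_pow MX ?P t x) \<partial>\<gamma>)"
      by (rule Suc.IH[OF Pg Pgb])
    also have "\<dots> = (\<integral>x. (\<integral>y. g y \<partial>kernel_pow MX ?P (Suc t) x) \<partial>\<gamma>)"
      using prob_algebraD(3)[OF \<gamma>] integral_kernel_pow_Suc[OF P _ Suc.prems]
      by (intro Bochner_Integration.integral_cong[OF refl]) metis
    finally show ?case .
  qed
  have Fb: "\<bar>\<integral>a. f (y, a) \<partial>\<phi> y\<bar> \<le> B" if y: "y \<in> space MX" for y
    by (rule abs_integral_le[OF kernel_in_prob_algebra[OF \<phi>' y] measurable_compose[OF measurable_Pair1'[OF y] f(1)]])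
       (use f(2) y in \<open>simp add: space_pair_measure\<close>)
  show ?thesis
    using state_action_law_stationary_action[OF \<gamma> p \<phi> f]
      marginal[OF kernel_integral_measurable2[OF \<phi>' f(1)] Fb] by simp
qed

section \<open>Occupation measures and average costs\<close>

text \<open>
  Invariance of the state marginal of a state-action measure under the transition law, up to
  \<open>s\<close> in total variation.  A positive \<open>s\<close> admits the occupation measures of finite horizons,
  so that no limit of them has to be constructed.
\<close>

definition almost_invariant ::
  "'x measure \<Rightarrow> 'a measure \<Rightarrow> ('x \<times> 'a \<Rightarrow> 'x measure) \<Rightarrow> real \<Rightarrow> ('x \<times> 'a) measure \<Rightarrow> bool" where
  "almost_invariant MX MA p s m \<longleftrightarrow> m \<in> space (prob_algebra (MX \<Otimes>\<^sub>M MA)) \<and>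
     (\<forall>g\<in>test_functions MX. \<bar>(\<integral>z. g (fst z) \<partial>m) - (\<integral>z. (\<integral>y. g y \<partial>p z) \<partial>m)\<bar> \<le> s)"

lemma almost_invariant_mono: "almost_invariant MX MA p s m \<Longrightarrow> s \<le> s' \<Longrightarrow> almost_invariant MX MA p s' m"
  unfolding almost_invariant_def by (meson order_trans)

lemma almost_invariantD:
  assumes "almost_invariant MX MA p s m"
  shows "m \<in> space (prob_algebra (MX \<Otimes>\<^sub>M MA))"
    "g \<in> test_functions MX \<Longrightarrow> \<bar>(\<integral>z. g (fst z) \<partial>m) - (\<integral>z. (\<integral>y. g y \<partial>p z) \<partial>m)\<bar> \<le> s"
  using assms by (auto simp: almost_invariant_def)

lemma pmf_mixture_in_prob_algebra:
  assumes L: "\<And>i. L i \<in> space (prob_algebra N)"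
  shows "measure_pmf w \<bind> L \<in> space (prob_algebra N)"
  by (rule bind_in_prob_algebra[where M="count_space UNIV"])
     (use L in \<open>auto simp: space_prob_algebra prob_space_measure_pmf\<close>)

lemma integral_pmf_mixture:
  fixes f :: "'b \<Rightarrow> real"
  assumes L: "\<And>i. L i \<in> space (prob_algebra N)"
    and f: "f \<in> borel_measurable N" "\<And>z. z \<in> space N \<Longrightarrow> \<bar>f z\<bar> \<le> B"
  shows "(\<integral>z. f z \<partial>(measure_pmf w \<bind> L)) = (\<integral>i. (\<integral>z. f z \<partial>L i) \<partial>measure_pmf w)"
  by (rule integral_bind_kernel[where M="count_space UNIV", OF _ _ f])
     (use L in \<open>auto simp: space_prob_algebra prob_space_measure_pmf\<close>)

definition mixture :: "real \<Rightarrow> 'b measure \<Rightarrow> 'b measure \<Rightarrow> 'b measure" where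
  "mixture \<theta> m1 m2 = measure_pmf (bernoulli_pmf \<theta>) \<bind> (\<lambda>b. if b then m1 else m2)"

lemma integral_mixture:
  fixes f :: "'b \<Rightarrow> real"
  assumes m: "m1 \<in> space (prob_algebra N)" "m2 \<in> space (prob_algebra N)" and \<theta>: "0 \<le> \<theta>" "\<theta> \<le> 1"
    and f: "f \<in> borel_measurable N" "\<And>z. z \<in> space N \<Longrightarrow> \<bar>f z\<bar> \<le> B"
  shows "(\<integral>z. f z \<partial>mixture \<theta> m1 m2) = \<theta> * (\<integral>z. f z \<partial>m1) + (1 - \<theta>) * (\<integral>z. f z \<partial>m2)"
proof -
  have L: "(if b then m1 else m2) \<in> space (prob_algebra N)" for b using m by simp
  show ?thesis
    unfolding mixture_def
    using integral_pmf_mixture[of "\<lambda>b. if b then m1 else m2", OF L f, where w="bernoulli_pmf \<theta>"] \<theta> by simp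
qed

lemma almost_invariant_mixture:
  assumes p: "p \<in> MX \<Otimes>\<^sub>M MA \<rightarrow>\<^sub>M prob_algebra MX"
    and m: "almost_invariant MX MA p s m1" "almost_invariant MX MA p s m2"
    and \<theta>: "0 \<le> \<theta>" "\<theta> \<le> 1"
  shows "almost_invariant MX MA p s (mixture \<theta> m1 m2)"
  unfolding almost_invariant_def
proof (intro conjI ballI)
  let ?m = "mixture \<theta> m1 m2"
  note mp = almost_invariantD(1)[OF m(1)] almost_invariantD(1)[OF m(2)]
  show "?m \<in> space (prob_algebra (MX \<Otimes>\<^sub>M MA))"
    unfolding mixture_def by (rule pmf_mixture_in_prob_algebra) (use mp in simp)
  fix g assume g: "g \<in> test_functions MX"
  then have gm: "g \<in> borel_measurable MX" and gb: "\<And>x. x \<in> space MX \<Longrightarrow> \<bar>g x\<bar> \<le> 1"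
    by (auto simp: test_functions_def)
  have 1: "(\<lambda>z. g (fst z)) \<in> borel_measurable (MX \<Otimes>\<^sub>M MA)" using gm by measurable
  have 2: "\<bar>g (fst z)\<bar> \<le> 1" if "z \<in> space (MX \<Otimes>\<^sub>M MA)" for z
    using gb that by (auto simp: space_pair_measure)
  define d where "d k = (\<integral>z. g (fst z) \<partial>k) - (\<integral>z. (\<integral>y. g y \<partial>p z) \<partial>k)" for k
  have "d ?m = \<theta> * d m1 + (1 - \<theta>) * d m2"
    using integral_mixture[OF mp \<theta> 1 2]
      integral_mixture[OF mp \<theta> kernel_integral_measurable[OF p gm] kernel_image_bounded[OF p gm gb]]
    by (simp add: d_def algebra_simps)
  moreover have "\<bar>d m1\<bar> \<le> s" "\<bar>d m2\<bar> \<le> s"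
    using m g by (auto simp: d_def almost_invariant_def)
  ultimately have "\<bar>d ?m\<bar> \<le> \<theta> * s + (1 - \<theta>) * s"
    using \<theta> abs_triangle_ineq[of "\<theta> * d m1" "(1 - \<theta>) * d m2"]
      mult_left_mono[of "\<bar>d m1\<bar>" s \<theta>] mult_left_mono[of "\<bar>d m2\<bar>" s "1 - \<theta>"]
    by (simp add: abs_mult)
  then show "\<bar>(\<integral>z. g (fst z) \<partial>?m) - (\<integral>z. (\<integral>y. g y \<partial>p z) \<partial>?m)\<bar> \<le> s"
    by (simp add: d_def algebra_simps)
qed

definition occupation_measure ::
  "'x measure \<Rightarrow> 'a measure \<Rightarrow> 'x measure \<Rightarrow> ('x \<times> 'a \<Rightarrow> 'x measure) \<Rightarrow> ('x, 'a) policy \<Rightarrow>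
     nat \<Rightarrow> ('x \<times> 'a) measure" where
  "occupation_measure MX MA \<gamma> p \<pi> T =
     measure_pmf (pmf_of_set {..<T}) \<bind> state_action_law MX MA \<gamma> p \<pi>"

context
  fixes MX :: "'x measure" and MA :: "'a measure" and \<gamma> p \<pi>
  assumes \<gamma>: "\<gamma> \<in> space (prob_algebra MX)" and p: "p \<in> MX \<Otimes>\<^sub>M MA \<rightarrow>\<^sub>M prob_algebra MX"
    and \<pi>: "\<pi> \<in> policies MX MA"
begin

lemma integral_occupation_measure:
  fixes f :: "'x \<times> 'a \<Rightarrow> real"
  assumes T: "0 < T"
    and f: "f \<in> borel_measurable (MX \<Otimes>\<^sub>M MA)" "\<And>z. z \<in> space (MX \<Otimes>\<^sub>M MA) \<Longrightarrow> \<bar>f z\<bar> \<le> B"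
  shows "(\<integral>z. f z \<partial>occupation_measure MX MA \<gamma> p \<pi> T)
    = (\<Sum>t<T. \<integral>z. f z \<partial>state_action_law MX MA \<gamma> p \<pi> t) / real T"
proof -
  have "{..<T} \<noteq> {}" using T by auto
  then show ?thesis
    unfolding occupation_measure_def
    using integral_pmf_mixture[of "state_action_law MX MA \<gamma> p \<pi>",
        OF state_action_law_in_prob_algebra[OF \<gamma> p \<pi>] f, where w="pmf_of_set {..<T}"]
    by (simp add: integral_pmf_of_set)
qed

text \<open>
  The sums over the present and over the next states telescope, leaving one initial and one final
  term, each at most \<open>1\<close>.
\<close>

lemma occupation_measure_almost_invariant:
  assumes T: "0 < T"
  shows "almost_invariant MX MA p (2 / real T) (occupation_measure MX MA \<gamma> p \<pi> T)"
  unfolding almost_invariant_def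
proof (intro conjI ballI)
  let ?L = "state_action_law MX MA \<gamma> p \<pi>"
  have L: "?L t \<in> space (prob_algebra (MX \<Otimes>\<^sub>M MA))" for t
    by (rule state_action_law_in_prob_algebra[OF \<gamma> p \<pi>])
  show "occupation_measure MX MA \<gamma> p \<pi> T \<in> space (prob_algebra (MX \<Otimes>\<^sub>M MA))"
    unfolding occupation_measure_def by (rule pmf_mixture_in_prob_algebra[OF L])
  fix g assume "g \<in> test_functions MX"
  then have gm: "g \<in> borel_measurable MX" and gb: "\<And>x. x \<in> space MX \<Longrightarrow> \<bar>g x\<bar> \<le> 1"
    by (auto simp: test_functions_def)
  have 1: "(\<lambda>z. g (fst z)) \<in> borel_measurable (MX \<Otimes>\<^sub>M MA)" using gm by measurable
  have 2: "\<bar>g (fst z)\<bar> \<le> 1" if "z \<in> space (MX \<Otimes>\<^sub>M MA)" for z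
    using gb that by (auto simp: space_pair_measure)
  define a where "a t = (\<integral>z. g (fst z) \<partial>?L t)" for t
  have a: "\<bar>a t\<bar> \<le> 1" for t unfolding a_def by (rule abs_integral_le[OF L 1 2])
  have "(\<integral>z. g (fst z) \<partial>occupation_measure MX MA \<gamma> p \<pi> T) = (\<Sum>t<T. a t) / real T"
    unfolding a_def by (rule integral_occupation_measure[OF T 1 2])
  moreover have "(\<integral>z. (\<integral>y. g y \<partial>p z) \<partial>occupation_measure MX MA \<gamma> p \<pi> T) = (\<Sum>t<T. a (Suc t)) / real T"
    using integral_occupation_measure[OF T kernel_integral_measurable[OF p gm] kernel_image_bounded[OF p gm gb]]
      state_action_law_transition[OF \<gamma> p \<pi> gm gb] by (simp add: a_def)
  moreover have "(\<Sum>t<T. a t) - (\<Sum>t<T. a (Suc t)) = a 0 - a T"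
    by (induction T) auto
  ultimately have "\<bar>(\<integral>z. g (fst z) \<partial>occupation_measure MX MA \<gamma> p \<pi> T)
      - (\<integral>z. (\<integral>y. g y \<partial>p z) \<partial>occupation_measure MX MA \<gamma> p \<pi> T)\<bar> = \<bar>a 0 - a T\<bar> / real T"
    using T by (simp add: diff_divide_distrib[symmetric])
  also have "\<dots> \<le> 2 / real T"
    using a[of 0] a[of T] by (intro divide_right_mono) auto
  finally show "\<bar>(\<integral>z. g (fst z) \<partial>occupation_measure MX MA \<gamma> p \<pi> T)
      - (\<integral>z. (\<integral>y. g y \<partial>p z) \<partial>occupation_measure MX MA \<gamma> p \<pi> T)\<bar> \<le> 2 / real T" .
qed

lemma expected_total_cost:
  fixes f :: "'x \<times> 'a \<Rightarrow> real"
  assumes f: "f \<in> borel_measurable (MX \<Otimes>\<^sub>M MA)" "\<And>z. z \<in> space (MX \<Otimes>\<^sub>M MA) \<Longrightarrow> \<bar>f z\<bar> \<le> B"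
  shows "(\<integral>\<omega>. (\<Sum>t<T. f (\<omega> t)) \<partial>process_law MX MA \<gamma> p \<pi>)
    = (\<Sum>t<T. \<integral>z. f z \<partial>state_action_law MX MA \<gamma> p \<pi> t)"
proof -
  let ?L = "process_law MX MA \<gamma> p \<pi>"
  have L: "?L \<in> space (prob_algebra (\<Pi>\<^sub>M i\<in>UNIV. MX \<Otimes>\<^sub>M MA))"
    by (rule process_law_in_prob_algebra[OF \<gamma> p \<pi>])
  have c: "(\<lambda>\<omega>. \<omega> t) \<in> (\<Pi>\<^sub>M i\<in>UNIV. MX \<Otimes>\<^sub>M MA) \<rightarrow>\<^sub>M MX \<Otimes>\<^sub>M MA" for t :: nat by simp
  have "integrable ?L (\<lambda>\<omega>. f (\<omega> t))" for t
    by (rule integrable_bounded[OF L measurable_compose[OF c f(1)]])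
       (use f(2) measurable_space[OF c] in blast)
  then show ?thesis
    using integral_distr_prob[OF L c f(1)]
    by (simp add: Bochner_Integration.integral_sum state_action_law_def)
qed

lemma avg_cost_eq_limsup_occupation:
  fixes f :: "'x \<times> 'a \<Rightarrow> real"
  assumes f: "f \<in> borel_measurable (MX \<Otimes>\<^sub>M MA)" "\<And>z. z \<in> space (MX \<Otimes>\<^sub>M MA) \<Longrightarrow> \<bar>f z\<bar> \<le> B"
  shows "avg_cost MX MA \<gamma> p f \<pi>
    = limsup (\<lambda>T. ereal (\<integral>z. f z \<partial>occupation_measure MX MA \<gamma> p \<pi> T))"
  unfolding avg_cost_def
proof (rule Limsup_eq)
  show "\<forall>\<^sub>F T in sequentially. ereal (1 / real T * (\<integral>\<omega>. (\<Sum>t<T. f (\<omega> t)) \<partial>process_law MX MA \<gamma> p \<pi>))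
      = ereal (\<integral>z. f z \<partial>occupation_measure MX MA \<gamma> p \<pi> T)"
    using eventually_gt_at_top[of 0]
    by eventually_elim (simp add: integral_occupation_measure[OF _ f] expected_total_cost[OF f])
qed

lemma avg_cost_bounds:
  fixes f :: "'x \<times> 'a \<Rightarrow> real"
  assumes f: "f \<in> borel_measurable (MX \<Otimes>\<^sub>M MA)" "\<And>z. z \<in> space (MX \<Otimes>\<^sub>M MA) \<Longrightarrow> 0 \<le> f z \<and> f z \<le> B"
  shows "0 \<le> avg_cost MX MA \<gamma> p f \<pi>" "avg_cost MX MA \<gamma> p f \<pi> \<le> ereal B"
proof -
  have fb: "\<bar>f z\<bar> \<le> B" if "z \<in> space (MX \<Otimes>\<^sub>M MA)" for z using f(2)[OF that] by auto
  note eq = avg_cost_eq_limsup_occupation[OF f(1) fb]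
  have b: "0 \<le> (\<integral>z. f z \<partial>occupation_measure MX MA \<gamma> p \<pi> T) \<and>
      (\<integral>z. f z \<partial>occupation_measure MX MA \<gamma> p \<pi> T) \<le> B" if "0 < T" for T
    using integral_between[OF almost_invariantD(1)[OF occupation_measure_almost_invariant[OF that]] f] by simp
  have "0 \<le> limsup (\<lambda>T. ereal (\<integral>z. f z \<partial>occupation_measure MX MA \<gamma> p \<pi> T))"
  proof (rule le_Limsup)
    show "\<forall>\<^sub>F T in sequentially. 0 \<le> ereal (\<integral>z. f z \<partial>occupation_measure MX MA \<gamma> p \<pi> T)"
      using eventually_gt_at_top[of 0] by eventually_elim (simp add: b)
  qed simp
  then show "0 \<le> avg_cost MX MA \<gamma> p f \<pi>" by (simp only: eq)
  have "limsup (\<lambda>T. ereal (\<integral>z. f z \<partial>occupation_measure MX MA \<gamma> p \<pi> T)) \<le> ereal B"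
  proof (rule Limsup_bounded)
    show "\<forall>\<^sub>F T in sequentially. ereal (\<integral>z. f z \<partial>occupation_measure MX MA \<gamma> p \<pi> T) \<le> ereal B"
      using eventually_gt_at_top[of 0] by eventually_elim (simp add: b)
  qed
  then show "avg_cost MX MA \<gamma> p f \<pi> \<le> ereal B" by (simp only: eq)
qed

text \<open>
  The limes superior bounds all sufficiently long averages, so that one horizon \<open>T\<close> serves
  finitely many cost functions at once.
\<close>

lemma policy_to_almost_invariant:
  fixes f :: "'i \<Rightarrow> 'x \<times> 'a \<Rightarrow> real"
  assumes I: "finite I" and s: "0 < s"
    and f: "\<And>i. i \<in> I \<Longrightarrow> f i \<in> borel_measurable (MX \<Otimes>\<^sub>M MA)"
      "\<And>i z. i \<in> I \<Longrightarrow> z \<in> space (MX \<Otimes>\<^sub>M MA) \<Longrightarrow> \<bar>f i z\<bar> \<le> B i"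
    and v: "\<And>i. i \<in> I \<Longrightarrow> avg_cost MX MA \<gamma> p (f i) \<pi> \<le> ereal (v i)"
  obtains m where "almost_invariant MX MA p s m" "\<forall>i\<in>I. (\<integral>z. f i z \<partial>m) \<le> v i + s"
proof -
  have "\<forall>\<^sub>F T in sequentially. \<forall>i\<in>I. (\<integral>z. f i z \<partial>occupation_measure MX MA \<gamma> p \<pi> T) < v i + s"
  proof (rule eventually_ball_finite[OF I], rule ballI)
    fix i assume i: "i \<in> I"
    have "limsup (\<lambda>T. ereal (\<integral>z. f i z \<partial>occupation_measure MX MA \<gamma> p \<pi> T)) < ereal (v i + s)"
      using v[OF i] avg_cost_eq_limsup_occupation[OF f(1)[OF i] f(2)[OF i]] s
      by (metis ereal_less_eq(3) le_less_trans less_add_same_cancel1 less_ereal.simps(1))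
    then have "\<forall>\<^sub>F T in sequentially.
        ereal (\<integral>z. f i z \<partial>occupation_measure MX MA \<gamma> p \<pi> T) < ereal (v i + s)"
      by (rule Limsup_lessD)
    then show "\<forall>\<^sub>F T in sequentially. (\<integral>z. f i z \<partial>occupation_measure MX MA \<gamma> p \<pi> T) < v i + s"
      by simp
  qed
  moreover have "\<forall>\<^sub>F T in sequentially. 2 / real T < s"
    by (rule order_tendstoD(2)[OF lim_const_over_n s])
  ultimately have "\<forall>\<^sub>F T in sequentially. 0 < T \<and> 2 / real T < s \<and>
      (\<forall>i\<in>I. (\<integral>z. f i z \<partial>occupation_measure MX MA \<gamma> p \<pi> T) < v i + s)"
    using eventually_gt_at_top[of 0] by eventually_elim auto
  then obtain T where T: "0 < T" "2 / real T < s"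
    "\<forall>i\<in>I. (\<integral>z. f i z \<partial>occupation_measure MX MA \<gamma> p \<pi> T) < v i + s"
    by (auto simp: eventually_sequentially)
  show thesis
    by (rule that[OF almost_invariant_mono[OF occupation_measure_almost_invariant[OF T(1)]]])
       (use T in \<open>auto intro: less_imp_le\<close>)
qed

end

text \<open>Geometrically fast convergence of the expected costs makes the superior limit a limit.\<close>

lemma avg_cost_stationary_policy:
  fixes f :: "'x \<times> 'a \<Rightarrow> real"
  assumes \<gamma>: "\<gamma> \<in> space (prob_algebra MX)" and p: "p \<in> MX \<Otimes>\<^sub>M MA \<rightarrow>\<^sub>M prob_algebra MX"
    and \<phi>: "\<phi> \<in> stationary_policies MX MA"
    and f: "f \<in> borel_measurable (MX \<Otimes>\<^sub>M MA)" "\<And>z. z \<in> space (MX \<Otimes>\<^sub>M MA) \<Longrightarrow> \<bar>f z\<bar> \<le> B"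
    and \<kappa>: "0 < \<kappa>" "\<kappa> < 1"
    and rate: "\<And>t. 1 \<le> t \<Longrightarrow>
      \<bar>(\<integral>x. (\<integral>y. (\<integral>a. f (y, a) \<partial>\<phi> y) \<partial>kernel_pow MX (policy_kernel p \<phi>) t x) \<partial>\<gamma>) - v\<bar> \<le> D * \<kappa> ^ t"
  shows "avg_cost MX MA \<gamma> p f (stationary_policy \<phi>) = ereal v"
proof -
  let ?\<pi> = "stationary_policy \<phi>"
  have \<pi>: "?\<pi> \<in> policies MX MA" by (rule stationary_policy_in_policies[OF \<phi>])
  define a where "a t = (\<integral>z. f z \<partial>state_action_law MX MA \<gamma> p ?\<pi> t)" for t
  define D' where "D' = max D \<bar>a 0 - v\<bar>"
  have D': "0 \<le> D'" by (simp add: D'_def)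
  have a: "\<bar>a t - v\<bar> \<le> D' * \<kappa> ^ t" for t
  proof (cases t)
    case (Suc s)
    then have "\<bar>a t - v\<bar> \<le> D * \<kappa> ^ t"
      using rate[of t] by (simp add: a_def state_action_law_stationary[OF \<gamma> p \<phi> f])
    also have "\<dots> \<le> D' * \<kappa> ^ t" using \<kappa> by (intro mult_right_mono) (auto simp: D'_def)
    finally show ?thesis .
  qed (simp add: D'_def)
  have bound: "\<bar>(\<integral>z. f z \<partial>occupation_measure MX MA \<gamma> p ?\<pi> T) - v\<bar> \<le> (D' / (1 - \<kappa>)) / real T"
    if T: "0 < T" for T
  proof -
    have "(\<integral>z. f z \<partial>occupation_measure MX MA \<gamma> p ?\<pi> T) - v = (\<Sum>t<T. a t - v) / real T"
      using T by (simp add: integral_occupation_measure[OF \<gamma> p \<pi> T f] a_def sum_subtractf diff_divide_distrib)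
    moreover have "\<bar>\<Sum>t<T. a t - v\<bar> \<le> (\<Sum>t<T. D' * \<kappa> ^ t)"
      by (intro order_trans[OF sum_abs] sum_mono a)
    moreover have "(\<Sum>t<T. D' * \<kappa> ^ t) \<le> D' * (1 / (1 - \<kappa>))"
    proof -
      have "(\<Sum>t<T. \<kappa> ^ t) \<le> (\<Sum>t. \<kappa> ^ t)"
        using \<kappa> by (intro sum_le_suminf summable_geometric) auto
      also have "\<dots> = 1 / (1 - \<kappa>)" using \<kappa> by (intro suminf_geometric) auto
      finally show ?thesis using D' by (simp only: sum_distrib_left[symmetric] mult_left_mono)
    qed
    ultimately show ?thesis
      using divide_right_mono[of "\<bar>\<Sum>t<T. a t - v\<bar>" "D' / (1 - \<kappa>)" "real T"] by simp
  qed
  have "(\<lambda>T. (\<integral>z. f z \<partial>occupation_measure MX MA \<gamma> p ?\<pi> T)) \<longlonglongrightarrow> v"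
  proof (rule LIM_zero_cancel, rule Lim_null_comparison)
    show "\<forall>\<^sub>F T in sequentially. norm ((\<integral>z. f z \<partial>occupation_measure MX MA \<gamma> p ?\<pi> T) - v)
        \<le> (D' / (1 - \<kappa>)) / real T"
      using eventually_gt_at_top[of 0] by eventually_elim (use bound in \<open>simp only: real_norm_def\<close>)
    show "(\<lambda>T. (D' / (1 - \<kappa>)) / real T) \<longlonglongrightarrow> 0" by (rule lim_const_over_n)
  qed
  then have "(\<lambda>T. ereal (\<integral>z. f z \<partial>occupation_measure MX MA \<gamma> p ?\<pi> T)) \<longlonglongrightarrow> ereal v" by simp
  then have "limsup (\<lambda>T. ereal (\<integral>z. f z \<partial>occupation_measure MX MA \<gamma> p ?\<pi> T)) = ereal v"
    by (intro lim_imp_Limsup) simp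
  then show ?thesis by (simp only: avg_cost_eq_limsup_occupation[OF \<gamma> p \<pi> f])
qed

section \<open>Disintegration over a finite state space\<close>

lemma integral_uniform_measure:
  fixes f :: "'a \<Rightarrow> real"
  assumes "finite_measure M" and A: "A \<in> sets M" "0 < measure M A" and f: "f \<in> borel_measurable M"
  shows "(\<integral>x. f x \<partial>uniform_measure M A) = (\<integral>x. indicator A x * f x \<partial>M) / measure M A"
proof -
  interpret finite_measure M by fact
  have "uniform_measure M A = density M (\<lambda>x. ennreal (indicator A x / measure M A))"
    unfolding uniform_measure_def
    by (rule density_cong)
       (use A in \<open>auto simp: emeasure_eq_measure indicator_def divide_ennreal[symmetric]\<close>)
  then have "(\<integral>x. f x \<partial>uniform_measure M A) = (\<integral>x. (indicator A x / measure M A) *\<^sub>R f x \<partial>M)"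
    using A f by (simp add: integral_density)
  also have "\<dots> = (\<integral>x. indicator A x * f x / measure M A \<partial>M)" by simp
  also have "\<dots> = (\<integral>x. indicator A x * f x \<partial>M) / measure M A" by (rule integral_divide_zero)
  finally show ?thesis .
qed

definition disintegrates ::
  "'y measure \<Rightarrow> 'a measure \<Rightarrow> ('y \<times> 'a) measure \<Rightarrow> ('y \<Rightarrow> 'a measure) \<Rightarrow> bool" where
  "disintegrates MY MA m \<phi> \<longleftrightarrow> \<phi> \<in> stationary_policies MY MA \<and>
     (\<forall>F\<in>borel_measurable (MY \<Otimes>\<^sub>M MA). \<forall>B::real. (\<forall>z\<in>space (MY \<Otimes>\<^sub>M MA). \<bar>F z\<bar> \<le> B) \<longrightarrow>
        (\<integral>z. F z \<partial>m) = (\<integral>z. (\<integral>a. F (fst z, a) \<partial>\<phi> (fst z)) \<partial>m))"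

lemma disintegrates_integral:
  fixes F :: "'y \<times> 'a \<Rightarrow> real"
  assumes "disintegrates MY MA m \<phi>" "F \<in> borel_measurable (MY \<Otimes>\<^sub>M MA)"
    "\<And>z. z \<in> space (MY \<Otimes>\<^sub>M MA) \<Longrightarrow> \<bar>F z\<bar> \<le> B"
  shows "(\<integral>z. F z \<partial>m) = (\<integral>z. (\<integral>a. F (fst z, a) \<partial>\<phi> (fst z)) \<partial>m)"
proof -
  have "\<forall>z\<in>space (MY \<Otimes>\<^sub>M MA). \<bar>F z\<bar> \<le> B" using assms(3) by simp
  with assms(1,2) show ?thesis unfolding disintegrates_def by blast
qed

text \<open>
  Over finitely many states the conditional law of the action is an elementary conditional
  probability; on states of probability zero any action law will do.
\<close>

lemma finite_disintegration:
  fixes MA :: "'a measure" and Y :: "'y set"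
  assumes Y: "finite Y" and m: "m \<in> space (prob_algebra (count_space Y \<Otimes>\<^sub>M MA))"
  shows "\<exists>\<phi>. disintegrates (count_space Y) MA m \<phi>"
proof -
  let ?S = "count_space Y \<Otimes>\<^sub>M MA"
  interpret m: prob_space m by (rule prob_algebraD[OF m])
  have sm: "sets m = sets ?S" "space m = space ?S" using prob_algebraD[OF m] by auto
  obtain y0 a0 where "(y0, a0) \<in> space ?S" using m.not_empty sm by fastforce
  then have a0: "a0 \<in> space MA" by (simp add: space_pair_measure)
  define C where "C y = {y} \<times> space MA" for y :: 'y
  have C: "C y \<in> sets m" if "y \<in> Y" for y
    unfolding sm C_def using that by (intro pair_measureI) auto
  define w where "w y = measure m (C y)" for y
  define \<phi> where "\<phi> y = (if 0 < w y then distr (uniform_measure m (C y)) MA snd else return MA a0)" for y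
  have snd: "snd \<in> uniform_measure m (C y) \<rightarrow>\<^sub>M MA" for y
    by (simp add: measurable_cong_sets[of "uniform_measure m (C y)" ?S] sm)
  have \<phi>: "\<phi> y \<in> space (prob_algebra MA)" if "y \<in> Y" for y
  proof (cases "0 < w y")
    case True
    then have "prob_space (uniform_measure m (C y))"
      by (intro prob_space_uniform_measure) (auto simp: w_def m.emeasure_eq_measure)
    then show ?thesis
      using True snd by (simp add: \<phi>_def space_prob_algebra prob_space.prob_space_distr)
  qed (use a0 in \<open>simp add: \<phi>_def space_prob_algebra prob_space_return\<close>)
  have stat: "\<phi> \<in> stationary_policies (count_space Y) MA"
    using \<phi> by (auto simp: stationary_policies_def)
  have int: "(\<integral>z. F z \<partial>m) = (\<integral>z. (\<integral>a. F (fst z, a) \<partial>\<phi> (fst z)) \<partial>m)"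
    if F: "F \<in> borel_measurable ?S" and Fb: "\<And>z. z \<in> space ?S \<Longrightarrow> \<bar>F z\<bar> \<le> B" for F and B :: real
  proof -
    define G where "G y = (\<integral>a. F (y, a) \<partial>\<phi> y)" for y
    have Fy: "(\<lambda>a. F (y, a)) \<in> borel_measurable MA" if "y \<in> Y" for y
      using measurable_compose[OF measurable_Pair1'[of y "count_space Y" MA] F] that by simp
    have Gb: "\<bar>G y\<bar> \<le> B" if "y \<in> Y" for y
      unfolding G_def
      by (rule abs_integral_le[OF \<phi>[OF that] Fy[OF that]]) (use Fb that in \<open>simp add: space_pair_measure\<close>)
    have Gm: "(\<lambda>z. G (fst z)) \<in> borel_measurable ?S"
      by (rule measurable_compose[OF measurable_fst]) simp
    have split: "(\<integral>z. H z \<partial>m) = (\<Sum>y\<in>Y. \<integral>z. indicator (C y) z * H z \<partial>m)"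
      if H: "H \<in> borel_measurable ?S" "\<And>z. z \<in> space ?S \<Longrightarrow> \<bar>H z\<bar> \<le> B" for H
    proof -
      have "integrable m H" by (rule integrable_bounded[OF m H])
      then have iH: "integrable m (\<lambda>z. indicator (C y) z * H z)" if "y \<in> Y" for y
        using C[OF that] integrable_real_mult_indicator[of "C y" m H] by (simp add: mult.commute)
      have "(\<Sum>y\<in>Y. indicator (C y) z * H z) = H z" if z: "z \<in> space m" for z
      proof -
        have "fst z \<in> Y" "snd z \<in> space MA" using z by (auto simp: sm space_pair_measure)
        then have "(\<Sum>y\<in>Y. indicator (C y) z * H z) = (\<Sum>y\<in>Y. if y = fst z then H z else 0)"
          by (intro sum.cong refl) (auto simp: C_def indicator_def mem_Times_iff)
        then show ?thesis using Y \<open>fst z \<in> Y\<close> by simp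
      qed
      then have "(\<integral>z. H z \<partial>m) = (\<integral>z. (\<Sum>y\<in>Y. indicator (C y) z * H z) \<partial>m)"
        by (intro Bochner_Integration.integral_cong refl) simp
      then show ?thesis using iH by (simp add: Bochner_Integration.integral_sum)
    qed
    have piece: "(\<integral>z. indicator (C y) z * F z \<partial>m) = (\<integral>z. indicator (C y) z * G (fst z) \<partial>m)" if y: "y \<in> Y" for y
    proof (cases "0 < w y")
      case True
      have "G y = (\<integral>z. F (y, snd z) \<partial>uniform_measure m (C y))"
        using True by (simp add: G_def \<phi>_def integral_distr[OF snd Fy[OF y]])
      also have "\<dots> = (\<integral>z. indicator (C y) z * F (y, snd z) \<partial>m) / w y"
        unfolding w_def
      proof (rule integral_uniform_measure[OF m.finite_measure_axioms C[OF y]])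
        show "0 < measure m (C y)" using True by (simp add: w_def)
        have "(\<lambda>z. F (y, snd z)) \<in> borel_measurable ?S"
          by (rule measurable_compose[OF measurable_snd Fy[OF y]])
        then show "(\<lambda>z. F (y, snd z)) \<in> borel_measurable m" by (simp add: measurable_cong_sets[OF sm(1) refl])
      qed
      also have "(\<integral>z. indicator (C y) z * F (y, snd z) \<partial>m) = (\<integral>z. indicator (C y) z * F z \<partial>m)"
        by (intro Bochner_Integration.integral_cong refl) (auto simp: indicator_def C_def)
      finally have "(\<integral>z. indicator (C y) z * F z \<partial>m) = w y * G y" using True by simp
      also have "\<dots> = (\<integral>z. indicator (C y) z * G y \<partial>m)"
        using C[OF y] sets.sets_into_space[OF C[OF y]] by (simp add: w_def Int_absorb2)
      also have "\<dots> = (\<integral>z. indicator (C y) z * G (fst z) \<partial>m)"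
        by (intro Bochner_Integration.integral_cong refl) (auto simp: indicator_def C_def)
      finally show ?thesis .
    next
      case False
      then have "measure m (C y) = 0" by (simp add: w_def zero_less_measure_iff)
      then have "C y \<in> null_sets m" using C[OF y] by (auto simp: null_sets_def m.emeasure_eq_measure)
      then have ae: "AE z in m. z \<notin> C y" by (rule AE_not_in)
      have "(\<integral>z. indicator (C y) z * H z \<partial>m) = 0" for H :: "_ \<Rightarrow> real"
        by (rule integral_eq_zero_AE) (use ae in eventually_elim, simp)
      then show ?thesis by simp
    qed
    have "\<bar>G (fst z)\<bar> \<le> B" if "z \<in> space ?S" for z using Gb that by (auto simp: space_pair_measure)
    then show ?thesis
      using split[OF F Fb] split[OF Gm] piece by (simp add: G_def)
  qed
  have "disintegrates (count_space Y) MA m \<phi>"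
    unfolding disintegrates_def
  proof (intro conjI ballI allI impI stat)
    fix F and B :: real
    assume F: "F \<in> borel_measurable ?S" "\<forall>z\<in>space ?S. \<bar>F z\<bar> \<le> B"
    show "(\<integral>z. F z \<partial>m) = (\<integral>z. (\<integral>a. F (fst z, a) \<partial>\<phi> (fst z)) \<partial>m)"
      by (rule int[OF F(1)]) (rule F(2)[rule_format])
  qed
  then show ?thesis by (rule exI[of _ \<phi>])
qed

section \<open>Comparing a model with its finite approximation\<close>

text \<open>
  The limit law is only required to exist, not to be given by \<open>inv_measure\<close>, whose defining
  description is meaningful under further conditions.
\<close>

definition uniformly_ergodic ::
  "'x measure \<Rightarrow> 'a measure \<Rightarrow> ('x \<times> 'a \<Rightarrow> 'x measure) \<Rightarrow> real \<Rightarrow> real \<Rightarrow> bool" where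
  "uniformly_ergodic MX MA p R \<kappa> \<longleftrightarrow>
     (\<forall>\<phi>\<in>stationary_policies MX MA. \<exists>\<mu>\<in>space (prob_algebra MX). \<forall>t\<ge>1. \<forall>x\<in>space MX.
        tv_dist (kernel_pow MX (policy_kernel p \<phi>) t x) \<mu> \<le> R * \<kappa> ^ t)"

lemma stationary_expectation_rate:
  fixes F :: "'x \<Rightarrow> real"
  assumes P: "P \<in> MX \<rightarrow>\<^sub>M prob_algebra MX" and \<gamma>: "\<gamma> \<in> space (prob_algebra MX)"
    and \<mu>: "\<mu> \<in> space (prob_algebra MX)"
    and r: "\<And>x. x \<in> space MX \<Longrightarrow> tv_dist (kernel_pow MX P t x) \<mu> \<le> r"
    and F: "F \<in> borel_measurable MX" "\<And>x. x \<in> space MX \<Longrightarrow> 0 \<le> F x \<and> F x \<le> C" and C: "0 < C"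
  shows "\<bar>(\<integral>x. (\<integral>y. F y \<partial>kernel_pow MX P t x) \<partial>\<gamma>) - (\<integral>x. F x \<partial>\<mu>)\<bar> \<le> C / 2 * r"
proof -
  note Pt = kernel_pow_measurable[OF P, of t]
  have Fb: "\<bar>F x\<bar> \<le> C" if "x \<in> space MX" for x using F(2)[OF that] by auto
  interpret prob_space \<gamma> by (rule prob_algebraD[OF \<gamma>])
  have "\<bar>(\<integral>x. (\<integral>y. F y \<partial>kernel_pow MX P t x) \<partial>\<gamma>) - (\<integral>x. (\<integral>y. F y \<partial>\<mu>) \<partial>\<gamma>)\<bar> \<le> C / 2 * r"
  proof (rule integral_diff_le[OF \<gamma> kernel_integral_measurable[OF Pt F(1)] kernel_image_bounded[OF Pt F(1) Fb]])
    fix x assume x: "x \<in> space MX"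
    show "\<bar>(\<integral>y. F y \<partial>kernel_pow MX P t x) - (\<integral>y. F y \<partial>\<mu>)\<bar> \<le> C / 2 * r"
      by (rule integral_diff_le_half[OF kernel_in_prob_algebra[OF Pt x] \<mu> _ F C])
         (use abs_integral_diff_le_tv_dist[OF kernel_in_prob_algebra[OF Pt x] \<mu>] r[OF x] in \<open>blast intro: order_trans\<close>)
  qed auto
  then show ?thesis by (simp add: prob_space)
qed

text \<open>
  The original model is \<open>p\<close> on \<open>MX\<close>; below, \<open>p\<^sub>Y\<close> on \<open>MY\<close> is the finite model and \<open>p\<^sub>X\<close> its extension
  to \<open>MX\<close>, to which the second ergodicity condition refers.
\<close>

locale finite_approximation =
  fixes MX :: "'x measure" and MA :: "'a measure" and p :: "'x \<times> 'a \<Rightarrow> 'x measure"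
    and Y :: "'x set" and Q :: "'x \<Rightarrow> 'x" and \<nu> :: "'x measure"
  assumes p: "p \<in> MX \<Otimes>\<^sub>M MA \<rightarrow>\<^sub>M prob_algebra MX"
    and Q: "Q \<in> MX \<rightarrow>\<^sub>M count_space Y"
    and finite_Y: "finite Y"
    and \<nu>: "finite_measure \<nu>" "sets \<nu> = sets MX"
    and cell_pos: "\<And>y. y \<in> Y \<Longrightarrow> 0 < emeasure \<nu> (cell (space MX) Q y)"
begin

abbreviation "MY \<equiv> count_space Y"
abbreviation "cell_measure y \<equiv> uniform_measure \<nu> (cell (space MX) Q y)"
abbreviation "p\<^sub>Y \<equiv> fin_kernel (space MX) Y Q \<nu> p"
abbreviation "p\<^sub>X \<equiv> ext_kernel (space MX) Q \<nu> p"
abbreviation "cost\<^sub>Y \<equiv> fin_cost (space MX) Q \<nu>"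

text \<open>
  The common source of both approximations: the extension evaluates it at the cell of the current
  state, and the finite model records only the cell of the outcome.
\<close>

definition cell_kernel :: "'x \<times> 'a \<Rightarrow> 'x measure" where
  "cell_kernel = (\<lambda>(y, a). cell_measure y \<bind> (\<lambda>z. p (z, a)))"

lemma ext_kernel_eq: "p\<^sub>X (x, a) = cell_kernel (Q x, a)"
  by (simp add: ext_kernel_def cell_kernel_def)

lemma Q_space: "x \<in> space MX \<Longrightarrow> Q x \<in> Y"
  using measurable_space[OF Q] by simp

lemma cell_sets: "y \<in> Y \<Longrightarrow> cell (space MX) Q y \<in> sets MX"
  using measurable_sets[OF Q, of "{y}"] by (simp add: cell_def vimage_def Int_def conj_commute)

lemma cell_measure_prob: "y \<in> Y \<Longrightarrow> cell_measure y \<in> space (prob_algebra MX)"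
  using cell_pos[of y] \<nu> finite_measure.emeasure_finite[OF \<nu>(1)]
  by (auto simp: space_prob_algebra intro!: prob_space_uniform_measure)

lemma AE_cell_measure: "y \<in> Y \<Longrightarrow> AE x in cell_measure y. x \<in> space MX \<and> Q x = y"
  using cell_sets[of y] \<nu>(2)
  by (intro AE_uniform_measureI) (auto simp: cell_def)

lemma cell_average_near:
  fixes f :: "'x \<Rightarrow> real"
  assumes y: "y \<in> Y" and f: "f \<in> borel_measurable MX" "\<And>x. x \<in> space MX \<Longrightarrow> \<bar>f x\<bar> \<le> B"
    and v: "\<And>x. x \<in> space MX \<Longrightarrow> Q x = y \<Longrightarrow> \<bar>f x - v\<bar> \<le> e"
  shows "\<bar>(\<integral>x. f x \<partial>cell_measure y) - v\<bar> \<le> e"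
proof -
  interpret prob_space "cell_measure y" by (rule prob_algebraD[OF cell_measure_prob[OF y]])
  have int: "integrable (cell_measure y) f" by (rule integrable_bounded[OF cell_measure_prob[OF y] f])
  have "(\<integral>x. f x \<partial>cell_measure y) \<le> v + e"
    by (rule integral_le_const[OF int]) (use AE_cell_measure[OF y] in eventually_elim, use v in \<open>force simp: abs_le_iff\<close>)
  moreover have "v - e \<le> (\<integral>x. f x \<partial>cell_measure y)"
    by (rule integral_ge_const[OF int]) (use AE_cell_measure[OF y] in eventually_elim, use v in \<open>force simp: abs_le_iff\<close>)
  ultimately show ?thesis by (simp add: abs_le_iff)
qed

lemma cell_kernel_measurable: "cell_kernel \<in> MY \<Otimes>\<^sub>M MA \<rightarrow>\<^sub>M prob_algebra MX"
proof (rule measurable_pair_measure_countable1)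
  show "countable Y" using finite_Y by (rule countable_finite)
  fix y assume y: "y \<in> Y"
  have "(\<lambda>(a, z). p (z, a)) \<in> MA \<Otimes>\<^sub>M MX \<rightarrow>\<^sub>M prob_algebra MX"
    using measurable_compose[OF measurable_pair_swap' p] by (simp add: split_beta')
  with measurable_bind_prob_space2[OF measurable_const[OF cell_measure_prob[OF y]],
      where M=MA and R=MX and g="\<lambda>a z. p (z, a)"]
  show "(\<lambda>a. cell_kernel (y, a)) \<in> MA \<rightarrow>\<^sub>M prob_algebra MX" by (simp add: cell_kernel_def)
qed

lemma ext_kernel_measurable: "p\<^sub>X \<in> MX \<Otimes>\<^sub>M MA \<rightarrow>\<^sub>M prob_algebra MX"
proof -
  have "(\<lambda>z. (Q (fst z), snd z)) \<in> MX \<Otimes>\<^sub>M MA \<rightarrow>\<^sub>M MY \<Otimes>\<^sub>M MA"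
    using Q by measurable
  from measurable_compose[OF this cell_kernel_measurable]
  show ?thesis by (simp add: ext_kernel_eq[symmetric])
qed

lemma integral_cell_kernel:
  fixes g :: "'x \<Rightarrow> real"
  assumes y: "y \<in> Y" and a: "a \<in> space MA"
    and g: "g \<in> borel_measurable MX" "\<And>x. x \<in> space MX \<Longrightarrow> \<bar>g x\<bar> \<le> B"
  shows "(\<integral>x. g x \<partial>cell_kernel (y, a)) = (\<integral>z. (\<integral>x. g x \<partial>p (z, a)) \<partial>cell_measure y)"
  unfolding cell_kernel_def split
  by (rule integral_bind_kernel[OF cell_measure_prob[OF y] _ g])
     (use measurable_compose[OF measurable_Pair2'[OF a] p] in simp)

lemma fin_kernel_eq_distr:
  assumes y: "y \<in> Y" and a: "a \<in> space MA"
  shows "p\<^sub>Y (y, a) = distr (cell_kernel (y, a)) MY Q"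
proof (rule measure_eqI_finite[of _ Y])
  have ya: "(y, a) \<in> space (MY \<Otimes>\<^sub>M MA)" using y a by (simp add: space_pair_measure)
  note ck = kernel_in_prob_algebra[OF cell_kernel_measurable ya]
  interpret prob_space "cell_kernel (y, a)" by (rule prob_algebraD[OF ck])
  show "sets (p\<^sub>Y (y, a)) = Pow Y" by (simp add: fin_kernel_def point_measure_def)
  show "sets (distr (cell_kernel (y, a)) MY Q) = Pow Y" by simp
  show "finite Y" by (rule finite_Y)
  fix z assume z: "z \<in> Y"
  let ?f = "\<lambda>z. ennreal (\<integral>x. measure (p (x, a)) (cell (space MX) Q z) \<partial>cell_measure y)"
  have "emeasure (p\<^sub>Y (y, a)) {z} = (\<Sum>x\<in>{z}. ?f x)"
    unfolding fin_kernel_def split by (rule emeasure_point_measure_finite[OF finite_Y]) (use z in simp)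
  also have "\<dots> = ?f z" by simp
  also have "(\<integral>x. measure (p (x, a)) (cell (space MX) Q z) \<partial>cell_measure y)
      = (\<integral>x. (\<integral>w. indicator (cell (space MX) Q z) w \<partial>p (x, a)) \<partial>cell_measure y)"
  proof (rule Bochner_Integration.integral_cong[OF refl])
    fix x assume "x \<in> space (cell_measure y)"
    then have "(x, a) \<in> space (MX \<Otimes>\<^sub>M MA)"
      using a prob_algebraD(3)[OF cell_measure_prob[OF y]] by (simp add: space_pair_measure)
    then have "sets (p (x, a)) = sets MX" by (rule prob_algebraD(2)[OF kernel_in_prob_algebra[OF p]])
    then show "measure (p (x, a)) (cell (space MX) Q z) = (\<integral>w. indicator (cell (space MX) Q z) w \<partial>p (x, a))"
      using cell_sets[OF z] sets.sets_into_space[of "cell (space MX) Q z" "p (x, a)"]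
      by (simp add: Int_absorb2)
  qed
  also have "\<dots> = (\<integral>w. indicator (cell (space MX) Q z) w \<partial>cell_kernel (y, a))"
    by (rule integral_cell_kernel[OF y a, symmetric, where B=1]) (use cell_sets[OF z] in auto)
  also have "\<dots> = measure (cell_kernel (y, a)) (cell (space MX) Q z)"
    using cell_sets[OF z] prob_algebraD(2)[OF ck] sets.sets_into_space[of "cell (space MX) Q z" "cell_kernel (y, a)"]
    by (simp add: Int_absorb2)
  also have "cell (space MX) Q z = Q -` {z} \<inter> space (cell_kernel (y, a))"
    using prob_algebraD(3)[OF ck] by (auto simp: cell_def)
  also have "ennreal (measure (cell_kernel (y, a)) \<dots>) = emeasure (distr (cell_kernel (y, a)) MY Q) {z}"
    using z Q prob_algebraD(2)[OF ck]
    by (subst emeasure_distr) (auto simp: emeasure_eq_measure cong: measurable_cong_sets)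
  finally show "emeasure (p\<^sub>Y (y, a)) {z} = emeasure (distr (cell_kernel (y, a)) MY Q) {z}" .
qed

lemma fin_kernel_measurable: "p\<^sub>Y \<in> MY \<Otimes>\<^sub>M MA \<rightarrow>\<^sub>M prob_algebra MY"
proof -
  have "(\<lambda>z. distr (cell_kernel z) MY Q) \<in> MY \<Otimes>\<^sub>M MA \<rightarrow>\<^sub>M prob_algebra MY"
    by (rule measurable_compose[OF cell_kernel_measurable measurable_distr_prob_space[OF Q]])
  then show ?thesis
    by (rule measurable_cong[THEN iffD2, rotated]) (auto simp: space_pair_measure fin_kernel_eq_distr)
qed

lemma integral_fin_kernel:
  fixes f :: "'x \<Rightarrow> real"
  assumes y: "y \<in> Y" and a: "a \<in> space MA"
  shows "(\<integral>z. f z \<partial>p\<^sub>Y (y, a)) = (\<integral>x. f (Q x) \<partial>cell_kernel (y, a))"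
proof -
  have "(y, a) \<in> space (MY \<Otimes>\<^sub>M MA)" using y a by (simp add: space_pair_measure)
  then show ?thesis
    unfolding fin_kernel_eq_distr[OF y a]
    by (intro integral_distr_prob[OF kernel_in_prob_algebra[OF cell_kernel_measurable] Q]) auto
qed

lemma Q_MY_measurable: "f \<in> MY \<rightarrow>\<^sub>M N \<Longrightarrow> (\<lambda>x. f (Q x)) \<in> MX \<rightarrow>\<^sub>M N"
  using measurable_compose[OF Q] .

lemma lift_policy: "\<phi> \<in> stationary_policies MY MA \<Longrightarrow> (\<lambda>x. \<phi> (Q x)) \<in> stationary_policies MX MA"
  unfolding stationary_policies_def by (rule Q_MY_measurable)

lemma lift_pair_measurable: "(\<lambda>z. (Q (fst z), snd z)) \<in> MX \<Otimes>\<^sub>M MA \<rightarrow>\<^sub>M MY \<Otimes>\<^sub>M MA"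
  using Q by measurable

lemma policyD:
  assumes "\<phi> \<in> stationary_policies MY MA" "y \<in> Y"
  shows "\<phi> y \<in> space (prob_algebra MA)"
  using assms by (auto simp: stationary_policies_def Pi_iff)

text \<open>
  The extended kernel depends on the state only through its cell, so that \<open>Q\<close> maps its chains to
  those of the finite model.
\<close>

lemma fin_policy_kernel_lift:
  fixes f :: "'x \<Rightarrow> real"
  assumes \<phi>: "\<phi> \<in> stationary_policies MY MA" and x: "x \<in> space MX"
    and f: "\<And>y. y \<in> Y \<Longrightarrow> \<bar>f y\<bar> \<le> B"
  shows "(\<integral>z. f z \<partial>policy_kernel p\<^sub>Y \<phi> (Q x)) = (\<integral>z. f (Q z) \<partial>policy_kernel p\<^sub>X (\<lambda>x. \<phi> (Q x)) x)"
proof -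
  have fQ: "(\<lambda>z. f (Q z)) \<in> borel_measurable MX" by (rule Q_MY_measurable) simp
  have fQb: "\<bar>f (Q z)\<bar> \<le> B" if "z \<in> space MX" for z using f[OF Q_space[OF that]] .
  have "(\<integral>z. f z \<partial>policy_kernel p\<^sub>Y \<phi> (Q x)) = (\<integral>a. (\<integral>z. f z \<partial>p\<^sub>Y (Q x, a)) \<partial>\<phi> (Q x))"
    by (rule integral_policy_kernel[OF fin_kernel_measurable \<phi>]) (use Q_space[OF x] f in auto)
  also have "\<dots> = (\<integral>a. (\<integral>z. f (Q z) \<partial>p\<^sub>X (x, a)) \<partial>\<phi> (Q x))"
  proof (rule Bochner_Integration.integral_cong[OF refl])
    fix a assume "a \<in> space (\<phi> (Q x))"
    then have "a \<in> space MA" using prob_algebraD(3)[OF policyD[OF \<phi> Q_space[OF x]]] by simp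
    then show "(\<integral>z. f z \<partial>p\<^sub>Y (Q x, a)) = (\<integral>z. f (Q z) \<partial>p\<^sub>X (x, a))"
      by (simp add: integral_fin_kernel[OF Q_space[OF x]] ext_kernel_eq)
  qed
  also have "\<dots> = (\<integral>z. f (Q z) \<partial>policy_kernel p\<^sub>X (\<lambda>x. \<phi> (Q x)) x)"
    by (rule integral_policy_kernel[OF ext_kernel_measurable lift_policy[OF \<phi>] x fQ fQb, symmetric])
  finally show ?thesis .
qed

lemma fin_kernel_pow_lift:
  fixes f :: "'x \<Rightarrow> real"
  assumes \<phi>: "\<phi> \<in> stationary_policies MY MA" and x: "x \<in> space MX"
    and f: "\<And>y. y \<in> Y \<Longrightarrow> \<bar>f y\<bar> \<le> B"
  shows "(\<integral>z. f z \<partial>kernel_pow MY (policy_kernel p\<^sub>Y \<phi>) t (Q x))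
    = (\<integral>z. f (Q z) \<partial>kernel_pow MX (policy_kernel p\<^sub>X (\<lambda>x. \<phi> (Q x))) t x)"
  using f
proof (induction t arbitrary: f)
  case 0
  have "(\<lambda>z. f (Q z)) \<in> borel_measurable MX" by (rule Q_MY_measurable) simp
  then show ?case
    using integral_kernel_pow_0[of "Q x" MY f] integral_kernel_pow_0[OF x, of "\<lambda>z. f (Q z)"] Q_space[OF x]
    by simp
next
  case (Suc t)
  let ?P = "policy_kernel p\<^sub>Y \<phi>" and ?q = "policy_kernel p\<^sub>X (\<lambda>x. \<phi> (Q x))"
  note P = policy_kernel_measurable[OF fin_kernel_measurable \<phi>]
  note q = policy_kernel_measurable[OF ext_kernel_measurable lift_policy[OF \<phi>]]
  have fQ: "(\<lambda>z. f (Q z)) \<in> borel_measurable MX" by (rule Q_MY_measurable) simp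
  have fQb: "\<bar>f (Q z)\<bar> \<le> B" if "z \<in> space MX" for z using Suc.prems[OF Q_space[OF that]] .
  have Pf: "\<bar>\<integral>z. f z \<partial>?P y\<bar> \<le> B" if "y \<in> Y" for y
    by (rule kernel_image_bounded[OF P]) (use Suc.prems that in auto)
  have "(\<integral>z. f z \<partial>kernel_pow MY ?P (Suc t) (Q x)) = (\<integral>y. (\<integral>z. f z \<partial>?P y) \<partial>kernel_pow MY ?P t (Q x))"
    by (rule integral_kernel_pow_Suc[OF P, where B=B]) (use Suc.prems Q_space[OF x] in auto)
  also have "\<dots> = (\<integral>w. (\<integral>z. f z \<partial>?P (Q w)) \<partial>kernel_pow MX ?q t x)"
    by (rule Suc.IH[OF Pf])
  also have "\<dots> = (\<integral>w. (\<integral>z. f (Q z) \<partial>?q w) \<partial>kernel_pow MX ?q t x)"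
    using prob_algebraD(3)[OF kernel_in_prob_algebra[OF kernel_pow_measurable[OF q] x]]
    by (intro Bochner_Integration.integral_cong refl fin_policy_kernel_lift[OF \<phi> _ Suc.prems]) auto
  also have "\<dots> = (\<integral>z. f (Q z) \<partial>kernel_pow MX ?q (Suc t) x)"
    by (rule integral_kernel_pow_Suc[OF q x fQ fQb, symmetric])
  finally show ?case .
qed

end

lemma uniformly_ergodicE:
  assumes "uniformly_ergodic MX MA p R \<kappa>" "\<phi> \<in> stationary_policies MX MA"
  obtains \<mu> where "\<mu> \<in> space (prob_algebra MX)"
    "\<forall>t\<ge>1. \<forall>x\<in>space MX. tv_dist (kernel_pow MX (policy_kernel p \<phi>) t x) \<mu> \<le> R * \<kappa> ^ t"
  using assms unfolding uniformly_ergodic_def by blast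

context finite_approximation
begin

definition kernel_variation_le :: "real \<Rightarrow> bool" where
  "kernel_variation_le \<eta> \<longleftrightarrow> (\<forall>x\<in>space MX. \<forall>z\<in>space MX. Q x = Q z \<longrightarrow>
     (\<forall>a\<in>space MA. \<forall>g\<in>test_functions MX. \<bar>(\<integral>y. g y \<partial>p (x, a)) - (\<integral>y. g y \<partial>p (z, a))\<bar> \<le> \<eta>))"

definition cellwise_cost :: "real \<Rightarrow> real \<Rightarrow> ('x \<times> 'a \<Rightarrow> real) \<Rightarrow> bool" where
  "cellwise_cost C w f \<longleftrightarrow> 0 < C \<and> f \<in> borel_measurable (MX \<Otimes>\<^sub>M MA) \<and>
     (\<forall>z\<in>space (MX \<Otimes>\<^sub>M MA). 0 \<le> f z \<and> f z \<le> C) \<and>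
     (\<forall>x\<in>space MX. \<forall>z\<in>space MX. Q x = Q z \<longrightarrow> (\<forall>a\<in>space MA. \<bar>f (x, a) - f (z, a)\<bar> \<le> w))"

lemma cellwise_costD:
  assumes "cellwise_cost C w f"
  shows "0 < C" "f \<in> borel_measurable (MX \<Otimes>\<^sub>M MA)"
    "z \<in> space (MX \<Otimes>\<^sub>M MA) \<Longrightarrow> 0 \<le> f z \<and> f z \<le> C"
    "z \<in> space (MX \<Otimes>\<^sub>M MA) \<Longrightarrow> \<bar>f z\<bar> \<le> C"
    "x \<in> space MX \<Longrightarrow> x' \<in> space MX \<Longrightarrow> Q x = Q x' \<Longrightarrow> a \<in> space MA \<Longrightarrow> \<bar>f (x, a) - f (x', a)\<bar> \<le> w"
  using assms unfolding cellwise_cost_def by (blast, blast, blast, fastforce, blast)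

text \<open>
  The averaged law on the cell of \<open>x\<close> is a mixture of transition laws from the same cell.
\<close>

lemma cell_kernel_near:
  assumes \<eta>: "kernel_variation_le \<eta>" and x: "x \<in> space MX" and a: "a \<in> space MA"
    and g: "g \<in> test_functions MX"
  shows "\<bar>(\<integral>y. g y \<partial>cell_kernel (Q x, a)) - (\<integral>y. g y \<partial>p (x, a))\<bar> \<le> \<eta>"
proof -
  have gm: "g \<in> borel_measurable MX" and gb: "\<And>x. x \<in> space MX \<Longrightarrow> \<bar>g x\<bar> \<le> 1"
    using g by (auto simp: test_functions_def)
  have pa: "(\<lambda>z. p (z, a)) \<in> MX \<rightarrow>\<^sub>M prob_algebra MX"
    using measurable_compose[OF measurable_Pair2'[OF a] p] .
  have "\<bar>(\<integral>z. (\<integral>y. g y \<partial>p (z, a)) \<partial>cell_measure (Q x)) - (\<integral>y. g y \<partial>p (x, a))\<bar> \<le> \<eta>"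
    by (rule cell_average_near[OF Q_space[OF x] kernel_integral_measurable[OF pa gm] kernel_image_bounded[OF pa gm gb]])
       (use \<eta> x a g in \<open>auto simp: kernel_variation_le_def\<close>)
  then show ?thesis by (simp add: integral_cell_kernel[OF Q_space[OF x] a gm gb])
qed

lemma fin_cost_bounds:
  assumes f: "cellwise_cost C w f" and z: "z \<in> space (MY \<Otimes>\<^sub>M MA)"
  shows "0 \<le> cost\<^sub>Y f z \<and> cost\<^sub>Y f z \<le> C"
proof -
  obtain y a where ya: "z = (y, a)" "y \<in> Y" "a \<in> space MA" using z by (auto simp: space_pair_measure)
  have fa: "(\<lambda>x. f (x, a)) \<in> borel_measurable MX"
    using measurable_compose[OF measurable_Pair2'[OF ya(3)] cellwise_costD(2)[OF f]] .
  have fb: "0 \<le> f (x, a) \<and> f (x, a) \<le> C" if "x \<in> space MX" for x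
    using cellwise_costD(3)[OF f] that ya by (simp add: space_pair_measure)
  show ?thesis
    using integral_between[OF cell_measure_prob[OF ya(2)] fa fb] by (simp add: fin_cost_def ya(1))
qed

lemma fin_cost_abs_le: "cellwise_cost C w f \<Longrightarrow> z \<in> space (MY \<Otimes>\<^sub>M MA) \<Longrightarrow> \<bar>cost\<^sub>Y f z\<bar> \<le> C"
  using fin_cost_bounds[of C w f z] by auto

lemma fin_cost_measurable:
  assumes f: "f \<in> borel_measurable (MX \<Otimes>\<^sub>M MA)"
  shows "cost\<^sub>Y f \<in> borel_measurable (MY \<Otimes>\<^sub>M MA)"
proof (rule measurable_pair_measure_countable1)
  show "countable Y" using finite_Y by (rule countable_finite)
  fix y assume y: "y \<in> Y"
  have "(\<lambda>(a, z). f (z, a)) \<in> borel_measurable (MA \<Otimes>\<^sub>M MX)"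
    using measurable_compose[OF measurable_pair_swap' f] by (simp add: split_beta')
  from kernel_integral_measurable2[OF measurable_const[OF cell_measure_prob[OF y]] this]
  show "(\<lambda>a. cost\<^sub>Y f (y, a)) \<in> borel_measurable MA" by (simp add: fin_cost_def)
qed

lemma fin_cost_near:
  assumes f: "cellwise_cost C w f" and x: "x \<in> space MX" and a: "a \<in> space MA"
  shows "\<bar>cost\<^sub>Y f (Q x, a) - f (x, a)\<bar> \<le> w"
  unfolding fin_cost_def split
proof (rule cell_average_near[OF Q_space[OF x], where B=C])
  show "(\<lambda>x. f (x, a)) \<in> borel_measurable MX"
    using measurable_compose[OF measurable_Pair2'[OF a] cellwise_costD(2)[OF f]] .
qed (use cellwise_costD(4,5)[OF f] x a in \<open>auto simp: space_pair_measure\<close>)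

definition policy_cost :: "('x \<Rightarrow> 'a measure) \<Rightarrow> ('x \<times> 'a \<Rightarrow> real) \<Rightarrow> 'x \<Rightarrow> real" where
  "policy_cost \<phi> f y = (\<integral>a. f (y, a) \<partial>\<phi> y)"

lemma policy_cost_bounds:
  assumes f: "cellwise_cost C w f" and \<phi>: "\<phi> \<in> stationary_policies MY MA" and y: "y \<in> Y"
  shows "0 \<le> policy_cost \<phi> (cost\<^sub>Y f) y \<and> policy_cost \<phi> (cost\<^sub>Y f) y \<le> C"
proof -
  have "(\<lambda>a. cost\<^sub>Y f (y, a)) \<in> borel_measurable MA"
    using measurable_compose[OF measurable_Pair1'[of y MY MA] fin_cost_measurable[OF cellwise_costD(2)[OF f]]] y
    by simp
  from integral_between[OF policyD[OF \<phi> y] this, of 0 C] fin_cost_bounds[OF f] y show ?thesis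
    by (simp add: policy_cost_def space_pair_measure)
qed

text \<open>
  Passing to the finite model: the action law of an almost invariant measure is averaged over
  each cell.  Its state marginal is then almost invariant for the extended kernel, whose
  ergodicity forces it to be close to the invariant law that determines the cost in the finite
  model.
\<close>

theorem approximating_policy_in_finite_model:
  assumes \<gamma>: "\<gamma> \<in> space (prob_algebra MX)"
    and \<eta>: "kernel_variation_le \<eta>"
    and erg: "uniformly_ergodic MX MA p\<^sub>X R \<kappa>" and \<kappa>: "0 < \<kappa>" "\<kappa> < 1"
    and t: "1 \<le> t"
    and m: "almost_invariant MX MA p s m"
  obtains \<phi> where "\<phi> \<in> stationary_policies MY MA"
    "\<forall>C w f. cellwise_cost C w f \<longrightarrow>
      avg_cost MY MA (distr \<gamma> MY Q) p\<^sub>Y (cost\<^sub>Y f) (stationary_policy \<phi>)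
        \<le> ereal ((\<integral>z. f z \<partial>m) + w + C / 2 * (R * \<kappa> ^ t + real t * (\<eta> + s)))"
proof -
  let ?S = "MX \<Otimes>\<^sub>M MA" and ?SY = "MY \<Otimes>\<^sub>M MA"
  have mp: "m \<in> space (prob_algebra ?S)" by (rule almost_invariantD(1)[OF m])
  let ?q = "\<lambda>z. (Q (fst z), snd z)"
  have qm: "?q \<in> ?S \<rightarrow>\<^sub>M ?SY" by (rule lift_pair_measurable)
  obtain \<phi> where dis: "disintegrates MY MA (distr m ?SY ?q) \<phi>"
    using finite_disintegration[OF finite_Y distr_in_prob_algebra[OF mp qm]] ..
  have \<phi>: "\<phi> \<in> stationary_policies MY MA" using dis by (simp add: disintegrates_def)
  have \<phi>': "\<phi> \<in> MY \<rightarrow>\<^sub>M prob_algebra MA" using \<phi> by (simp add: stationary_policies_def)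
  have dis': "(\<integral>z. F (Q (fst z), snd z) \<partial>m) = (\<integral>z. (\<integral>a. F (Q (fst z), a) \<partial>\<phi> (Q (fst z))) \<partial>m)"
    if F: "F \<in> borel_measurable ?SY" "\<And>z. z \<in> space ?SY \<Longrightarrow> \<bar>F z\<bar> \<le> B" for F and B :: real
  proof -
    have G: "(\<lambda>z. \<integral>a. F (fst z, a) \<partial>\<phi> (fst z)) \<in> borel_measurable ?SY"
      by (rule measurable_compose[OF measurable_fst kernel_integral_measurable2[OF \<phi>' F(1)]])
    have "(\<integral>z. F (Q (fst z), snd z) \<partial>m) = (\<integral>z. F z \<partial>distr m ?SY ?q)"
      by (rule integral_distr_prob[OF mp qm F(1), symmetric])
    also have "\<dots> = (\<integral>z. (\<integral>a. F (fst z, a) \<partial>\<phi> (fst z)) \<partial>distr m ?SY ?q)" by (rule disintegrates_integral[OF dis F])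
    also have "\<dots> = (\<integral>z. (\<integral>a. F (Q (fst z), a) \<partial>\<phi> (Q (fst z))) \<partial>m)"
      unfolding integral_distr_prob[OF mp qm G] by simp
    finally show ?thesis .
  qed
  let ?\<phi>X = "\<lambda>x. \<phi> (Q x)"
  let ?P = "policy_kernel p\<^sub>X ?\<phi>X"
  have \<phi>X: "?\<phi>X \<in> stationary_policies MX MA" by (rule lift_policy[OF \<phi>])
  note P = policy_kernel_measurable[OF ext_kernel_measurable \<phi>X]
  obtain \<mu> where \<mu>: "\<mu> \<in> space (prob_algebra MX)"
    and rate': "\<forall>t\<ge>1. \<forall>x\<in>space MX. tv_dist (kernel_pow MX ?P t x) \<mu> \<le> R * \<kappa> ^ t"
    by (rule uniformly_ergodicE[OF erg \<phi>X])
  note rate = rate'[rule_format]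
  define \<sigma> where "\<sigma> = distr m MX fst"
  have \<sigma>: "\<sigma> \<in> space (prob_algebra MX)"
    unfolding \<sigma>_def by (rule distr_in_prob_algebra[OF mp measurable_fst])
  have int_\<sigma>: "(\<integral>x. g x \<partial>\<sigma>) = (\<integral>z. g (fst z) \<partial>m)" if "g \<in> borel_measurable MX" for g :: "'x \<Rightarrow> real"
    unfolding \<sigma>_def by (rule integral_distr_prob[OF mp measurable_fst that])
  have space_m: "fst z \<in> space MX" "snd z \<in> space MA" if "z \<in> space m" for z
  proof -
    have "z \<in> space ?S" using that unfolding prob_algebraD(3)[OF mp] .
    then show "fst z \<in> space MX" "snd z \<in> space MA" by (auto simp: space_pair_measure)
  qed
  have inv: "\<bar>(\<integral>x. (\<integral>y. g y \<partial>?P x) \<partial>\<sigma>) - (\<integral>x. g x \<partial>\<sigma>)\<bar> \<le> \<eta> + s" if g: "g \<in> test_functions MX" for g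
  proof -
    have gm: "g \<in> borel_measurable MX" and gb: "\<And>x. x \<in> space MX \<Longrightarrow> \<bar>g x\<bar> \<le> 1"
      using g by (auto simp: test_functions_def)
    let ?F = "\<lambda>z. \<integral>y. g y \<partial>cell_kernel z"
    have F: "?F \<in> borel_measurable ?SY" by (rule kernel_integral_measurable[OF cell_kernel_measurable gm])
    have Fb: "\<bar>?F z\<bar> \<le> 1" if "z \<in> space ?SY" for z
      by (rule kernel_image_bounded[OF cell_kernel_measurable gm gb that])
    have "(\<integral>x. (\<integral>y. g y \<partial>?P x) \<partial>\<sigma>) = (\<integral>z. (\<integral>y. g y \<partial>?P (fst z)) \<partial>m)"
      by (rule int_\<sigma>[OF kernel_integral_measurable[OF P gm]])
    also have "\<dots> = (\<integral>z. (\<integral>a. ?F (Q (fst z), a) \<partial>\<phi> (Q (fst z))) \<partial>m)"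
    proof (rule Bochner_Integration.integral_cong[OF refl])
      fix z assume "z \<in> space m"
      from integral_policy_kernel[OF ext_kernel_measurable \<phi>X space_m(1)[OF this] gm gb]
      show "(\<integral>y. g y \<partial>?P (fst z)) = (\<integral>a. ?F (Q (fst z), a) \<partial>\<phi> (Q (fst z)))"
        by (simp only: ext_kernel_eq)
    qed
    also have "\<dots> = (\<integral>z. ?F (Q (fst z), snd z) \<partial>m)" by (rule dis'[OF F Fb, symmetric])
    finally have 1: "(\<integral>x. (\<integral>y. g y \<partial>?P x) \<partial>\<sigma>) = (\<integral>z. ?F (Q (fst z), snd z) \<partial>m)" .
    have "\<bar>(\<integral>z. ?F (Q (fst z), snd z) \<partial>m) - (\<integral>z. (\<integral>y. g y \<partial>p z) \<partial>m)\<bar> \<le> \<eta>"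
    proof (rule integral_diff_le[OF mp measurable_compose[OF qm F] _ kernel_integral_measurable[OF p gm] kernel_image_bounded[OF p gm gb]])
      fix z assume z: "z \<in> space ?S"
      show "\<bar>?F (?q z)\<bar> \<le> 1" using Fb measurable_space[OF qm z] .
      show "\<bar>?F (?q z) - (\<integral>y. g y \<partial>p z)\<bar> \<le> \<eta>"
        using cell_kernel_near[OF \<eta> _ _ g, of "fst z" "snd z"] z by (auto simp: space_pair_measure)
    qed
    with 1 almost_invariantD(2)[OF m g] int_\<sigma>[OF gm] show ?thesis by linarith
  qed
  have bound: "avg_cost MY MA (distr \<gamma> MY Q) p\<^sub>Y (cost\<^sub>Y f) (stationary_policy \<phi>)
      \<le> ereal ((\<integral>z. f z \<partial>m) + w + C / 2 * (R * \<kappa> ^ t + real t * (\<eta> + s)))"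
    if f: "cellwise_cost C w f" for C w f
  proof -
    define H where "H = policy_cost \<phi> (cost\<^sub>Y f)"
    have Hb: "0 \<le> H y \<and> H y \<le> C" if "y \<in> Y" for y
      unfolding H_def by (rule policy_cost_bounds[OF f \<phi> that])
    have HQ: "(\<lambda>x. H (Q x)) \<in> borel_measurable MX" by (rule Q_MY_measurable) simp
    have HQb: "0 \<le> H (Q x) \<and> H (Q x) \<le> C" if "x \<in> space MX" for x using Hb[OF Q_space[OF that]] .
    have Habs: "\<bar>H y\<bar> \<le> C" if "y \<in> Y" for y using Hb[OF that] by auto
    have \<gamma>Y: "distr \<gamma> MY Q \<in> space (prob_algebra MY)" by (rule distr_in_prob_algebra[OF \<gamma> Q])
    have "avg_cost MY MA (distr \<gamma> MY Q) p\<^sub>Y (cost\<^sub>Y f) (stationary_policy \<phi>) = ereal (\<integral>x. H (Q x) \<partial>\<mu>)"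
    proof (rule avg_cost_stationary_policy[OF \<gamma>Y fin_kernel_measurable \<phi>
          fin_cost_measurable[OF cellwise_costD(2)[OF f]] fin_cost_abs_le[OF f] \<kappa>])
      fix u :: nat assume u: "1 \<le> u"
      have "(\<integral>y. (\<integral>y. (\<integral>a. cost\<^sub>Y f (y, a) \<partial>\<phi> y) \<partial>kernel_pow MY (policy_kernel p\<^sub>Y \<phi>) u y) \<partial>distr \<gamma> MY Q)
          = (\<integral>x. (\<integral>y. H y \<partial>kernel_pow MY (policy_kernel p\<^sub>Y \<phi>) u (Q x)) \<partial>\<gamma>)"
        unfolding H_def policy_cost_def by (rule integral_distr_prob[OF \<gamma> Q]) simp
      also have "\<dots> = (\<integral>x. (\<integral>z. H (Q z) \<partial>kernel_pow MX ?P u x) \<partial>\<gamma>)"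
      proof (rule Bochner_Integration.integral_cong[OF refl])
        fix x assume "x \<in> space \<gamma>"
        then have "x \<in> space MX" using prob_algebraD(3)[OF \<gamma>] by simp
        then show "(\<integral>y. H y \<partial>kernel_pow MY (policy_kernel p\<^sub>Y \<phi>) u (Q x))
            = (\<integral>z. H (Q z) \<partial>kernel_pow MX ?P u x)"
          by (rule fin_kernel_pow_lift[OF \<phi> _ Habs])
      qed
      finally show "\<bar>(\<integral>y. (\<integral>y. (\<integral>a. cost\<^sub>Y f (y, a) \<partial>\<phi> y) \<partial>kernel_pow MY (policy_kernel p\<^sub>Y \<phi>) u y) \<partial>distr \<gamma> MY Q)
          - (\<integral>x. H (Q x) \<partial>\<mu>)\<bar> \<le> (C / 2 * R) * \<kappa> ^ u"
        using stationary_expectation_rate[OF P \<gamma> \<mu> rate[OF u] HQ HQb cellwise_costD(1)[OF f]]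
        by (simp add: mult.assoc)
    qed
    moreover have "\<bar>(\<integral>x. H (Q x) \<partial>\<sigma>) - (\<integral>x. H (Q x) \<partial>\<mu>)\<bar> \<le> C / 2 * (R * \<kappa> ^ t + real t * (\<eta> + s))"
      by (rule integral_diff_le_half[OF \<sigma> \<mu> _ HQ HQb cellwise_costD(1)[OF f]])
         (rule almost_invariant_close_to_ergodic_limit[OF P \<sigma> \<mu> inv rate[OF t]])
    moreover have "(\<integral>x. H (Q x) \<partial>\<sigma>) = (\<integral>z. H (Q (fst z)) \<partial>m)"
      by (rule int_\<sigma>[OF HQ])
    moreover have "(\<integral>z. H (Q (fst z)) \<partial>m) = (\<integral>z. cost\<^sub>Y f (Q (fst z), snd z) \<partial>m)"
      unfolding H_def policy_cost_def
      by (rule dis'[OF fin_cost_measurable[OF cellwise_costD(2)[OF f]] fin_cost_abs_le[OF f], symmetric])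
    moreover have "\<bar>(\<integral>z. cost\<^sub>Y f (Q (fst z), snd z) \<partial>m) - (\<integral>z. f z \<partial>m)\<bar> \<le> w"
    proof (rule integral_diff_le[OF mp measurable_compose[OF qm fin_cost_measurable[OF cellwise_costD(2)[OF f]]] _
          cellwise_costD(2,4)[OF f]])
      fix z assume z: "z \<in> space ?S"
      show "\<bar>cost\<^sub>Y f (?q z)\<bar> \<le> C" using fin_cost_abs_le[OF f measurable_space[OF qm z]] .
      show "\<bar>cost\<^sub>Y f (?q z) - f z\<bar> \<le> w"
        using fin_cost_near[OF f, of "fst z" "snd z"] z by (auto simp: space_pair_measure)
    qed
    ultimately show ?thesis by (simp only: ereal_less_eq(3))
  qed
  show thesis by (rule that[OF \<phi>]) (use bound in blast)
qed

text \<open>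
  Returning to the original model: the stationary policy of an almost invariant measure \<open>m\<close> of
  the finite model is constant on cells, and the law \<open>\<sigma>\<close> of the next state, drawn from
  \<open>cell_kernel\<close> under \<open>m\<close>, is almost invariant on the original state space.
\<close>

theorem approximating_policy_in_original_model:
  assumes \<gamma>: "\<gamma> \<in> space (prob_algebra MX)"
    and \<eta>: "kernel_variation_le \<eta>"
    and erg: "uniformly_ergodic MX MA p R \<kappa>" and \<kappa>: "0 < \<kappa>" "\<kappa> < 1"
    and t: "1 \<le> t"
    and m: "almost_invariant MY MA p\<^sub>Y s m"
  obtains \<phi> where "\<phi> \<in> stationary_policies MX MA"
    "\<forall>C w f. cellwise_cost C w f \<longrightarrow>
      avg_cost MX MA \<gamma> p f (stationary_policy \<phi>)
        \<le> ereal ((\<integral>z. cost\<^sub>Y f z \<partial>m) + C * s + w + C / 2 * (R * \<kappa> ^ t + real t * (\<eta> + s)))"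
proof -
  let ?S = "MX \<Otimes>\<^sub>M MA" and ?SY = "MY \<Otimes>\<^sub>M MA"
  have mp: "m \<in> space (prob_algebra ?SY)" by (rule almost_invariantD(1)[OF m])
  obtain \<phi> where dis: "disintegrates MY MA m \<phi>"
    using finite_disintegration[OF finite_Y mp] ..
  have \<phi>: "\<phi> \<in> stationary_policies MY MA" using dis by (simp add: disintegrates_def)
  let ?\<phi>X = "\<lambda>x. \<phi> (Q x)"
  let ?P = "policy_kernel p ?\<phi>X"
  have \<phi>X: "?\<phi>X \<in> stationary_policies MX MA" by (rule lift_policy[OF \<phi>])
  have \<phi>X': "?\<phi>X \<in> MX \<rightarrow>\<^sub>M prob_algebra MA" using \<phi>X by (simp add: stationary_policies_def)
  note P = policy_kernel_measurable[OF p \<phi>X]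
  obtain \<mu> where \<mu>: "\<mu> \<in> space (prob_algebra MX)"
    and rate': "\<forall>t\<ge>1. \<forall>x\<in>space MX. tv_dist (kernel_pow MX ?P t x) \<mu> \<le> R * \<kappa> ^ t"
    by (rule uniformly_ergodicE[OF erg \<phi>X])
  note rate = rate'[rule_format]
  define \<sigma> where "\<sigma> = m \<bind> cell_kernel"
  have \<sigma>: "\<sigma> \<in> space (prob_algebra MX)"
    unfolding \<sigma>_def by (rule bind_in_prob_algebra[OF mp cell_kernel_measurable])
  have int_\<sigma>: "(\<integral>x. g x \<partial>\<sigma>) = (\<integral>z. (\<integral>x. g x \<partial>cell_kernel z) \<partial>m)"
    if "g \<in> borel_measurable MX" "\<And>x. x \<in> space MX \<Longrightarrow> \<bar>g x\<bar> \<le> B" for g and B :: real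
    unfolding \<sigma>_def by (rule integral_bind_kernel[OF mp cell_kernel_measurable that])
  have marginal: "\<bar>(\<integral>x. h (Q x) \<partial>\<sigma>) - (\<integral>z. h (fst z) \<partial>m)\<bar> \<le> B * s"
    if B: "0 < B" and h: "\<And>y. y \<in> Y \<Longrightarrow> \<bar>h y\<bar> \<le> B" for h and B :: real
  proof -
    have hQ: "(\<lambda>x. h (Q x)) \<in> borel_measurable MX" by (rule Q_MY_measurable) simp
    have "(\<integral>x. h (Q x) \<partial>\<sigma>) = (\<integral>z. (\<integral>x. h (Q x) \<partial>cell_kernel z) \<partial>m)"
      by (rule int_\<sigma>[OF hQ]) (use h Q_space in auto)
    also have "\<dots> = (\<integral>z. (\<integral>y. h y \<partial>p\<^sub>Y z) \<partial>m)"
    proof (rule Bochner_Integration.integral_cong[OF refl])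
      fix z assume "z \<in> space m"
      then have "z \<in> space ?SY" unfolding prob_algebraD(3)[OF mp] .
      then have "fst z \<in> Y" "snd z \<in> space MA" by (auto simp: space_pair_measure)
      from integral_fin_kernel[OF this, of h]
      show "(\<integral>x. h (Q x) \<partial>cell_kernel z) = (\<integral>y. h y \<partial>p\<^sub>Y z)" by simp
    qed
    finally have 1: "(\<integral>x. h (Q x) \<partial>\<sigma>) = (\<integral>z. (\<integral>y. h y \<partial>p\<^sub>Y z) \<partial>m)" .
    have "(\<lambda>y. h y / B) \<in> test_functions MY" using B h by (simp add: test_functions_def)
    from almost_invariantD(2)[OF m this]
    have "\<bar>(\<integral>z. h (fst z) \<partial>m) - (\<integral>z. (\<integral>y. h y \<partial>p\<^sub>Y z) \<partial>m)\<bar> / B \<le> s"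
      using B by (simp add: diff_divide_distrib[symmetric])
    with 1 B show ?thesis by (simp add: divide_le_eq abs_minus_commute mult.commute)
  qed
  have inv: "\<bar>(\<integral>x. (\<integral>y. g y \<partial>?P x) \<partial>\<sigma>) - (\<integral>x. g x \<partial>\<sigma>)\<bar> \<le> \<eta> + s" if g: "g \<in> test_functions MX" for g
  proof -
    have gm: "g \<in> borel_measurable MX" and gb: "\<And>x. x \<in> space MX \<Longrightarrow> \<bar>g x\<bar> \<le> 1"
      using g by (auto simp: test_functions_def)
    let ?F = "\<lambda>z. \<integral>y. g y \<partial>cell_kernel z"
    have F: "?F \<in> borel_measurable ?SY" by (rule kernel_integral_measurable[OF cell_kernel_measurable gm])
    have Fb: "\<bar>?F z\<bar> \<le> 1" if "z \<in> space ?SY" for z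
      by (rule kernel_image_bounded[OF cell_kernel_measurable gm gb that])
    define h where "h y = (\<integral>a. ?F (y, a) \<partial>\<phi> y)" for y
    have Fy: "(\<lambda>a. ?F (y, a)) \<in> borel_measurable MA" if "y \<in> Y" for y
      using measurable_compose[OF measurable_Pair1'[of y MY MA] F] that by simp
    have hb: "\<bar>h y\<bar> \<le> 1" if y: "y \<in> Y" for y
      unfolding h_def by (rule abs_integral_le[OF policyD[OF \<phi> y] Fy[OF y] Fb])
        (use y in \<open>simp add: space_pair_measure\<close>)
    have hQ: "(\<lambda>x. h (Q x)) \<in> borel_measurable MX" by (rule Q_MY_measurable) simp
    have "\<bar>(\<integral>x. (\<integral>y. g y \<partial>?P x) \<partial>\<sigma>) - (\<integral>x. h (Q x) \<partial>\<sigma>)\<bar> \<le> \<eta>"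
    proof (rule integral_diff_le[OF \<sigma> kernel_integral_measurable[OF P gm] kernel_image_bounded[OF P gm gb] hQ])
      fix x assume x: "x \<in> space MX"
      show "\<bar>h (Q x)\<bar> \<le> 1" by (rule hb[OF Q_space[OF x]])
      have px: "(\<lambda>a. p (x, a)) \<in> MA \<rightarrow>\<^sub>M prob_algebra MX"
        using measurable_compose[OF measurable_Pair1'[OF x] p] .
      have "\<bar>(\<integral>a. (\<integral>y. g y \<partial>p (x, a)) \<partial>\<phi> (Q x)) - h (Q x)\<bar> \<le> \<eta>"
        unfolding h_def
      proof (rule integral_diff_le[OF policyD[OF \<phi> Q_space[OF x]]
            kernel_integral_measurable[OF px gm] kernel_image_bounded[OF px gm gb] Fy[OF Q_space[OF x]]])
        fix a assume a: "a \<in> space MA"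
        show "\<bar>?F (Q x, a)\<bar> \<le> 1" using Fb[of "(Q x, a)"] Q_space[OF x] a by (simp add: space_pair_measure)
        show "\<bar>(\<integral>y. g y \<partial>p (x, a)) - ?F (Q x, a)\<bar> \<le> \<eta>"
          using cell_kernel_near[OF \<eta> x a g] by (simp add: abs_minus_commute)
      qed auto
      then show "\<bar>(\<integral>y. g y \<partial>?P x) - h (Q x)\<bar> \<le> \<eta>"
        by (simp add: integral_policy_kernel[OF p \<phi>X x gm gb])
    qed auto
    moreover have "(\<integral>x. g x \<partial>\<sigma>) = (\<integral>z. h (fst z) \<partial>m)"
      using int_\<sigma>[OF gm gb] disintegrates_integral[OF dis F Fb] by (simp add: h_def)
    moreover have "\<bar>(\<integral>x. h (Q x) \<partial>\<sigma>) - (\<integral>z. h (fst z) \<partial>m)\<bar> \<le> 1 * s"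
      by (rule marginal[OF _ hb]) auto
    ultimately show ?thesis by linarith
  qed
  have bound: "avg_cost MX MA \<gamma> p f (stationary_policy ?\<phi>X)
      \<le> ereal ((\<integral>z. cost\<^sub>Y f z \<partial>m) + C * s + w + C / 2 * (R * \<kappa> ^ t + real t * (\<eta> + s)))"
    if f: "cellwise_cost C w f" for C w f
  proof -
    define F where "F x = (\<integral>a. f (x, a) \<partial>\<phi> (Q x))" for x
    define H where "H = policy_cost \<phi> (cost\<^sub>Y f)"
    note fm = cellwise_costD(2)[OF f]
    have Hb: "0 \<le> H y \<and> H y \<le> C" if "y \<in> Y" for y
      unfolding H_def by (rule policy_cost_bounds[OF f \<phi> that])
    have HQ: "(\<lambda>x. H (Q x)) \<in> borel_measurable MX" by (rule Q_MY_measurable) simp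
    have Habs: "\<bar>H y\<bar> \<le> C" if "y \<in> Y" for y using Hb[OF that] by auto
    have Fm: "F \<in> borel_measurable MX"
      unfolding F_def by (rule kernel_integral_measurable2[OF \<phi>X' fm])
    have fx: "(\<lambda>a. f (x, a)) \<in> borel_measurable MA" if "x \<in> space MX" for x
      using measurable_compose[OF measurable_Pair1'[OF that] fm] .
    have Fb: "0 \<le> F x \<and> F x \<le> C" if x: "x \<in> space MX" for x
      using integral_between[OF policyD[OF \<phi> Q_space[OF x]] fx[OF x], of 0 C] cellwise_costD(3)[OF f] x
      by (simp add: F_def space_pair_measure)
    have Fabs: "\<bar>F x\<bar> \<le> C" if "x \<in> space MX" for x using Fb[OF that] by auto
    have FH: "\<bar>F x - H (Q x)\<bar> \<le> w" if x: "x \<in> space MX" for x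
      unfolding F_def H_def policy_cost_def
    proof (rule integral_diff_le[OF policyD[OF \<phi> Q_space[OF x]] fx[OF x]])
      show "(\<lambda>a. cost\<^sub>Y f (Q x, a)) \<in> borel_measurable MA"
        using measurable_compose[OF measurable_Pair1'[of "Q x" MY MA] fin_cost_measurable[OF fm]] Q_space[OF x]
        by simp
      fix a assume a: "a \<in> space MA"
      show "\<bar>f (x, a)\<bar> \<le> C" using cellwise_costD(4)[OF f] x a by (simp add: space_pair_measure)
      show "\<bar>cost\<^sub>Y f (Q x, a)\<bar> \<le> C"
        using fin_cost_abs_le[OF f] Q_space[OF x] a by (simp add: space_pair_measure)
      show "\<bar>f (x, a) - cost\<^sub>Y f (Q x, a)\<bar> \<le> w"
        using fin_cost_near[OF f x a] by (simp add: abs_minus_commute)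
    qed
    have "avg_cost MX MA \<gamma> p f (stationary_policy ?\<phi>X) = ereal (\<integral>x. F x \<partial>\<mu>)"
    proof (rule avg_cost_stationary_policy[OF \<gamma> p \<phi>X fm cellwise_costD(4)[OF f] \<kappa>])
      fix u :: nat assume u: "1 \<le> u"
      show "\<bar>(\<integral>x. (\<integral>y. (\<integral>a. f (y, a) \<partial>\<phi> (Q y)) \<partial>kernel_pow MX ?P u x) \<partial>\<gamma>) - (\<integral>x. F x \<partial>\<mu>)\<bar>
          \<le> (C / 2 * R) * \<kappa> ^ u"
        using stationary_expectation_rate[OF P \<gamma> \<mu> rate[OF u] Fm Fb cellwise_costD(1)[OF f]]
        by (simp add: mult.assoc F_def)
    qed
    moreover have "\<bar>(\<integral>x. F x \<partial>\<sigma>) - (\<integral>x. F x \<partial>\<mu>)\<bar> \<le> C / 2 * (R * \<kappa> ^ t + real t * (\<eta> + s))"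
      by (rule integral_diff_le_half[OF \<sigma> \<mu> _ Fm Fb cellwise_costD(1)[OF f]])
         (rule almost_invariant_close_to_ergodic_limit[OF P \<sigma> \<mu> inv rate[OF t]])
    moreover have "\<bar>(\<integral>x. F x \<partial>\<sigma>) - (\<integral>x. H (Q x) \<partial>\<sigma>)\<bar> \<le> w"
      by (rule integral_diff_le[OF \<sigma> Fm Fabs HQ _ FH]) (use Habs Q_space in auto)
    moreover have "\<bar>(\<integral>x. H (Q x) \<partial>\<sigma>) - (\<integral>z. H (fst z) \<partial>m)\<bar> \<le> C * s"
      by (rule marginal[OF cellwise_costD(1)[OF f] Habs])
    moreover have "(\<integral>z. H (fst z) \<partial>m) = (\<integral>z. cost\<^sub>Y f z \<partial>m)"
      using disintegrates_integral[OF dis fin_cost_measurable[OF fm] fin_cost_abs_le[OF f]] by (simp add: H_def policy_cost_def)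
    ultimately show ?thesis by (simp only: ereal_less_eq(3))
  qed
  show thesis by (rule that[OF \<phi>X]) (use bound in blast)
qed

end

section \<open>Comparison of the optimal values\<close>

text \<open>
  Mixing occupation measures replaces mixing policies: a small weight \<open>\<theta>\<close> on a strictly feasible
  policy gains the slack \<open>\<theta> * b\<close> in every constraint and costs at most \<open>\<theta> * C\<close>.
\<close>

lemma slater_mixture:
  fixes c :: "'x \<times> 'a \<Rightarrow> real"
  assumes \<gamma>: "\<gamma> \<in> space (prob_algebra MX)" and p: "p \<in> MX \<Otimes>\<^sub>M MA \<rightarrow>\<^sub>M prob_algebra MX"
    and c: "c \<in> borel_measurable (MX \<Otimes>\<^sub>M MA)" "\<And>z. z \<in> space (MX \<Otimes>\<^sub>M MA) \<Longrightarrow> 0 \<le> c z \<and> c z \<le> C"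
    and d: "\<And>l. l \<in> {1..q} \<Longrightarrow> d l \<in> borel_measurable (MX \<Otimes>\<^sub>M MA)"
      "\<And>l z. l \<in> {1..q} \<Longrightarrow> z \<in> space (MX \<Otimes>\<^sub>M MA) \<Longrightarrow> \<bar>d l z\<bar> \<le> D l"
    and \<pi>: "\<pi> \<in> feasible_policies MX MA \<gamma> p q d k" "avg_cost MX MA \<gamma> p c \<pi> \<le> ereal v" "0 \<le> v"
    and \<pi>0: "\<pi>0 \<in> policies MX MA" "\<And>l. l \<in> {1..q} \<Longrightarrow> avg_cost MX MA \<gamma> p (d l) \<pi>0 \<le> ereal (k l - b)"
    and s: "0 < s" and \<theta>: "0 \<le> \<theta>" "\<theta> \<le> 1"
  obtains m where "almost_invariant MX MA p s m"
    "\<forall>l\<in>{1..q}. (\<integral>z. d l z \<partial>m) \<le> k l - \<theta> * b + s" "(\<integral>z. c z \<partial>m) \<le> v + \<theta> * C + s"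
proof -
  \<comment> \<open>Index \<open>0\<close> stands for the cost to be minimised, the others for the constraints.\<close>
  define f where "f l = (if l = 0 then c else d l)" for l :: nat
  define Df where "Df l = (if l = 0 then C else D l)" for l :: nat
  have cb: "\<bar>c z\<bar> \<le> C" if "z \<in> space (MX \<Otimes>\<^sub>M MA)" for z using c(2)[OF that] by auto
  have f: "f l \<in> borel_measurable (MX \<Otimes>\<^sub>M MA)" if "l \<in> {0..q}" for l
    using c(1) d(1)[of l] that by (auto simp: f_def)
  have fb: "\<bar>f l z\<bar> \<le> Df l" if "l \<in> {0..q}" "z \<in> space (MX \<Otimes>\<^sub>M MA)" for l z
    using cb d(2)[of l z] that by (auto simp: f_def Df_def)
  have \<pi>p: "\<pi> \<in> policies MX MA" "\<And>l. l \<in> {1..q} \<Longrightarrow> avg_cost MX MA \<gamma> p (d l) \<pi> \<le> ereal (k l)"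
    using \<pi>(1) by (auto simp: feasible_policies_def)
  have v1: "avg_cost MX MA \<gamma> p (f l) \<pi> \<le> ereal (if l = 0 then v else k l)" if "l \<in> {0..q}" for l
    using \<pi>(2) \<pi>p(2)[of l] that by (auto simp: f_def)
  have v0: "avg_cost MX MA \<gamma> p (f l) \<pi>0 \<le> ereal (if l = 0 then C else k l - b)" if "l \<in> {0..q}" for l
    using avg_cost_bounds(2)[OF \<gamma> p \<pi>0(1) c] \<pi>0(2)[of l] that by (auto simp: f_def)
  obtain m1 where m1: "almost_invariant MX MA p s m1"
    and i1: "\<forall>l\<in>{0..q}. (\<integral>z. f l z \<partial>m1) \<le> (if l = 0 then v else k l) + s"
    by (rule policy_to_almost_invariant[OF \<gamma> p \<pi>p(1) finite_atLeastAtMost s f fb v1])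
  obtain m0 where m0: "almost_invariant MX MA p s m0"
    and i0: "\<forall>l\<in>{0..q}. (\<integral>z. f l z \<partial>m0) \<le> (if l = 0 then C else k l - b) + s"
    by (rule policy_to_almost_invariant[OF \<gamma> p \<pi>0(1) finite_atLeastAtMost s f fb v0])
  define m where "m = mixture \<theta> m0 m1"
  have m: "almost_invariant MX MA p s m"
    unfolding m_def by (rule almost_invariant_mixture[OF p m0 m1 \<theta>])
  have bound: "(\<integral>z. f l z \<partial>m) \<le> \<theta> * (if l = 0 then C else k l - b) + (1 - \<theta>) * (if l = 0 then v else k l) + s"
    if l: "l \<in> {0..q}" for l
  proof -
    have "(\<integral>z. f l z \<partial>m) = \<theta> * (\<integral>z. f l z \<partial>m0) + (1 - \<theta>) * (\<integral>z. f l z \<partial>m1)"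
      unfolding m_def
      by (rule integral_mixture[OF almost_invariantD(1)[OF m0] almost_invariantD(1)[OF m1] \<theta> f[OF l] fb[OF l]])
    also have "\<dots> \<le> \<theta> * ((if l = 0 then C else k l - b) + s) + (1 - \<theta>) * ((if l = 0 then v else k l) + s)"
      using \<theta> i0[rule_format, OF l] i1[rule_format, OF l] by (intro add_mono mult_left_mono) auto
    also have "\<dots> = \<theta> * (if l = 0 then C else k l - b) + (1 - \<theta>) * (if l = 0 then v else k l) + s"
      by (simp add: algebra_simps)
    finally show ?thesis .
  qed
  show thesis
  proof (rule that[OF m])
    show "\<forall>l\<in>{1..q}. (\<integral>z. d l z \<partial>m) \<le> k l - \<theta> * b + s"
    proof
      fix l assume "l \<in> {1..q}"
      then show "(\<integral>z. d l z \<partial>m) \<le> k l - \<theta> * b + s"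
        using bound[of l] by (simp add: f_def algebra_simps)
    qed
    have "(1 - \<theta>) * v \<le> v" using \<theta> \<pi>(3) by (simp add: mult_left_le_one_le)
    then show "(\<integral>z. c z \<partial>m) \<le> v + \<theta> * C + s"
      using bound[of 0] by (simp add: f_def)
  qed
qed

lemma opt_value_finite:
  assumes \<gamma>: "\<gamma> \<in> space (prob_algebra MX)" and p: "p \<in> MX \<Otimes>\<^sub>M MA \<rightarrow>\<^sub>M prob_algebra MX"
    and c: "c \<in> borel_measurable (MX \<Otimes>\<^sub>M MA)" "\<And>z. z \<in> space (MX \<Otimes>\<^sub>M MA) \<Longrightarrow> 0 \<le> c z \<and> c z \<le> C"
    and ne: "feasible_policies MX MA \<gamma> p q d k \<noteq> {}"
  obtains v where "opt_value MX MA \<gamma> p c q d k = ereal v"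
proof -
  obtain \<pi> where \<pi>: "\<pi> \<in> feasible_policies MX MA \<gamma> p q d k" using ne by blast
  then have "opt_value MX MA \<gamma> p c q d k \<le> avg_cost MX MA \<gamma> p c \<pi>"
    unfolding opt_value_def by (rule INF_lower)
  also have "\<dots> \<le> ereal C"
    by (rule avg_cost_bounds(2)[OF \<gamma> p _ c]) (use \<pi> in \<open>simp add: feasible_policies_def\<close>)
  finally have "opt_value MX MA \<gamma> p c q d k \<le> ereal C" .
  moreover have "0 \<le> opt_value MX MA \<gamma> p c q d k"
    unfolding opt_value_def
    by (rule INF_greatest, rule avg_cost_bounds(1)[OF \<gamma> p _ c]) (simp add: feasible_policies_def)
  ultimately show thesis using that by (cases "opt_value MX MA \<gamma> p c q d k") auto
qed

lemma opt_value_le_real: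
  assumes \<gamma>: "\<gamma> \<in> space (prob_algebra MX)" and p: "p \<in> MX \<Otimes>\<^sub>M MA \<rightarrow>\<^sub>M prob_algebra MX"
    and c: "c \<in> borel_measurable (MX \<Otimes>\<^sub>M MA)" "\<And>z. z \<in> space (MX \<Otimes>\<^sub>M MA) \<Longrightarrow> 0 \<le> c z \<and> c z \<le> C"
    and le: "\<And>\<pi> v. \<pi> \<in> feasible_policies MX MA \<gamma> p q d k \<Longrightarrow> avg_cost MX MA \<gamma> p c \<pi> = ereal v \<Longrightarrow> 0 \<le> v \<Longrightarrow> x \<le> v"
  shows "ereal x \<le> opt_value MX MA \<gamma> p c q d k"
  unfolding opt_value_def
proof (rule INF_greatest)
  fix \<pi> assume \<pi>: "\<pi> \<in> feasible_policies MX MA \<gamma> p q d k"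
  then have "\<pi> \<in> policies MX MA" by (simp add: feasible_policies_def)
  from avg_cost_bounds[OF \<gamma> p this c]
  obtain v where "avg_cost MX MA \<gamma> p c \<pi> = ereal v" "0 \<le> v"
    by (cases "avg_cost MX MA \<gamma> p c \<pi>") auto
  with le[OF \<pi>] show "ereal x \<le> avg_cost MX MA \<gamma> p c \<pi>" by simp
qed

context finite_approximation
begin

text \<open>
  The factor \<open>2\<close> in front of \<open>C / a\<close> stems from the passage to the original model, which starts
  from the finite model, where the strictly feasible policy has only the slack \<open>a - \<epsilon>d\<close>, which is
  greater than \<open>a / 2\<close>.
\<close>

theorem optimal_values_close:
  fixes c :: "'x \<times> 'a \<Rightarrow> real" and q :: nat and k :: "nat \<Rightarrow> real"
  assumes \<gamma>: "\<gamma> \<in> space (prob_algebra MX)"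
    and \<eta>: "kernel_variation_le \<eta>" "0 \<le> \<eta>"
    and erg: "uniformly_ergodic MX MA p R \<kappa>" "uniformly_ergodic MX MA p\<^sub>X R \<kappa>"
    and \<kappa>: "0 < \<kappa>" "\<kappa> < 1"
    and t: "1 \<le> t"
    and c: "cellwise_cost C w c"
    and d: "\<And>l. l \<in> {1..q} \<Longrightarrow> cellwise_cost (D l) (wd l) (d l)"
    and \<epsilon>c: "w + C / 2 * (R * \<kappa> ^ t + real t * \<eta>) \<le> \<epsilon>c"
    and \<epsilon>d: "\<And>l. l \<in> {1..q} \<Longrightarrow> wd l + D l / 2 * (R * \<kappa> ^ t + real t * \<eta>) \<le> \<epsilon>d"
    and \<epsilon>d0: "0 \<le> \<epsilon>d" and small: "\<epsilon>d < a / 2"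
    and \<pi>0: "\<pi>0 \<in> policies MX MA" "\<And>l. l \<in> {1..q} \<Longrightarrow> avg_cost MX MA \<gamma> p (d l) \<pi>0 \<le> ereal (k l - a)"
  shows "\<bar>opt_value MY MA (distr \<gamma> MY Q) p\<^sub>Y (cost\<^sub>Y c) q (\<lambda>l. cost\<^sub>Y (d l)) k
      - opt_value MX MA \<gamma> p c q d k\<bar> \<le> ereal (\<epsilon>c + 2 * C / a * \<epsilon>d)"
proof -
  let ?\<gamma>Y = "distr \<gamma> MY Q" and ?cY = "cost\<^sub>Y c" and ?dY = "\<lambda>l. cost\<^sub>Y (d l)"
  let ?V = "opt_value MX MA \<gamma> p c q d k" and ?VY = "opt_value MY MA ?\<gamma>Y p\<^sub>Y ?cY q ?dY k"
  let ?F = "feasible_policies MX MA \<gamma> p q d k" and ?FY = "feasible_policies MY MA ?\<gamma>Y p\<^sub>Y q ?dY k"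
  have a: "0 < a" using \<epsilon>d0 small by simp
  have C: "0 < C" by (rule cellwise_costD(1)[OF c])
  have Dl: "0 < D l" if "l \<in> {1..q}" for l by (rule cellwise_costD(1)[OF d[OF that]])
  have \<gamma>Y: "?\<gamma>Y \<in> space (prob_algebra MY)" by (rule distr_in_prob_algebra[OF \<gamma> Q])
  \<comment> \<open>\<open>B * s\<close> collects all terms that vanish with the defect \<open>s\<close> of invariance.\<close>
  define B where "B = 1 + (C + (\<Sum>l=1..q. D l)) * (1 + real t)"
  have sumD: "0 \<le> (\<Sum>l=1..q. D l)" by (rule sum_nonneg) (use Dl in force)
  have B0: "0 < B"
    unfolding B_def using C sumD by (intro add_pos_nonneg) auto
  have BX: "s + X * s + X / 2 * (real t * s) \<le> B * s" "s + X / 2 * (real t * s) \<le> B * s"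
    if "0 \<le> X" "X \<le> C + (\<Sum>l=1..q. D l)" "0 < s" for X s
  proof -
    have "X * (1 + real t) \<le> (C + (\<Sum>l=1..q. D l)) * (1 + real t)"
      using that by (intro mult_right_mono) auto
    then have "(1 + X * (1 + real t)) * s \<le> B * s" using that by (intro mult_right_mono) (auto simp: B_def)
    moreover have "0 \<le> X * s" "0 \<le> X * (real t * s)" using that by auto
    ultimately show "s + X * s + X / 2 * (real t * s) \<le> B * s" "s + X / 2 * (real t * s) \<le> B * s"
      by (auto simp: algebra_simps)
  qed
  have CB: "C \<le> C + (\<Sum>l=1..q. D l)" using sumD by simp
  have DB: "D l \<le> C + (\<Sum>l=1..q. D l)" if "l \<in> {1..q}" for l
  proof -
    have "D l \<le> (\<Sum>l=1..q. D l)" by (rule member_le_sum[OF that]) (use Dl in force, simp)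
    with C show ?thesis by simp
  qed
  note cm = cellwise_costD(2)[OF c] and cb = cellwise_costD(3)[OF c]
  note cYm = fin_cost_measurable[OF cm] and cYb = fin_cost_bounds[OF c]
  have to_Y: "\<exists>\<psi>\<in>?FY. avg_cost MY MA ?\<gamma>Y p\<^sub>Y ?cY \<psi> \<le> ereal (v + \<epsilon>c + \<theta> * C + B * s)"
    if \<pi>: "\<pi> \<in> ?F" "avg_cost MX MA \<gamma> p c \<pi> \<le> ereal v" "0 \<le> v"
      and s: "0 < s" and \<theta>: "0 \<le> \<theta>" "\<theta> \<le> 1" "\<epsilon>d + B * s \<le> \<theta> * a" for \<pi> v s \<theta>
  proof -
    obtain m where m: "almost_invariant MX MA p s m"
      and md: "\<forall>l\<in>{1..q}. (\<integral>z. d l z \<partial>m) \<le> k l - \<theta> * a + s" and mc: "(\<integral>z. c z \<partial>m) \<le> v + \<theta> * C + s"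
      by (rule slater_mixture[OF \<gamma> p cm cb cellwise_costD(2)[OF d] cellwise_costD(4)[OF d] \<pi> \<pi>0 s \<theta>(1,2)])
    obtain \<phi> where \<phi>: "\<phi> \<in> stationary_policies MY MA"
      and V': "\<forall>C w f. cellwise_cost C w f \<longrightarrow>
        avg_cost MY MA ?\<gamma>Y p\<^sub>Y (cost\<^sub>Y f) (stationary_policy \<phi>)
          \<le> ereal ((\<integral>z. f z \<partial>m) + w + C / 2 * (R * \<kappa> ^ t + real t * (\<eta> + s)))"
      by (rule approximating_policy_in_finite_model[OF \<gamma> \<eta>(1) erg(2) \<kappa> t m])
    note V = V'[rule_format]
    have "avg_cost MY MA ?\<gamma>Y p\<^sub>Y (?dY l) (stationary_policy \<phi>) \<le> ereal (k l)" if l: "l \<in> {1..q}" for l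
    proof (rule order_trans[OF V[OF d[OF l]]])
      have "(\<integral>z. d l z \<partial>m) + wd l + D l / 2 * (R * \<kappa> ^ t + real t * (\<eta> + s))
          = (\<integral>z. d l z \<partial>m) + (wd l + D l / 2 * (R * \<kappa> ^ t + real t * \<eta>)) + D l / 2 * (real t * s)"
        by (simp add: algebra_simps)
      then show "ereal ((\<integral>z. d l z \<partial>m) + wd l + D l / 2 * (R * \<kappa> ^ t + real t * (\<eta> + s))) \<le> ereal (k l)"
        using md[rule_format, OF l] \<epsilon>d[OF l] BX(2)[OF less_imp_le[OF Dl[OF l]] DB[OF l] s] \<theta>(3) unfolding ereal_less_eq(3) by linarith
    qed
    with stationary_policy_in_policies[OF \<phi>] have "stationary_policy \<phi> \<in> ?FY"
      by (simp add: feasible_policies_def)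
    moreover have "avg_cost MY MA ?\<gamma>Y p\<^sub>Y ?cY (stationary_policy \<phi>) \<le> ereal (v + \<epsilon>c + \<theta> * C + B * s)"
    proof (rule order_trans[OF V[OF c]])
      have "(\<integral>z. c z \<partial>m) + w + C / 2 * (R * \<kappa> ^ t + real t * (\<eta> + s))
          = (\<integral>z. c z \<partial>m) + (w + C / 2 * (R * \<kappa> ^ t + real t * \<eta>)) + C / 2 * (real t * s)"
        by (simp add: algebra_simps)
      then show "ereal ((\<integral>z. c z \<partial>m) + w + C / 2 * (R * \<kappa> ^ t + real t * (\<eta> + s))) \<le> ereal (v + \<epsilon>c + \<theta> * C + B * s)"
        using mc \<epsilon>c BX(2)[OF less_imp_le[OF C] CB s] unfolding ereal_less_eq(3) by linarith
    qed
    ultimately show ?thesis by blast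
  qed
  have to_X: "\<exists>\<psi>\<in>?F. avg_cost MX MA \<gamma> p c \<psi> \<le> ereal (v + \<epsilon>c + \<theta> * C + B * s)"
    if \<pi>: "\<pi> \<in> ?FY" "avg_cost MY MA ?\<gamma>Y p\<^sub>Y ?cY \<pi> \<le> ereal v" "0 \<le> v"
      and s: "0 < s" and \<theta>: "0 \<le> \<theta>" "\<theta> \<le> 1" "\<epsilon>d + B * s \<le> \<theta> * (a - \<epsilon>d - B * s)" for \<pi> v s \<theta>
  proof -
    \<comment> \<open>The strictly feasible policy passes to the finite model first, where it keeps the slack
      \<open>a - \<epsilon>d\<close> up to a term of order \<open>s\<close>.\<close>
    have d0: "avg_cost MX MA \<gamma> p (d l) \<pi>0 \<le> ereal (k l - a)" if "l \<in> {1..q}" for l by (rule \<pi>0(2)[OF that])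
    obtain m0 where m0: "almost_invariant MX MA p s m0"
      and i0: "\<forall>l\<in>{1..q}. (\<integral>z. d l z \<partial>m0) \<le> k l - a + s"
      by (rule policy_to_almost_invariant[OF \<gamma> p \<pi>0(1) finite_atLeastAtMost s cellwise_costD(2)[OF d] cellwise_costD(4)[OF d] d0])
    obtain \<phi>0 where \<phi>0: "\<phi>0 \<in> stationary_policies MY MA"
      and V0': "\<forall>C w f. cellwise_cost C w f \<longrightarrow>
        avg_cost MY MA ?\<gamma>Y p\<^sub>Y (cost\<^sub>Y f) (stationary_policy \<phi>0)
          \<le> ereal ((\<integral>z. f z \<partial>m0) + w + C / 2 * (R * \<kappa> ^ t + real t * (\<eta> + s)))"
      by (rule approximating_policy_in_finite_model[OF \<gamma> \<eta>(1) erg(2) \<kappa> t m0])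
    note V0 = V0'[rule_format]
    have slack: "avg_cost MY MA ?\<gamma>Y p\<^sub>Y (?dY l) (stationary_policy \<phi>0) \<le> ereal (k l - (a - \<epsilon>d - B * s))"
      if l: "l \<in> {1..q}" for l
    proof (rule order_trans[OF V0[OF d[OF l]]])
      have "(\<integral>z. d l z \<partial>m0) + wd l + D l / 2 * (R * \<kappa> ^ t + real t * (\<eta> + s))
          = (\<integral>z. d l z \<partial>m0) + (wd l + D l / 2 * (R * \<kappa> ^ t + real t * \<eta>)) + D l / 2 * (real t * s)"
        by (simp add: algebra_simps)
      then show "ereal ((\<integral>z. d l z \<partial>m0) + wd l + D l / 2 * (R * \<kappa> ^ t + real t * (\<eta> + s)))
          \<le> ereal (k l - (a - \<epsilon>d - B * s))"
        using i0[rule_format, OF l] \<epsilon>d[OF l] BX(2)[OF less_imp_le[OF Dl[OF l]] DB[OF l] s] unfolding ereal_less_eq(3) by linarith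
    qed
    obtain m where m: "almost_invariant MY MA p\<^sub>Y s m"
      and md: "\<forall>l\<in>{1..q}. (\<integral>z. ?dY l z \<partial>m) \<le> k l - \<theta> * (a - \<epsilon>d - B * s) + s"
      and mc: "(\<integral>z. ?cY z \<partial>m) \<le> v + \<theta> * C + s"
      by (rule slater_mixture[OF \<gamma>Y fin_kernel_measurable cYm cYb fin_cost_measurable[OF cellwise_costD(2)[OF d]]
            fin_cost_abs_le[OF d] \<pi> stationary_policy_in_policies[OF \<phi>0] slack s \<theta>(1,2)])
    obtain \<phi> where \<phi>: "\<phi> \<in> stationary_policies MX MA"
      and V': "\<forall>C w f. cellwise_cost C w f \<longrightarrow>
        avg_cost MX MA \<gamma> p f (stationary_policy \<phi>)
          \<le> ereal ((\<integral>z. cost\<^sub>Y f z \<partial>m) + C * s + w + C / 2 * (R * \<kappa> ^ t + real t * (\<eta> + s)))"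
      by (rule approximating_policy_in_original_model[OF \<gamma> \<eta>(1) erg(1) \<kappa> t m])
    note V = V'[rule_format]
    have "avg_cost MX MA \<gamma> p (d l) (stationary_policy \<phi>) \<le> ereal (k l)" if l: "l \<in> {1..q}" for l
    proof (rule order_trans[OF V[OF d[OF l]]])
      have "(\<integral>z. ?dY l z \<partial>m) + D l * s + wd l + D l / 2 * (R * \<kappa> ^ t + real t * (\<eta> + s))
          = (\<integral>z. ?dY l z \<partial>m) + (wd l + D l / 2 * (R * \<kappa> ^ t + real t * \<eta>)) + (D l * s + D l / 2 * (real t * s))"
        by (simp add: algebra_simps)
      then show "ereal ((\<integral>z. ?dY l z \<partial>m) + D l * s + wd l + D l / 2 * (R * \<kappa> ^ t + real t * (\<eta> + s))) \<le> ereal (k l)"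
        using md[rule_format, OF l] \<epsilon>d[OF l] BX(1)[OF less_imp_le[OF Dl[OF l]] DB[OF l] s] \<theta>(3) unfolding ereal_less_eq(3) by linarith
    qed
    with stationary_policy_in_policies[OF \<phi>] have "stationary_policy \<phi> \<in> ?F"
      by (simp add: feasible_policies_def)
    moreover have "avg_cost MX MA \<gamma> p c (stationary_policy \<phi>) \<le> ereal (v + \<epsilon>c + \<theta> * C + B * s)"
    proof (rule order_trans[OF V[OF c]])
      have "(\<integral>z. ?cY z \<partial>m) + C * s + w + C / 2 * (R * \<kappa> ^ t + real t * (\<eta> + s))
          = (\<integral>z. ?cY z \<partial>m) + (w + C / 2 * (R * \<kappa> ^ t + real t * \<eta>)) + (C * s + C / 2 * (real t * s))"
        by (simp add: algebra_simps)
      then show "ereal ((\<integral>z. ?cY z \<partial>m) + C * s + w + C / 2 * (R * \<kappa> ^ t + real t * (\<eta> + s)))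
          \<le> ereal (v + \<epsilon>c + \<theta> * C + B * s)"
        using mc \<epsilon>c BX(1)[OF less_imp_le[OF C] CB s] unfolding ereal_less_eq(3) by linarith
    qed
    ultimately show ?thesis by blast
  qed
  \<comment> \<open>The weight for the harder direction; it also serves the other one.\<close>
  define \<theta> where "\<theta> s = (\<epsilon>d + B * s) / (a - \<epsilon>d - B * s)" for s
  have lim: "((\<lambda>s. v + \<epsilon>c + \<theta> s * C + B * s) \<longlongrightarrow> v + \<epsilon>c + \<epsilon>d / (a - \<epsilon>d) * C) (at_right 0)" for v
  proof -
    have "((\<lambda>s. v + \<epsilon>c + \<theta> s * C + B * s) \<longlongrightarrow> v + \<epsilon>c + (\<epsilon>d + B * 0) / (a - \<epsilon>d - B * 0) * C + B * 0) (at_right 0)"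
      unfolding \<theta>_def using small \<epsilon>d0 by (intro tendsto_intros) auto
    then show ?thesis by simp
  qed
  have ev: "\<forall>\<^sub>F s in at_right 0. 0 < s \<and> 0 \<le> \<theta> s \<and> \<theta> s \<le> 1 \<and> \<epsilon>d + B * s \<le> \<theta> s * a
      \<and> \<epsilon>d + B * s \<le> \<theta> s * (a - \<epsilon>d - B * s)"
  proof -
    have "((\<lambda>s. a - 2 * \<epsilon>d - 2 * (B * s)) \<longlongrightarrow> a - 2 * \<epsilon>d - 2 * (B * 0)) (at_right 0)"
      by (intro tendsto_intros)
    then have "\<forall>\<^sub>F s in at_right 0. 0 < a - 2 * \<epsilon>d - 2 * (B * s)"
      using small by (intro order_tendstoD(1)) auto
    moreover have "\<forall>\<^sub>F s in at_right (0::real). 0 < s" by (rule eventually_at_right_less)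
    ultimately show ?thesis
    proof eventually_elim
      case (elim s)
      have num: "0 \<le> \<epsilon>d + B * s" using \<epsilon>d0 B0 elim by simp
      with elim have den: "0 < a - \<epsilon>d - B * s" by linarith
      have eq: "\<theta> s * (a - \<epsilon>d - B * s) = \<epsilon>d + B * s" using den by (simp add: \<theta>_def)
      have "0 \<le> \<theta> s" using num den by (simp add: \<theta>_def)
      moreover have "\<theta> s \<le> 1" using elim den by (simp add: \<theta>_def)
      moreover have "\<theta> s * (a - \<epsilon>d - B * s) \<le> \<theta> s * a"
        using num \<open>0 \<le> \<theta> s\<close> by (intro mult_left_mono) auto
      ultimately show ?case using elim eq by simp
    qed
  qed
  have ratio: "\<epsilon>c + \<epsilon>d / (a - \<epsilon>d) * C \<le> \<epsilon>c + 2 * C / a * \<epsilon>d"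
  proof -
    have "\<epsilon>d / (a - \<epsilon>d) \<le> \<epsilon>d / (a / 2)" using \<epsilon>d0 small by (intro divide_left_mono) auto
    then have "\<epsilon>d / (a - \<epsilon>d) * C \<le> \<epsilon>d / (a / 2) * C" using C by (intro mult_right_mono) auto
    then show ?thesis by (simp add: mult.commute mult.left_commute)
  qed
  have "avg_cost MX MA \<gamma> p (d l) \<pi>0 \<le> ereal (k l)" if "l \<in> {1..q}" for l
    by (rule order_trans[OF \<pi>0(2)[OF that]]) (use a in simp)
  with \<pi>0(1) have \<pi>0F: "\<pi>0 \<in> ?F" by (simp add: feasible_policies_def)
  have "0 \<le> C" using C by simp
  obtain s0 where "0 < s0" "0 \<le> \<theta> s0" "\<theta> s0 \<le> 1" "\<epsilon>d + B * s0 \<le> \<theta> s0 * a"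
    using eventually_happens[OF ev] by auto
  from to_Y[OF \<pi>0F avg_cost_bounds(2)[OF \<gamma> p \<pi>0(1) cm cb] \<open>0 \<le> C\<close> this]
  have FY_ne: "?FY \<noteq> {}" by blast
  obtain V where V: "?V = ereal V"
    by (rule opt_value_finite[OF \<gamma> p cm cb, of q d k]) (use \<pi>0F in auto)
  obtain VY where VY: "?VY = ereal VY"
    by (rule opt_value_finite[OF \<gamma>Y fin_kernel_measurable cYm cYb, of q ?dY k]) (use FY_ne in auto)
  have "ereal (VY - (\<epsilon>c + 2 * C / a * \<epsilon>d)) \<le> ?V"
  proof (rule opt_value_le_real[OF \<gamma> p cm cb])
    fix \<pi> v assume \<pi>: "\<pi> \<in> ?F" "avg_cost MX MA \<gamma> p c \<pi> = ereal v" "0 \<le> v"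
    have "VY \<le> v + \<epsilon>c + \<epsilon>d / (a - \<epsilon>d) * C"
    proof (rule tendsto_lowerbound[OF lim])
      show "\<forall>\<^sub>F s in at_right 0. VY \<le> v + \<epsilon>c + \<theta> s * C + B * s"
        using ev
      proof eventually_elim
        case (elim s)
        then obtain \<psi> where \<psi>: "\<psi> \<in> ?FY" "avg_cost MY MA ?\<gamma>Y p\<^sub>Y ?cY \<psi> \<le> ereal (v + \<epsilon>c + \<theta> s * C + B * s)"
          using to_Y[OF \<pi>(1) _ \<pi>(3), of s "\<theta> s"] \<pi>(2) by auto
        have "?VY \<le> avg_cost MY MA ?\<gamma>Y p\<^sub>Y ?cY \<psi>" unfolding opt_value_def by (rule INF_lower[OF \<psi>(1)])
        with \<psi>(2) VY have "ereal VY \<le> ereal (v + \<epsilon>c + \<theta> s * C + B * s)" by (metis order_trans)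
        then show ?case by simp
      qed
    qed simp
    with ratio show "VY - (\<epsilon>c + 2 * C / a * \<epsilon>d) \<le> v" by linarith
  qed
  moreover have "ereal (V - (\<epsilon>c + 2 * C / a * \<epsilon>d)) \<le> ?VY"
  proof (rule opt_value_le_real[OF \<gamma>Y fin_kernel_measurable cYm cYb])
    fix \<pi> v assume \<pi>: "\<pi> \<in> ?FY" "avg_cost MY MA ?\<gamma>Y p\<^sub>Y ?cY \<pi> = ereal v" "0 \<le> v"
    have "V \<le> v + \<epsilon>c + \<epsilon>d / (a - \<epsilon>d) * C"
    proof (rule tendsto_lowerbound[OF lim])
      show "\<forall>\<^sub>F s in at_right 0. V \<le> v + \<epsilon>c + \<theta> s * C + B * s"
        using ev
      proof eventually_elim
        case (elim s)
        then obtain \<psi> where \<psi>: "\<psi> \<in> ?F" "avg_cost MX MA \<gamma> p c \<psi> \<le> ereal (v + \<epsilon>c + \<theta> s * C + B * s)"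
          using to_X[OF \<pi>(1) _ \<pi>(3), of s "\<theta> s"] \<pi>(2) by auto
        have "?V \<le> avg_cost MX MA \<gamma> p c \<psi>" unfolding opt_value_def by (rule INF_lower[OF \<psi>(1)])
        with \<psi>(2) V have "ereal V \<le> ereal (v + \<epsilon>c + \<theta> s * C + B * s)" by (metis order_trans)
        then show ?case by simp
      qed
    qed simp
    with ratio show "V - (\<epsilon>c + 2 * C / a * \<epsilon>d) \<le> v" by linarith
  qed
  ultimately show ?thesis by (simp add: V VY abs_le_iff)
qed

end

section \<open>The error terms\<close>

text \<open>
  Where it is positive, \<open>err_I4\<close> does not depend on the cost function, hence neither does the real minimiser of the
  error bound, and one number of steps serves the cost and all constraints.
\<close>

definition error_steps :: "nat \<Rightarrow> real \<Rightarrow> real \<Rightarrow> real \<Rightarrow> real \<Rightarrow> nat \<Rightarrow> nat" where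
  "error_steps dm R G \<alpha> \<kappa> n =
     max 1 (nat \<lceil>ln (real n powr (1 / real dm) / (G * \<alpha> / (R * ln (1 / \<kappa>)))) / ln (1 / \<kappa>)\<rceil>)"

lemma err_I4_eq:
  assumes "0 < err_I4 C R G \<alpha> \<kappa>"
  shows "C \<noteq> 0" "err_I4 C R G \<alpha> \<kappa> = G * \<alpha> / (R * ln (1 / \<kappa>))"
proof -
  show "C \<noteq> 0" using assms by (auto simp: err_I4_def err_I1_def)
  then show "err_I4 C R G \<alpha> \<kappa> = G * \<alpha> / (R * ln (1 / \<kappa>))"
    by (simp add: err_I4_def err_I3_def err_I1_def mult.assoc)
qed

text \<open>
  Rounding the real minimiser \<open>\<tau>\<close> up costs at most one more step, and for \<open>1 \<le> \<tau>\<close> the factor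
  \<open>C / 2\<close> in place of \<open>C\<close> absorbs the doubling.  For \<open>\<tau> < 1\<close> the one-step variation of the kernel
  inside a cell need not be small compared with \<open>R * \<kappa> powr \<tau>\<close> by its Lipschitz bound, but
  ergodicity after a single step bounds it by \<open>2 * R * \<kappa>\<close>.
\<close>

lemma error_at_integer_steps_le_err_term:
  assumes C: "0 < C" and R: "0 < R" and \<kappa>: "0 < \<kappa>" "\<kappa> < 1" and n: "1 \<le> n"
    and I4: "0 < err_I4 C R G \<alpha> \<kappa>" "err_I4 C R G \<alpha> \<kappa> \<le> real n powr (1 / real dm)"
  defines "h \<equiv> (1 / real n) powr (1 / real dm)"
  shows "2 * K * \<alpha> * h + C / 2 * (R * \<kappa> ^ error_steps dm R G \<alpha> \<kappa> n
      + real (error_steps dm R G \<alpha> \<kappa> n) * min (2 * G * \<alpha> * h) (2 * R * \<kappa>))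
    \<le> err_term dm C K R G \<alpha> \<kappa> n"
proof -
  define L where "L = ln (1 / \<kappa>)"
  define N where "N = real n powr (1 / real dm)"
  define g where "g = G * \<alpha>"
  have L: "0 < L" using \<kappa> by (simp add: L_def)
  have N: "0 < N" using n by (simp add: N_def)
  have h: "h = 1 / N" using n by (simp add: h_def N_def powr_divide)
  have i4: "err_I4 C R G \<alpha> \<kappa> = g / (R * L)"
    using err_I4_eq(2)[OF I4(1)] by (simp add: g_def L_def)
  have g: "0 < g" using I4(1) mult_pos_pos[OF R L] by (simp add: i4 zero_less_divide_iff)
  define \<tau> where "\<tau> = ln (N / (g / (R * L))) / L"
  have ge1: "1 \<le> N / (g / (R * L))"
    using I4 by (subst le_divide_eq_1_pos) (auto simp: i4 N_def)
  have \<tau>0: "0 \<le> \<tau>" using ge1 L by (simp add: \<tau>_def)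
  define E where "E = R * \<kappa> powr \<tau>"
  have "\<kappa> powr \<tau> = exp (- (\<tau> * L))" using \<kappa> by (simp add: powr_def L_def ln_div)
  also have "\<tau> * L = ln (N / (g / (R * L)))" using L by (simp add: \<tau>_def)
  also have "exp (- ln (N / (g / (R * L)))) = 1 / (N / (g / (R * L)))"
    using ge1 by (subst exp_minus, subst exp_ln) (auto simp: inverse_eq_divide)
  finally have E: "E = g / (L * N)" using R by (simp add: E_def)
  have err: "err_term dm C K R G \<alpha> \<kappa> n = 2 * K * \<alpha> * h + (2 * C * E + 2 * C * (g * h) * \<tau>)"
  proof -
    have "err_term dm C K R G \<alpha> \<kappa> n
        = (2 * C * R * (g / (R * L)) + 2 * K * \<alpha>) * h + 2 * C * g / L * h * ln (N / (g / (R * L)))"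
      by (simp add: err_term_def i4 err_I1_def err_I2_def err_I3_def L_def N_def h_def g_def mult.assoc)
    also have "ln (N / (g / (R * L))) = \<tau> * L" using L by (simp add: \<tau>_def)
    finally show ?thesis using R L N by (simp add: E h field_simps)
  qed
  define t where "t = error_steps dm R G \<alpha> \<kappa> n"
  have t: "t = max 1 (nat \<lceil>\<tau>\<rceil>)"
    by (simp add: t_def error_steps_def \<tau>_def N_def g_def L_def)
  have E0: "0 < E" using R \<kappa> by (simp add: E_def)
  have gh: "0 < g * h" using g N by (simp add: h)
  have "R * \<kappa> ^ t + real t * min (2 * (g * h)) (2 * R * \<kappa>) \<le> 4 * E + 4 * (g * h) * \<tau>"
  proof (cases "1 \<le> \<tau>")
    case True
    then have tt: "real t = of_int \<lceil>\<tau>\<rceil>" by (simp add: t max_def) linarith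
    then have "\<tau> \<le> real t" "real t \<le> 2 * \<tau>" using True by linarith+
    have "\<kappa> ^ t = \<kappa> powr real t" using \<kappa> by (simp add: powr_realpow)
    also have "\<dots> \<le> \<kappa> powr \<tau>" using \<kappa> \<open>\<tau> \<le> real t\<close> by (intro powr_mono') auto
    finally have "R * \<kappa> ^ t \<le> E" using R by (simp add: E_def)
    moreover have "real t * min (2 * (g * h)) (2 * R * \<kappa>) \<le> (2 * \<tau>) * (2 * (g * h))"
      using \<open>real t \<le> 2 * \<tau>\<close> gh R \<kappa> \<tau>0 by (intro mult_mono) auto
    ultimately show ?thesis using E0 by (simp add: mult.assoc mult.commute mult.left_commute)
  next
    case False
    then have "\<lceil>\<tau>\<rceil> \<le> 1" by linarith
    then have t1: "t = 1" by (simp add: t)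
    have "\<kappa> = \<kappa> powr 1" using \<kappa> by simp
    also have "\<dots> \<le> \<kappa> powr \<tau>" using \<kappa> False by (intro powr_mono') auto
    finally have RE: "R * \<kappa> \<le> E" using R by (simp add: E_def)
    have "R * \<kappa> ^ t + real t * min (2 * (g * h)) (2 * R * \<kappa>) \<le> 3 * (R * \<kappa>)" by (simp add: t1)
    also have "\<dots> \<le> 4 * E" using RE E0 by linarith
    also have "\<dots> \<le> 4 * E + 4 * (g * h) * \<tau>" using gh \<tau>0 by simp
    finally show ?thesis .
  qed
  from mult_left_mono[OF this, of "C / 2"] C
  show ?thesis unfolding err t_def[symmetric]
    by (simp add: algebra_simps g_def)
qed

section \<open>The concrete model\<close>

text \<open>
  On \<open>X \<times> A\<close> the product of the Borel algebras is used, which need not be the Borel algebra of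
  the product type when the type of actions is not second countable.  Composing with the
  finite-valued maps \<open>Q m\<close> shows that continuous functions are measurable nevertheless.
\<close>

lemma continuous_on_Times_measurable:
  fixes f :: "'x::topological_space \<times> 'a::topological_space \<Rightarrow> real"
  assumes f: "continuous_on (X \<times> A) f"
    and Q: "\<And>m. Q m \<in> bspace X \<rightarrow>\<^sub>M count_space (Y m)" "\<And>m. finite (Y m)" "\<And>m. Y m \<subseteq> X"
    and lim: "\<And>x. x \<in> X \<Longrightarrow> (\<lambda>m. Q m x) \<longlonglongrightarrow> x"
  shows "f \<in> borel_measurable (bspace X \<Otimes>\<^sub>M bspace A)"
proof (rule borel_measurable_LIMSEQ_real)
  fix m :: nat
  have "f \<in> borel_measurable (count_space (Y m) \<Otimes>\<^sub>M bspace A)"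
  proof (rule measurable_pair_measure_countable1)
    show "countable (Y m)" using Q(2) by (rule countable_finite)
    fix y assume "y \<in> Y m"
    then have "y \<in> X" using Q(3) by blast
    then have "continuous_on A (\<lambda>a. f (y, a))"
      by (intro continuous_on_compose2[OF f] continuous_intros) auto
    then show "(\<lambda>a. f (y, a)) \<in> borel_measurable (bspace A)"
      by (rule borel_measurable_continuous_on_restrict)
  qed
  moreover have "(\<lambda>z. (Q m (fst z), snd z)) \<in> bspace X \<Otimes>\<^sub>M bspace A \<rightarrow>\<^sub>M count_space (Y m) \<Otimes>\<^sub>M bspace A"
    using Q(1)[of m] by measurable
  ultimately show "(\<lambda>z. f (Q m (fst z), snd z)) \<in> borel_measurable (bspace X \<Otimes>\<^sub>M bspace A)"
    by (rule measurable_compose[rotated])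
next
  fix z assume z: "z \<in> space (bspace X \<Otimes>\<^sub>M bspace A)"
  then have zX: "fst z \<in> X" "snd z \<in> A" by (auto simp: space_pair_measure space_restrict_space)
  have "Q m (fst z) \<in> X" for m
    using measurable_space[OF Q(1), of "fst z" m] Q(3)[of m] zX by (auto simp: space_restrict_space)
  with zX have "(\<lambda>m. f (Q m (fst z), snd z)) \<longlonglongrightarrow> f (fst z, snd z)"
    by (intro continuous_on_tendsto_compose[OF f] tendsto_intros lim) (auto simp: mem_Times_iff)
  then show "(\<lambda>m. f (Q m (fst z), snd z)) \<longlonglongrightarrow> f z" by simp
qed

lemma abs_le_sup_norm:
  assumes "compact S" "continuous_on S f" "z \<in> S"
  shows "\<bar>f z\<bar> \<le> sup_norm S f"
proof -
  have "compact ((\<lambda>z. \<bar>f z\<bar>) ` S)"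
    by (intro compact_continuous_image assms continuous_intros)
  then have "bdd_above ((\<lambda>z. \<bar>f z\<bar>) ` S)" by (intro bounded_imp_bdd_above compact_imp_bounded)
  then show ?thesis unfolding sup_norm_def by (intro cSUP_upper assms)
qed

lemma measure_ge_integral_mixture:
  assumes N: "N \<in> space (prob_algebra M)" and P: "P \<in> M \<rightarrow>\<^sub>M prob_algebra K"
    and D: "D \<in> sets K" and le: "\<And>x. x \<in> space M \<Longrightarrow> b \<le> measure (P x) D"
  shows "b \<le> measure (N \<bind> P) D"
proof -
  have ind: "measure L D = (\<integral>y. indicator D y \<partial>L)" if "L \<in> space (prob_algebra K)" for L :: "'b measure"
    using prob_algebraD(2)[OF that] D sets.sets_into_space[of D L] by (simp add: Int_absorb2)
  have Dm: "(indicator D :: _ \<Rightarrow> real) \<in> borel_measurable K" using D by simp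
  have "measure (N \<bind> P) D = (\<integral>y. indicator D y \<partial>(N \<bind> P))"
    by (rule ind[OF bind_in_prob_algebra[OF N P]])
  also have "\<dots> = (\<integral>x. (\<integral>y. indicator D y \<partial>P x) \<partial>N)"
    by (rule integral_bind_kernel[OF N P Dm, where B=1]) auto
  also have "b \<le> \<dots>"
  proof (rule integral_between(1)[OF N kernel_integral_measurable[OF P Dm], of b 1])
    fix x assume x: "x \<in> space M"
    then have "b \<le> (\<integral>y. indicator D y \<partial>P x)"
      using le[OF x] ind[OF kernel_in_prob_algebra[OF P x]] by simp
    moreover have "(\<integral>y. indicator D y \<partial>P x) \<le> (1::real)"
      by (rule integral_between(2)[OF kernel_in_prob_algebra[OF P x] Dm, of 0 1]) auto
    ultimately show "b \<le> (\<integral>y. indicator D y \<partial>P x) \<and> (\<integral>y. indicator D y \<partial>P x) \<le> (1::real)" by simp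
  qed
  finally show ?thesis .
qed

text \<open>
  A minorization of the transition law is inherited by the kernels of all stationary policies, so
  that \<open>inv_measure\<close> is a genuine invariant law for each of them.
\<close>

lemma uniformly_ergodic_inv_measure:
  assumes p: "p \<in> MX \<Otimes>\<^sub>M MA \<rightarrow>\<^sub>M prob_algebra MX"
    and \<Lambda>: "\<Lambda> \<in> space (prob_algebra MX)" and b: "0 < b" "b < 1"
    and minor: "\<And>x a D. x \<in> space MX \<Longrightarrow> a \<in> space MA \<Longrightarrow> D \<in> sets MX \<Longrightarrow> b * measure \<Lambda> D \<le> measure (p (x, a)) D"
    and erg: "\<forall>\<phi>\<in>stationary_policies MX MA. \<forall>t\<ge>1. \<forall>x\<in>space MX.
      tv_dist (kernel_pow MX (policy_kernel p \<phi>) t x) (inv_measure MX (policy_kernel p \<phi>)) \<le> R * \<kappa> ^ t"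
  shows "uniformly_ergodic MX MA p R \<kappa>"
  unfolding uniformly_ergodic_def
proof
  fix \<phi> assume \<phi>: "\<phi> \<in> stationary_policies MX MA"
  have "inv_measure MX (policy_kernel p \<phi>) \<in> space (prob_algebra MX)"
  proof (rule doeblin_inv_measure[OF policy_kernel_measurable[OF p \<phi>] \<Lambda> b])
    fix x D assume x: "x \<in> space MX" and D: "D \<in> sets MX"
    show "b * measure \<Lambda> D \<le> measure (policy_kernel p \<phi> x) D"
      unfolding policy_kernel_def
    proof (rule measure_ge_integral_mixture[OF _ _ D])
      show "\<phi> x \<in> space (prob_algebra MA)"
        using \<phi> x by (simp add: stationary_policies_def kernel_in_prob_algebra)
      show "(\<lambda>a. p (x, a)) \<in> MA \<rightarrow>\<^sub>M prob_algebra MX"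
        using measurable_compose[OF measurable_Pair1'[OF x] p] .
    qed (rule minor[OF x _ D])
  qed
  with erg \<phi> show "\<exists>\<mu>\<in>space (prob_algebra MX). \<forall>t\<ge>1. \<forall>x\<in>space MX.
      tv_dist (kernel_pow MX (policy_kernel p \<phi>) t x) \<mu> \<le> R * \<kappa> ^ t"
    by (intro bexI[of _ "inv_measure MX (policy_kernel p \<phi>)"]) simp_all
qed

text \<open>Ergodicity after one step under the policy that always plays \<open>a\<close>.\<close>

lemma uniformly_ergodic_kernel_variation:
  assumes p: "p \<in> MX \<Otimes>\<^sub>M MA \<rightarrow>\<^sub>M prob_algebra MX" and erg: "uniformly_ergodic MX MA p R \<kappa>"
    and x: "x \<in> space MX" and z: "z \<in> space MX" and a: "a \<in> space MA" and g: "g \<in> test_functions MX"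
  shows "\<bar>(\<integral>y. g y \<partial>p (x, a)) - (\<integral>y. g y \<partial>p (z, a))\<bar> \<le> 2 * R * \<kappa>"
proof -
  let ?\<phi> = "\<lambda>_. return MA a"
  have \<phi>: "?\<phi> \<in> stationary_policies MX MA"
    using a by (auto simp: stationary_policies_def space_prob_algebra prob_space_return intro!: measurable_const)
  obtain \<mu> where \<mu>: "\<mu> \<in> space (prob_algebra MX)"
    and r: "\<forall>t\<ge>1. \<forall>x\<in>space MX. tv_dist (kernel_pow MX (policy_kernel p ?\<phi>) t x) \<mu> \<le> R * \<kappa> ^ t"
    by (rule uniformly_ergodicE[OF erg \<phi>])
  have near: "\<bar>(\<integral>y. g y \<partial>p (x, a)) - (\<integral>y. g y \<partial>\<mu>)\<bar> \<le> R * \<kappa>" if x: "x \<in> space MX" for x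
  proof -
    note P = policy_kernel_measurable[OF p \<phi>]
    have pa: "(\<lambda>a. p (x, a)) \<in> MA \<rightarrow>\<^sub>M prob_algebra MX"
      using measurable_compose[OF measurable_Pair1'[OF x] p] .
    have "kernel_pow MX (policy_kernel p ?\<phi>) 1 x = return MX x \<bind> policy_kernel p ?\<phi>" by simp
    also have "\<dots> = policy_kernel p ?\<phi> x" by (rule bind_return[OF measurable_prob_algebraD[OF P] x])
    also have "\<dots> = p (x, a)"
      unfolding policy_kernel_def by (rule bind_return[OF measurable_prob_algebraD[OF pa] a])
    finally have eq: "kernel_pow MX (policy_kernel p ?\<phi>) 1 x = p (x, a)" .
    have "(x, a) \<in> space (MX \<Otimes>\<^sub>M MA)" using x a by (simp add: space_pair_measure)
    from abs_integral_diff_le_tv_dist[OF kernel_in_prob_algebra[OF p this] \<mu> g]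
    show ?thesis using r[rule_format, of 1 x] x unfolding eq by simp
  qed
  from near[OF x] near[OF z] show ?thesis by linarith
qed

theorem theorem9:
  fixes X :: "'x::euclidean_space set"
    and A :: "'a::metric_space set"
    and p :: "'x \<times> 'a \<Rightarrow> 'x measure"
    and c :: "'x \<times> 'a \<Rightarrow> real"
    and q :: nat
    and d :: "nat \<Rightarrow> 'x \<times> 'a \<Rightarrow> real"
    and \<gamma> :: "'x measure"
    and k \<alpha>' :: "nat \<Rightarrow> real"
    and \<alpha> :: real
    and Y :: "nat \<Rightarrow> 'x set"
    and Q :: "nat \<Rightarrow> 'x \<Rightarrow> 'x"
    and \<nu> :: "nat \<Rightarrow> 'x measure"
    and R \<kappa>0 Kc Gp :: real
    and K :: "nat \<Rightarrow> real"
    and n :: nat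
  defines "MX \<equiv> bspace X"
    and "MA \<equiv> bspace A"
  defines "\<epsilon>c \<equiv> (\<lambda>m. err_term DIM('x) (sup_norm (X \<times> A) c) Kc R Gp \<alpha> \<kappa>0 m)"
    and "\<epsilon>max \<equiv> (\<lambda>m. Max ((\<lambda>l. err_term DIM('x) (sup_norm (X \<times> A) (d l)) (K l) R Gp \<alpha> \<kappa>0 m) ` {1..q}))"
  assumes X: "compact X"
    and A: "compact A"
    and p: "p \<in> MX \<Otimes>\<^sub>M MA \<rightarrow>\<^sub>M prob_algebra MX"
    and c: "continuous_on (X \<times> A) c" "\<forall>z\<in>X \<times> A. 0 \<le> c z"
    and q: "1 \<le> q"
    and d: "\<forall>l\<in>{1..q}. continuous_on (X \<times> A) (d l) \<and> (\<forall>z\<in>X \<times> A. 0 \<le> d l z)"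
    and \<gamma>: "\<gamma> \<in> space (prob_algebra MX)"
    and k: "\<forall>l\<in>{1..q}. 0 \<le> k l"
    and slater: "\<forall>l\<in>{1..q}. 0 < \<alpha>' l"
      "\<exists>\<pi>\<in>policies MX MA. \<forall>l\<in>{1..q}. avg_cost MX MA \<gamma> p (d l) \<pi> + ereal (\<alpha>' l) = ereal (k l)"
    and \<alpha>: "0 < \<alpha>"
    and Y: "\<forall>m\<ge>1. Y m \<subseteq> X \<and> finite (Y m) \<and> card (Y m) = m \<and>
      (\<forall>x\<in>X. Min (dist x ` Y m) \<le> \<alpha> * (1 / real m) powr (1 / DIM('x)))"
    and Q: "\<forall>m\<ge>1. nearest_point_map X (Y m) (Q m)"
    and \<nu>: "\<forall>m\<ge>1. finite_measure (\<nu> m) \<and> sets (\<nu> m) = sets MX \<and>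
      (\<forall>y\<in>Y m. 0 < emeasure (\<nu> m) (cell X (Q m) y))"
    and R: "0 < R"
    and \<kappa>0: "0 < \<kappa>0" "\<kappa>0 < 1"
    and ergodic_p: "\<forall>\<phi>\<in>stationary_policies MX MA. \<forall>t\<ge>1. \<forall>x\<in>X.
      tv_dist (kernel_pow MX (policy_kernel p \<phi>) t x)
              (inv_measure MX (policy_kernel p \<phi>)) \<le> R * \<kappa>0 ^ t"
    and ergodic_q: "\<forall>m\<ge>1. \<forall>\<phi>\<in>stationary_policies MX MA. \<forall>t\<ge>1. \<forall>x\<in>X.
      tv_dist (kernel_pow MX (policy_kernel (ext_kernel X (Q m) (\<nu> m) p) \<phi>) t x)
              (inv_measure MX (policy_kernel (ext_kernel X (Q m) (\<nu> m) p) \<phi>)) \<le> R * \<kappa>0 ^ t"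
    and p_cont: "\<forall>z\<in>X \<times> A. ((\<lambda>w. tv_dist (p w) (p z)) \<longlongrightarrow> 0) (at z within X \<times> A)"
    and minorization: "\<exists>\<Lambda>\<in>space (prob_algebra MX). \<exists>\<alpha>0 \<phi>. 0 < \<alpha>0 \<and> \<alpha>0 < 1 \<and>
      \<phi> \<in> borel_measurable (MX \<Otimes>\<^sub>M MA) \<and> (\<exists>B. \<forall>z\<in>X \<times> A. \<bar>\<phi> z\<bar> \<le> B) \<and>
      (\<forall>z\<in>X \<times> A. 1 - \<alpha>0 \<le> \<phi> z \<and> (\<forall>D\<in>sets MX. measure \<Lambda> D * \<phi> z \<le> measure (p z) D))"
    and c_lip: "\<forall>a\<in>A. Kc-lipschitz_on X (\<lambda>x. c (x, a))"
    and d_lip: "\<forall>l\<in>{1..q}. \<forall>a\<in>A. (K l)-lipschitz_on X (\<lambda>x. d l (x, a))"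
    and p_lip: "\<forall>x\<in>X. \<forall>y\<in>X. \<forall>a\<in>A. tv_dist (p (x, a)) (p (y, a)) \<le> Gp * dist x y"
    and I4_pos: "0 < err_I4 (sup_norm (X \<times> A) c) R Gp \<alpha> \<kappa>0"
      "\<forall>l\<in>{1..q}. 0 < err_I4 (sup_norm (X \<times> A) (d l)) R Gp \<alpha> \<kappa>0"
    and n: "1 \<le> n" "err_I4 (sup_norm (X \<times> A) c) R Gp \<alpha> \<kappa>0 \<le> real n powr (1 / DIM('x))"
    and small: "\<epsilon>max n < 1 / 2 * Min (\<alpha>' ` {1..q})"
  shows "\<bar>opt_value (count_space (Y n)) MA (distr \<gamma> (count_space (Y n)) (Q n))
            (fin_kernel X (Y n) (Q n) (\<nu> n) p) (fin_cost X (Q n) (\<nu> n) c)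
            q (\<lambda>l. fin_cost X (Q n) (\<nu> n) (d l)) k
          - opt_value MX MA \<gamma> p c q d k\<bar>
         \<le> ereal (2 * \<epsilon>c n + 4 * sup_norm (X \<times> A) c / Min (\<alpha>' ` {1..q}) * \<epsilon>max n)"
proof -
  define h where "h m = (1 / real m) powr (1 / real DIM('x))" for m :: nat
  define T where "T = error_steps DIM('x) R Gp \<alpha> \<kappa>0 n"
  \<comment> \<open>The first entry is the Lipschitz bound, as points of one cell are at distance at most
    \<open>2 * \<alpha> * h n\<close>; the second one comes from ergodicity after one step.\<close>
  define \<eta> where "\<eta> = min (2 * Gp * \<alpha> * h n) (2 * R * \<kappa>0)"
  have spX: "space MX = X" and spA: "space MA = A"
    by (simp_all add: MX_def MA_def space_restrict_space)
  have sp: "space (MX \<Otimes>\<^sub>M MA) = X \<times> A" by (simp add: space_pair_measure spX spA)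
  obtain \<pi>0 where \<pi>0: "\<pi>0 \<in> policies MX MA"
    and sl: "\<And>l. l \<in> {1..q} \<Longrightarrow> avg_cost MX MA \<gamma> p (d l) \<pi>0 + ereal (\<alpha>' l) = ereal (k l)"
    using slater(2) by auto
  obtain x0 where x0: "x0 \<in> X"
    using prob_space.not_empty[OF prob_algebraD(1)[OF \<gamma>]] prob_algebraD(3)[OF \<gamma>] spX by auto
  \<comment> \<open>There is an action, as the strictly feasible policy has to draw one.\<close>
  obtain a0 where a0: "a0 \<in> A"
  proof -
    have "\<pi>0 0 \<in> hist_space MX MA 0 \<rightarrow>\<^sub>M prob_algebra MA" using \<pi>0 by (simp add: policies_def)
    moreover have "(\<lambda>_. undefined, x0) \<in> space (hist_space MX MA 0)"
      using x0 by (simp add: hist_space_def space_pair_measure space_PiM spX)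
    ultimately have P: "\<pi>0 0 (\<lambda>_. undefined, x0) \<in> space (prob_algebra MA)" by (rule measurable_space)
    from prob_space.not_empty[OF prob_algebraD(1)[OF P]] prob_algebraD(3)[OF P] spA that
    show thesis by auto
  qed
  have compact: "compact (X \<times> A)" using X A by (rule compact_Times)

  have h0: "0 \<le> h m" for m by (simp add: h_def)
  have near: "dist x (Q m x) \<le> \<alpha> * h m" if m: "1 \<le> m" and x: "x \<in> X" for m x
  proof -
    have Ym: "finite (Y m)" "card (Y m) = m" "Min (dist x ` Y m) \<le> \<alpha> * h m"
      using Y m x by (auto simp: h_def)
    have "Min (dist x ` Y m) \<in> dist x ` Y m" by (rule Min_in) (use Ym m in auto)
    then obtain y where y: "y \<in> Y m" "Min (dist x ` Y m) = dist x y" by blast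
    have "dist x (Q m x) \<le> dist x y" using Q m x y(1) by (auto simp: nearest_point_map_def)
    with y(2) Ym(3) show ?thesis by simp
  qed
  have Qm: "Q m \<in> MX \<rightarrow>\<^sub>M count_space (Y m)" if "1 \<le> m" for m
    using Q that by (simp add: nearest_point_map_def MX_def)
  have Q_lim: "(\<lambda>m. Q (Suc m) x) \<longlonglongrightarrow> x" if x: "x \<in> X" for x
  proof (rule metric_tendsto_imp_tendsto)
    have "(\<lambda>m. 1 / real (Suc m)) \<longlonglongrightarrow> 0" using LIMSEQ_Suc[OF lim_const_over_n[of 1]] by simp
    then have "(\<lambda>m. (1 / real (Suc m)) powr (1 / real DIM('x))) \<longlonglongrightarrow> 0 powr (1 / real DIM('x))"
      by (intro tendsto_powr' tendsto_const) (auto simp: DIM_positive)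
    then have "(\<lambda>m. \<alpha> * h (Suc m)) \<longlonglongrightarrow> \<alpha> * (0 powr (1 / real DIM('x)))"
      unfolding h_def by (rule tendsto_mult_left)
    then show "(\<lambda>m. \<alpha> * h (Suc m)) \<longlonglongrightarrow> 0" by simp
    show "\<forall>\<^sub>F m in sequentially. dist (Q (Suc m) x) x \<le> dist (\<alpha> * h (Suc m)) 0"
    proof (rule always_eventually, rule allI)
      fix m
      have "0 \<le> \<alpha> * h (Suc m)" using \<alpha> h0 by simp
      with near[OF _ x, of "Suc m"] show "dist (Q (Suc m) x) x \<le> dist (\<alpha> * h (Suc m)) 0"
        by (simp add: dist_commute dist_real_def)
    qed
  qed

  interpret fa: finite_approximation MX MA p "Y n" "Q n" "\<nu> n"
  proof (rule finite_approximation.intro[OF p Qm[OF n(1)]])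
    show "finite (Y n)" using Y n(1) by blast
    show "finite_measure (\<nu> n)" "sets (\<nu> n) = sets MX" using \<nu> n(1) by blast+
    show "0 < emeasure (\<nu> n) (cell (space MX) (Q n) y)" if "y \<in> Y n" for y
      unfolding spX using \<nu> n(1) that by blast
  qed
  have same_cell: "dist x z \<le> 2 * \<alpha> * h n" if "x \<in> X" "z \<in> X" "Q n x = Q n z" for x z
  proof -
    have "dist x z \<le> dist x (Q n x) + dist z (Q n x)" by (rule dist_triangle2)
    also have "\<dots> = dist x (Q n x) + dist z (Q n z)" by (simp only: that(3))
    also have "\<dots> \<le> \<alpha> * h n + \<alpha> * h n"
      by (intro add_mono near[OF n(1)] that)
    finally show ?thesis by simp
  qed

  have Gp: "0 < Gp"
  proof -
    have "0 < Gp * \<alpha> / (R * ln (1 / \<kappa>0))" using I4_pos(1) err_I4_eq(2)[OF I4_pos(1)] by simp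
    moreover have "0 < R * ln (1 / \<kappa>0)" using R \<kappa>0 by simp
    ultimately show ?thesis using \<alpha> by (simp add: zero_less_divide_iff zero_less_mult_iff)
  qed
  have \<eta>0: "0 \<le> \<eta>" using Gp \<alpha> h0 R \<kappa>0 by (simp add: \<eta>_def)

  obtain \<Lambda> \<alpha>0 \<phi>0 where \<Lambda>: "\<Lambda> \<in> space (prob_algebra MX)" and \<alpha>0: "0 < \<alpha>0" "\<alpha>0 < 1"
    and minor0: "\<forall>z\<in>X \<times> A. 1 - \<alpha>0 \<le> \<phi>0 z \<and> (\<forall>D\<in>sets MX. measure \<Lambda> D * \<phi>0 z \<le> measure (p z) D)"
    using minorization by blast
  have minor: "(1 - \<alpha>0) * measure \<Lambda> D \<le> measure (p (x, a)) D"
    if "x \<in> space MX" "a \<in> space MA" "D \<in> sets MX" for x a D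
  proof -
    have z: "(x, a) \<in> X \<times> A" using that by (simp add: spX spA)
    have "(1 - \<alpha>0) * measure \<Lambda> D \<le> \<phi>0 (x, a) * measure \<Lambda> D"
      using minor0 z by (intro mult_right_mono) auto
    also have "\<dots> \<le> measure (p (x, a)) D" using minor0 z that(3) by (simp add: mult.commute)
    finally show ?thesis .
  qed
  have minor_ext: "(1 - \<alpha>0) * measure \<Lambda> D \<le> measure (ext_kernel (space MX) (Q n) (\<nu> n) p (x, a)) D"
    if x: "x \<in> space MX" and a: "a \<in> space MA" and D: "D \<in> sets MX" for x a D
    unfolding ext_kernel_def split
    by (rule measure_ge_integral_mixture[OF fa.cell_measure_prob[OF fa.Q_space[OF x]]
          measurable_compose[OF measurable_Pair2'[OF a] p] D minor[OF _ a D]])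
  have b: "0 < 1 - \<alpha>0" "1 - \<alpha>0 < 1" using \<alpha>0 by auto
  have erg_p: "uniformly_ergodic MX MA p R \<kappa>0"
    by (rule uniformly_ergodic_inv_measure[OF p \<Lambda> b minor]) (use ergodic_p in \<open>simp_all add: spX\<close>)
  have erg_q: "uniformly_ergodic MX MA (ext_kernel (space MX) (Q n) (\<nu> n) p) R \<kappa>0"
    by (rule uniformly_ergodic_inv_measure[OF fa.ext_kernel_measurable \<Lambda> b minor_ext])
       (use ergodic_q n(1) in \<open>simp_all add: spX\<close>)

  have kernel: "fa.kernel_variation_le \<eta>"
    unfolding fa.kernel_variation_le_def
  proof (intro ballI impI)
    fix x z a g
    assume x: "x \<in> space MX" and z: "z \<in> space MX" and Qxz: "Q n x = Q n z"
      and a: "a \<in> space MA" and g: "g \<in> test_functions MX"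
    have P: "p (x, a) \<in> space (prob_algebra MX)" "p (z, a) \<in> space (prob_algebra MX)"
      using kernel_in_prob_algebra[OF p] x z a by (auto simp: space_pair_measure)
    have "\<bar>(\<integral>y. g y \<partial>p (x, a)) - (\<integral>y. g y \<partial>p (z, a))\<bar> \<le> tv_dist (p (x, a)) (p (z, a))"
      by (rule abs_integral_diff_le_tv_dist[OF P g])
    also have "\<dots> \<le> Gp * dist x z" using p_lip x z a by (simp add: spX spA)
    also have "\<dots> \<le> Gp * (2 * \<alpha> * h n)"
      using same_cell[of x z] x z Qxz Gp by (intro mult_left_mono) (auto simp: spX)
    finally show "\<bar>(\<integral>y. g y \<partial>p (x, a)) - (\<integral>y. g y \<partial>p (z, a))\<bar> \<le> \<eta>"
      using uniformly_ergodic_kernel_variation[OF p erg_p x z a g] by (simp add: \<eta>_def algebra_simps)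
  qed

  have cost: "fa.cellwise_cost (sup_norm (X \<times> A) f) (2 * L * \<alpha> * h n) f"
    and norm_pos: "0 < sup_norm (X \<times> A) f" and L0: "0 \<le> L"
    if f: "continuous_on (X \<times> A) f" "\<forall>z\<in>X \<times> A. 0 \<le> f z"
      and lip: "\<forall>a\<in>A. L-lipschitz_on X (\<lambda>x. f (x, a))"
      and I4: "0 < err_I4 (sup_norm (X \<times> A) f) R Gp \<alpha> \<kappa>0" for f L
  proof -
    have fb: "\<bar>f z\<bar> \<le> sup_norm (X \<times> A) f" if "z \<in> X \<times> A" for z
      by (rule abs_le_sup_norm[OF compact f(1) that])
    have "0 \<le> sup_norm (X \<times> A) f" using fb[of "(x0, a0)"] x0 a0 by auto
    with err_I4_eq(1)[OF I4] show pos: "0 < sup_norm (X \<times> A) f" by simp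
    show L: "0 \<le> L" using lip a0 lipschitz_on_nonneg by blast
    have "f \<in> borel_measurable (MX \<Otimes>\<^sub>M MA)"
      unfolding MX_def MA_def
      by (rule continuous_on_Times_measurable[OF f(1), where Q="\<lambda>m. Q (Suc m)" and Y="\<lambda>m. Y (Suc m)"])
         (use Qm Y Q_lim in \<open>auto simp: MX_def\<close>)
    moreover have "\<bar>f (x, a) - f (z, a)\<bar> \<le> 2 * L * \<alpha> * h n"
      if "x \<in> X" "z \<in> X" "Q n x = Q n z" "a \<in> A" for x z a
    proof -
      have "\<bar>f (x, a) - f (z, a)\<bar> \<le> L * dist x z"
        using lipschitz_onD[OF lip[rule_format, OF that(4)] that(1,2)] by (simp add: dist_real_def)
      also have "\<dots> \<le> L * (2 * \<alpha> * h n)" by (rule mult_left_mono[OF same_cell[OF that(1-3)] L])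
      finally show ?thesis by (simp add: algebra_simps)
    qed
    moreover have "0 \<le> f z \<and> f z \<le> sup_norm (X \<times> A) f" if "z \<in> X \<times> A" for z
      using f(2) fb[OF that] that by auto
    ultimately show "fa.cellwise_cost (sup_norm (X \<times> A) f) (2 * L * \<alpha> * h n) f"
      unfolding fa.cellwise_cost_def sp spX spA using pos by blast
  qed
  let ?C = "sup_norm (X \<times> A) c" and ?D = "\<lambda>l. sup_norm (X \<times> A) (d l)"
  let ?e = "R * \<kappa>0 ^ T + real T * \<eta>"
  have e0: "0 \<le> ?e" using R \<kappa>0 \<eta>0 by simp
  have dc: "continuous_on (X \<times> A) (d l)" "\<forall>z\<in>X \<times> A. 0 \<le> d l z"
    "\<forall>a\<in>A. (K l)-lipschitz_on X (\<lambda>x. d l (x, a))" "0 < err_I4 (?D l) R Gp \<alpha> \<kappa>0"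
    if "l \<in> {1..q}" for l
    using d d_lip I4_pos(2) that by auto
  note cc = c c_lip I4_pos(1)
  have bound: "2 * L * \<alpha> * h n + S / 2 * ?e \<le> err_term DIM('x) S L R Gp \<alpha> \<kappa>0 n"
    if S: "0 < S" and I4: "0 < err_I4 S R Gp \<alpha> \<kappa>0" for S L
  proof -
    have "err_I4 S R Gp \<alpha> \<kappa>0 = err_I4 ?C R Gp \<alpha> \<kappa>0"
      using err_I4_eq(2)[OF I4] err_I4_eq(2)[OF I4_pos(1)] by simp
    with error_at_integer_steps_le_err_term[OF S R \<kappa>0 n(1) I4, of "DIM('x)" L] n(2)
    show ?thesis by (simp add: h_def \<eta>_def T_def)
  qed
  have pos: "0 \<le> 2 * L * \<alpha> * h n + S / 2 * ?e" if "0 < S" "0 \<le> L" for S L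
    using that \<alpha> h0 mult_nonneg_nonneg[OF _ e0, of "S / 2"] by (intro add_nonneg_nonneg) auto
  have \<epsilon>c: "2 * Kc * \<alpha> * h n + ?C / 2 * ?e \<le> \<epsilon>c n"
    unfolding \<epsilon>c_def by (rule bound[OF norm_pos[OF cc] I4_pos(1)])
  then have \<epsilon>c0: "0 \<le> \<epsilon>c n" using pos[OF norm_pos[OF cc] L0[OF cc]] by linarith
  have \<epsilon>d: "2 * K l * \<alpha> * h n + ?D l / 2 * ?e \<le> \<epsilon>max n" if l: "l \<in> {1..q}" for l
  proof (rule order_trans[OF bound[OF norm_pos[OF dc[OF l]] dc(4)[OF l]]])
    show "err_term DIM('x) (?D l) (K l) R Gp \<alpha> \<kappa>0 n \<le> \<epsilon>max n"
      unfolding \<epsilon>max_def by (rule Max_ge) (use l in auto)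
  qed
  have q1: "1 \<in> {1..q}" using q by simp
  have \<epsilon>d0: "0 \<le> \<epsilon>max n"
    using \<epsilon>d[OF q1] pos[OF norm_pos[OF dc[OF q1]] L0[OF dc[OF q1]]] by linarith
  define a where "a = Min (\<alpha>' ` {1..q})"
  have small': "\<epsilon>max n < a / 2" using small by (simp add: a_def)
  have strict: "avg_cost MX MA \<gamma> p (d l) \<pi>0 \<le> ereal (k l - a)" if l: "l \<in> {1..q}" for l
  proof -
    have "a \<le> \<alpha>' l" unfolding a_def by (rule Min_le) (use l in auto)
    then show ?thesis using sl[OF l] by (cases "avg_cost MX MA \<gamma> p (d l) \<pi>0") auto
  qed
  have t1: "1 \<le> T" by (simp add: T_def error_steps_def)
  have "\<bar>opt_value (count_space (Y n)) MA (distr \<gamma> (count_space (Y n)) (Q n))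
        (fin_kernel (space MX) (Y n) (Q n) (\<nu> n) p) (fin_cost (space MX) (Q n) (\<nu> n) c)
        q (\<lambda>l. fin_cost (space MX) (Q n) (\<nu> n) (d l)) k
      - opt_value MX MA \<gamma> p c q d k\<bar> \<le> ereal (\<epsilon>c n + 2 * ?C / a * \<epsilon>max n)"
    by (rule fa.optimal_values_close[OF \<gamma> kernel \<eta>0 erg_p erg_q \<kappa>0 t1 cost[OF cc] cost[OF dc] \<epsilon>c \<epsilon>d \<epsilon>d0
          small' \<pi>0 strict])
  also have "ereal (\<epsilon>c n + 2 * ?C / a * \<epsilon>max n) \<le> ereal (2 * \<epsilon>c n + 4 * ?C / a * \<epsilon>max n)"
  proof -
    have "0 \<le> ?C / a * \<epsilon>max n" using norm_pos[OF cc] \<epsilon>d0 small' by simp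
    then show ?thesis using \<epsilon>c0 by simp
  qed
  finally show ?thesis by (simp only: spX a_def)
qed

end
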